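(* Let $(\mathcal{E},d,\preceq)$ be an ordered Polish space and let $P$ be a stochastically monotone Markov kernel on $\mathcal{E}$. Assume that conditions (BMC) and (PR) (stated in the context) hold and that the set $M=\{(x,y)\in\mathcal{E}\times\mathcal{E}: x\preceq y\}$ is achievable; fix, for every $(x,y)\in\mathcal{E}\times\mathcal{E}$, a marginally Markovian $(x,y)$-coupling for which $\tau_{x,y}(M)=\min\{n\ge 0: (X_n^x,X_n^y)\in M\}$ is almost surely finite. Then there exists a unique stationary measure (stationary probability distribution) $\pi$, and the following hold: (i) For any $x,y\in\mathcal{E}$ and every $n$, $$\sup_{g\in\mathcal{G}}\big|\mathbf{E}g(X_n^x)-\mathbf{E}g(X_n^y)\big|\le\max\Big\{\mathbf{P}\big(\tau_{x,y}(M)>n\big),\ \mathbf{P}\big(\tau_{y,x}(M)>n\big)\Big\},$$ and the right-hand side tends to $0$ as $n\to\infty$. (ii) For each $x\in\mathcal{E}$, $$\lim_{n\to\infty}\sup_{g\in\mathcal{G}}\Big|\mathbf{E}g(X_n^x)-\int g(y)\,d\pi(y)\Big|\le \lim_{n\to\infty}\sup_{g\in\mathcal{G}}\int\big|\mathbf{E}g(X_n^x)-\mathbf{E}g(X_n^y)\big|\,d\pi(y)=0.$$ (iii) If, in addition, $\mathcal{E}$ is KS-normal, then, for every $y\in\mathcal{E}$, the distribution of $X_n^y$ converges to $\pi$ weakly as $n\to\infty$. (iv) If, for some $x\in\mathcal{E}$, the laws of $X_n^x$, $n\in\mathbb{N}_0$, are tight, then they converge to $\pi$ weakly (even if $\mathcal{E}$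 is not KS-normal). If, in addition, $(\beta_n)$ is a sequence of real numbers such that for every $n$ $$\sup_{x,y\in\mathcal{E}}\mathbf{P}\big(\tau_{x,y}(M)>n\big)\le\beta_n,$$ then for every $x\in\mathcal{E}$ and every $n$ $$\sup_{g\in\mathcal{G}}\Big|\mathbf{E}g(X_n^x)-\int g(y)\,d\pi(y)\Big|\le\beta_n,$$ and, in particular, $$\sup_{I\in\mathcal{I}}\big|\mathbf{P}(X_n^x\in I)-\pi(I)\big|\le\beta_n.$$
   Context: An ordered Polish space is a Polish (complete separable metric) space $(\mathcal{E},d)$ with its Borel $\sigma$-algebra and a partial order $\preceq$ such that $M=\{(x,y): x\preceq y\}$ is closed in $\mathcal{E}\times\mathcal{E}$. $\mathcal{G}$ denotes the set of all measurable functions $g:\mathcal{E}\to[0,1]$ that are increasing ($x\preceq y\Rightarrow g(x)\le g(y)$). $\mathcal{I}$ denotes the collection of all measurable increasing sets, i.e. Borel sets $I\subseteq\mathcal{E}$ such that $x\in I$ and $x\preceq y$ imply $y\in I$. A Markov kernel $P(x,A)$ on $\mathcal{E}$ is a probability measure in $A$ for each $x$ and measurable in $x$ for each Borel $A$; no Feller property is assumed. $P$ is stochastically monotone if $g\in\mathcal{G}$ implies $Pg\in\mathcal{G}$, where $Pg(x)=\int g(y)P(x,dy)$. $(X_n^x)_{n\in\mathbb{N}_0}$ denotes the time-homogeneous Markov chain with kernel $P$ and $X_0^x=x$. A stationary distribution is a probability measure $\pi$ with $\int P(x,\cdot)\,d\pi(x)=\pi$. Condition (BMC): whenever $x_1\preceq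 x_2\preceq\cdots$ is an increasing sequence in $\mathcal{E}$ with $x_n\preceq y$ for all $n$ for some $y\in\mathcal{E}$, the sequence $(x_n)$ converges to some $x\in\mathcal{E}$. Condition (PR): there are two points $x_0\preceq y_0$ in $\mathcal{E}$ such that the hitting times $\nu^-=\min\{n\ge1: X_n^{x_0}\succeq x_0\}$ and $\nu^+=\min\{n\ge1: X_n^{y_0}\preceq y_0\}$ have finite expectations. For $x,y\in\mathcal{E}$, a marginally Markovian $(x,y)$-coupling is a sequence of pairs $(X_n^x,X_n^y)_{n\in\mathbb{N}_0}$ of $\mathcal{E}$-valued random variables on a common probability space with $X_0^x=x$, $X_0^y=y$, such that for every $n\in\mathbb{N}_0$, almost surely, $$\mathbf{P}\big(X^x_{n+1}\in\cdot\,|\,\sigma(X^x_k,X^y_k)_{k\le n}\big)=P(X_n^x,\cdot),\qquad \mathbf{P}\big(X^y_{n+1}\in\cdot\,|\,\sigma(X^x_k,X^y_k)_{k\le n}\big)=P(X_n^y,\cdot).$$ A measurable set $H\subseteq\mathcal{E}\times\mathcal{E}$ is achievable if for every $(x,y)\in\mathcal{E}\times\mathcal{E}$ there is a marginally Markovian $(x,y)$-coupling such that $\tau_{x,y}(H)=\min\{n\ge 0: (X_n^x,X_n^y)\in H\}$ is almost surely finite. For $K\subseteq\mathcal{E}$, let $i(K)=\{x\in\mathcal{E}: x\succeq y\text{ for some }y\in K\}$ and $d(K)=\{x\in\mathcal{E}: x\preceq y\text{ for some }y\in K\}$. $\mathcal{E}$ is KS-normal if for every compact $C\subseteq\mathcal{E}$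 the set $i(C)\cap d(C)$ is compact. *)

theory Defs
  imports "HOL-Probability.Probability"
begin

text \<open>The space is the universe of a type of class \<^class>\<open>polish_space\<close> (a complete metric,
  second countable space); the partial order is an explicit relation \<open>le\<close>.\<close>

definition order_graph :: "('a \<Rightarrow> 'a \<Rightarrow> bool) \<Rightarrow> ('a \<times> 'a) set" where
  "order_graph le = {(x, y). le x y}"

definition ordered_polish :: "('a::polish_space \<Rightarrow> 'a \<Rightarrow> bool) \<Rightarrow> bool" where
  "ordered_polish le \<longleftrightarrow> reflp le \<and> transp le \<and> antisymp le \<and> closed (order_graph le)"

definition increasing_functions :: "('a::polish_space \<Rightarrow> 'a \<Rightarrow> bool) \<Rightarrow> ('a \<Rightarrow> real) set" where
  "increasing_functions le =
     {g \<in> borel_measurable borel. (\<forall>x. 0 \<le> g x \<and> g x \<le> 1) \<and> monotone le (\<le>) g}"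

definition increasing_sets :: "('a::polish_space \<Rightarrow> 'a \<Rightarrow> bool) \<Rightarrow> 'a set set" where
  "increasing_sets le = {I \<in> sets borel. \<forall>x y. x \<in> I \<and> le x y \<longrightarrow> y \<in> I}"

definition bmc :: "('a::polish_space \<Rightarrow> 'a \<Rightarrow> bool) \<Rightarrow> bool" where
  "bmc le \<longleftrightarrow>
     (\<forall>(s :: nat \<Rightarrow> 'a) y. (\<forall>n. le (s n) (s (Suc n))) \<and> (\<forall>n. le (s n) y) \<longrightarrow> convergent s)"

definition up_hull :: "('a \<Rightarrow> 'a \<Rightarrow> bool) \<Rightarrow> 'a set \<Rightarrow> 'a set" where
  "up_hull le K = {x. \<exists>y\<in>K. le y x}"

definition down_hull :: "('a \<Rightarrow> 'a \<Rightarrow> bool) \<Rightarrow> 'a set \<Rightarrow> 'a set" where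
  "down_hull le K = {x. \<exists>y\<in>K. le x y}"

definition ks_normal :: "('a::polish_space \<Rightarrow> 'a \<Rightarrow> bool) \<Rightarrow> bool" where
  "ks_normal le \<longleftrightarrow> (\<forall>C. compact C \<longrightarrow> compact (up_hull le C \<inter> down_hull le C))"

definition markov_kernel :: "('a::polish_space \<Rightarrow> 'a measure) \<Rightarrow> bool" where
  "markov_kernel P \<longleftrightarrow>
     (\<forall>x. prob_space (P x) \<and> sets (P x) = sets borel) \<and>
     (\<forall>A\<in>sets borel. (\<lambda>x. measure (P x) A) \<in> borel_measurable borel)"

definition stoch_monotone ::
    "('a::polish_space \<Rightarrow> 'a \<Rightarrow> bool) \<Rightarrow> ('a \<Rightarrow> 'a measure) \<Rightarrow> bool" where
  "stoch_monotone le P \<longleftrightarrow>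
     (\<forall>g\<in>increasing_functions le. (\<lambda>x. \<integral>y. g y \<partial>P x) \<in> increasing_functions le)"

definition stationary_dist :: "('a::polish_space \<Rightarrow> 'a measure) \<Rightarrow> 'a measure \<Rightarrow> bool" where
  "stationary_dist P \<pi> \<longleftrightarrow>
     prob_space \<pi> \<and> sets \<pi> = sets borel \<and>
     (\<forall>A\<in>sets borel. (\<integral>x. measure (P x) A \<partial>\<pi>) = measure \<pi> A)"

definition history ::
    "'w measure \<Rightarrow> (nat \<Rightarrow> 'w \<Rightarrow> 'b::topological_space) \<Rightarrow> nat \<Rightarrow> 'w measure" where
  "history \<Omega> Z n =
     sigma (space \<Omega>) {Z k -` A \<inter> space \<Omega> | k A. k \<le> n \<and> A \<in> sets borel}"

text \<open>\<open>X\<close> evolves by the kernel \<open>P\<close> relative to the history of a (possibly larger) process \<open>Z\<close>.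
  The space being Polish, the Borel sets are countably generated, so it does not matter whether
  the exceptional null set is chosen before or after \<open>A\<close>.\<close>

definition evolves_by ::
    "('a::polish_space \<Rightarrow> 'a measure) \<Rightarrow> 'w measure \<Rightarrow> (nat \<Rightarrow> 'w \<Rightarrow> 'b::topological_space) \<Rightarrow>
      (nat \<Rightarrow> 'w \<Rightarrow> 'a) \<Rightarrow> bool" where
  "evolves_by P \<Omega> Z X \<longleftrightarrow>
     (\<forall>n. \<forall>A\<in>sets borel. AE \<omega> in \<Omega>.
        real_cond_exp \<Omega> (history \<Omega> Z n) (\<lambda>\<omega>'. indicator A (X (Suc n) \<omega>')) \<omega>
          = measure (P (X n \<omega>)) A)"

definition markov_chain ::
    "('a::polish_space \<Rightarrow> 'a measure) \<Rightarrow> 'a \<Rightarrow> 'w measure \<Rightarrow> (nat \<Rightarrow> 'w \<Rightarrow> 'a) \<Rightarrow> bool" where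
  "markov_chain P x \<Omega> X \<longleftrightarrow>
     prob_space \<Omega> \<and> (\<forall>n. X n \<in> borel_measurable \<Omega>) \<and> (AE \<omega> in \<Omega>. X 0 \<omega> = x) \<and>
     evolves_by P \<Omega> X X"

definition mm_coupling ::
    "('a::polish_space \<Rightarrow> 'a measure) \<Rightarrow> 'a \<Rightarrow> 'a \<Rightarrow> 'w measure \<Rightarrow> (nat \<Rightarrow> 'w \<Rightarrow> 'a \<times> 'a) \<Rightarrow> bool"
  where
  "mm_coupling P x y \<Omega> Z \<longleftrightarrow>
     prob_space \<Omega> \<and> (\<forall>n. Z n \<in> borel_measurable \<Omega>) \<and> (AE \<omega> in \<Omega>. Z 0 \<omega> = (x, y)) \<and>
     evolves_by P \<Omega> Z (\<lambda>n \<omega>. fst (Z n \<omega>)) \<and> evolves_by P \<Omega> Z (\<lambda>n \<omega>. snd (Z n \<omega>))"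

text \<open>First time \<open>n \<ge> m\<close> at which the process is in \<open>H\<close>; it is \<open>\<infinity>\<close> if there is none.\<close>

definition first_hit :: "nat \<Rightarrow> (nat \<Rightarrow> 'w \<Rightarrow> 'b) \<Rightarrow> 'b set \<Rightarrow> 'w \<Rightarrow> enat" where
  "first_hit m Z H \<omega> = Inf (enat ` {n. m \<le> n \<and> Z n \<omega> \<in> H})"

text \<open>\<open>achieves P H \<Omega> Z\<close>: the pairs \<open>(\<Omega> x y, Z x y)\<close>, one coupling chosen for every \<open>(x, y)\<close>,
  witness that \<open>H\<close> is achievable.\<close>

definition achieves ::
    "('a::polish_space \<Rightarrow> 'a measure) \<Rightarrow> ('a \<times> 'a) set \<Rightarrow> ('a \<Rightarrow> 'a \<Rightarrow> 'w measure) \<Rightarrow>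
      ('a \<Rightarrow> 'a \<Rightarrow> nat \<Rightarrow> 'w \<Rightarrow> 'a \<times> 'a) \<Rightarrow> bool" where
  "achieves P H \<Omega> Z \<longleftrightarrow>
     H \<in> sets borel \<and>
     (\<forall>x y. mm_coupling P x y (\<Omega> x y) (Z x y) \<and>
            (AE \<omega> in \<Omega> x y. first_hit 0 (Z x y) H \<omega> < \<infinity>))"

definition tail_prob ::
    "'w measure \<Rightarrow> (nat \<Rightarrow> 'w \<Rightarrow> 'b) \<Rightarrow> 'b set \<Rightarrow> nat \<Rightarrow> real" where
  "tail_prob \<Omega> Z H n = measure \<Omega> {\<omega> \<in> space \<Omega>. first_hit 0 Z H \<omega> > enat n}"

text \<open>\<open>X x\<close> on \<open>\<Omega> x\<close> is the chain started at \<open>x\<close>.\<close>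

definition pr_cond ::
    "('a::polish_space \<Rightarrow> 'a \<Rightarrow> bool) \<Rightarrow> ('a \<Rightarrow> 'w measure) \<Rightarrow> ('a \<Rightarrow> nat \<Rightarrow> 'w \<Rightarrow> 'a) \<Rightarrow> bool" where
  "pr_cond le \<Omega> X \<longleftrightarrow>
     (\<exists>x\<^sub>0 y\<^sub>0. le x\<^sub>0 y\<^sub>0 \<and>
        (\<integral>\<^sup>+\<omega>. ennreal_of_enat (first_hit 1 (X x\<^sub>0) {z. le x\<^sub>0 z} \<omega>) \<partial>\<Omega> x\<^sub>0) < \<infinity> \<and>
        (\<integral>\<^sup>+\<omega>. ennreal_of_enat (first_hit 1 (X y\<^sub>0) {z. le z y\<^sub>0} \<omega>) \<partial>\<Omega> y\<^sub>0) < \<infinity>)"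

text \<open>The library's weak convergence and tightness are for measures on the reals only.\<close>

definition weakly_converges :: "(nat \<Rightarrow> 'a::polish_space measure) \<Rightarrow> 'a measure \<Rightarrow> bool" where
  "weakly_converges \<mu> \<nu> \<longleftrightarrow>
     (\<forall>f :: 'a \<Rightarrow> real. continuous_on UNIV f \<and> bounded (range f) \<longrightarrow>
        (\<lambda>n. \<integral>x. f x \<partial>\<mu> n) \<longlonglongrightarrow> (\<integral>x. f x \<partial>\<nu>))"

definition tight_laws :: "(nat \<Rightarrow> 'a::polish_space measure) \<Rightarrow> bool" where
  "tight_laws \<mu> \<longleftrightarrow> (\<forall>\<epsilon>>0. \<exists>K. compact K \<and> (\<forall>n. measure (\<mu> n) K \<ge> 1 - \<epsilon>))"

end

theory Submission
  imports Defs
begin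

text \<open>
  Write \<open>T g x = \<integral> g dP x\<close>, and call an increasing measurable function with
  values in \<open>[0, 1]\<close> a test function; \<open>T\<close> preserves them. Along a
  coupling of the chains started at \<open>x\<close> and \<open>y\<close>, once the pair is
  ordered, the conditional expectations of a test function stay ordered, because each coordinate
  moves by \<open>P\<close>. Hence \<open>T^n g x - T^n g y\<close> is at most the probability
  that the pair has not been ordered by time \<open>n\<close> (\<open>coupling_bound\<close>), and
  \<open>T^n g\<close> is asymptotically constant for every test function \<open>g\<close>. This is the
  comparison of two starting points. It gives uniqueness, because test functions determine a measure
  (\<open>increasing_functions_determine\<close>), and convergence to
  the stationary law, with the rates, by integrating over the second starting point.

  Existence is the main point, as \<open>P\<close> need not be Feller. The occupation measure of
  the chain started at \<open>x\<^sub>0\<close>, up to its return above \<open>x\<^sub>0\<close>,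
  is after normalisation a law \<open>\<mu>\<close> with \<open>\<mu> \<le> \<mu>P\<close> in the
  stochastic order (\<open>cycle_measure\<close>); the point \<open>y\<^sub>0\<close> gives in the
  same way a law \<open>\<nu> \<ge> \<nu>P\<close>. So \<open>\<mu>P^n\<close> increases,
  \<open>\<nu>P^n\<close> decreases, and they agree asymptotically on test functions; thus
  \<open>\<mu>P^n \<le> \<nu>\<close> for all \<open>n\<close>. Since bounded increasing sequences
  of points converge, an increasing sequence of laws bounded by a law is tight
  (\<open>bounded_increasing_tight\<close>), so a subsequence converges weakly to some
  \<open>\<pi>\<close> (\<open>tight_subsequence_converges\<close>). Being a weak limit of an
  increasing sequence, \<open>\<pi>\<close> is its least upper bound: it dominates every
  \<open>\<mu>P^n\<close>, and since \<open>\<pi>P\<close> also dominates every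
  \<open>\<mu>P^n\<close> one gets \<open>\<pi> \<le> \<pi>P\<close>. For a test function
  \<open>g\<close> the integrals \<open>\<pi>(T^n g)\<close> therefore increase from
  \<open>\<pi>(g)\<close>, but they are asymptotic to \<open>\<mu>(T^n g) \<le> \<pi>(g)\<close>;
  so they are constant and \<open>\<pi>P = \<pi>\<close>.

  The tightness would be immediate from a realisation by an increasing sequence of random points,
  as in Strassen's theorem. The coupling is replaced by a potential function which bounds from
  below the weight of the best chain (\<open>chain_potential_integral\<close>), and by Ptak's
  combinatorial lemma, which extracts an infinite chain from these finite ones.

  For weak convergence, the convergence on test functions is carried over to the
  vector lattice they span, which separates disjoint compact sets
  (\<open>separated_compact\<close>); tightness then yields the portmanteau inequalities
  (\<open>tight_converges_weakly\<close>). In a KS-normal space the tightness comes from the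
  compact sets \<open>i(K) \<inter> d(K)\<close> (\<open>ks_normal_tight\<close>).
\<close>

section \<open>Borel probability measures\<close>

abbreviation borel_prob :: "'a::topological_space measure \<Rightarrow> bool" where
  "borel_prob \<mu> \<equiv> \<mu> \<in> space (prob_algebra borel)"

lemma borel_probD:
  assumes "borel_prob \<mu>"
  shows "prob_space \<mu>" "sets \<mu> = sets borel" "space \<mu> = UNIV"
  using assms sets_eq_imp_space_eq[of \<mu> borel] by (auto simp: space_prob_algebra)

lemma borel_probI:
  assumes "prob_space \<mu>" "sets \<mu> = sets borel"
  shows "borel_prob \<mu>"
  using assms by (auto simp: space_prob_algebra)

lemma borel_prob_measurable:
  assumes "borel_prob \<mu>"
  shows "f \<in> measurable \<mu> N \<longleftrightarrow> f \<in> measurable borel N"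
  using borel_probD(2)[OF assms] by (simp cong: measurable_cong_sets)

lemma borel_prob_integrable:
  fixes f :: "'a::topological_space \<Rightarrow> real"
  assumes "borel_prob \<mu>" "f \<in> borel_measurable borel" "\<And>x. \<bar>f x\<bar> \<le> B"
  shows "integrable \<mu> f"
proof -
  interpret prob_space \<mu> using borel_probD[OF assms(1)] by simp
  show ?thesis
    by (rule integrable_const_bound[where B=B]) (use assms in \<open>auto simp: borel_prob_measurable\<close>)
qed

lemma sum_level_indicators:
  fixes t :: real
  assumes "0 \<le> t" "t \<le> real N"
  shows "(\<Sum>i=1..N. if real i \<le> t then 1 else 0 :: real) \<le> t"
    and "t \<le> 1 + (\<Sum>i=1..N. if real i \<le> t then 1 else 0 :: real)"
proof -
  have "{i\<in>{1..N}. real i \<le> t} = {1..nat \<lfloor>t\<rfloor>}"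
    using assms by (auto simp: le_nat_floor) (linarith)+
  then have "(\<Sum>i=1..N. if real i \<le> t then 1 else 0 :: real) = real (nat \<lfloor>t\<rfloor>)"
    by (simp add: sum.If_cases Int_def)
  then show "(\<Sum>i=1..N. if real i \<le> t then 1 else 0 :: real) \<le> t"
    and "t \<le> 1 + (\<Sum>i=1..N. if real i \<le> t then 1 else 0 :: real)"
    using assms by linarith+
qed

text \<open>The average of the indicators of \<open>{x. i / N \<le> f x}\<close> over \<open>i = 1, \<dots>, N\<close> is \<open>f\<close> rounded down to a
multiple of \<open>1 / N\<close>. Integrals are in this way compared through superlevel sets, which are
increasing sets for an increasing \<open>f\<close> and closed sets for a continuous \<open>f\<close>.\<close>

lemma layer_sum_bounds:
  fixes f :: "'a::topological_space \<Rightarrow> real"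
  assumes mu: "borel_prob \<mu>" and f[measurable]: "f \<in> borel_measurable borel"
    and f01: "\<And>x. 0 \<le> f x" "\<And>x. f x \<le> 1"
  shows "(\<Sum>i=1..N. measure \<mu> {x. real i \<le> real N * f x}) \<le> real N * (\<integral>x. f x \<partial>\<mu>)"
    and "real N * (\<integral>x. f x \<partial>\<mu>) \<le> 1 + (\<Sum>i=1..N. measure \<mu> {x. real i \<le> real N * f x})"
proof -
  interpret prob_space \<mu> using borel_probD[OF mu] by simp
  let ?s = "\<lambda>x. \<Sum>i=1..N. indicator {x. real i \<le> real N * f x} x :: real"
  have s_eq: "?s x = (\<Sum>i=1..N. if real i \<le> real N * f x then 1 else 0)" for x
    by (intro sum.cong) (auto simp: indicator_def)
  have bound: "0 \<le> real N * f x" "real N * f x \<le> real N" for x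
    using f01[of x] by (auto simp: mult_left_le)
  have [measurable]: "{x. real i \<le> real N * f x} \<in> sets borel" for i
    by measurable
  have int_s: "integrable \<mu> ?s"
    by (intro Bochner_Integration.integrable_sum borel_prob_integrable[OF mu, where B=1]) auto
  have int_f: "integrable \<mu> f"
    by (rule borel_prob_integrable[OF mu, where B=1]) (use f f01 in \<open>auto simp: abs_le_iff intro: order_trans[of _ 0]\<close>)
  have "(\<integral>x. ?s x \<partial>\<mu>) = (\<Sum>i=1..N. measure \<mu> {x. real i \<le> real N * f x})"
    using borel_probD[OF mu]
    by (subst Bochner_Integration.integral_sum) (auto intro!: borel_prob_integrable[OF mu, where B=1])
  moreover have "(\<integral>x. ?s x \<partial>\<mu>) \<le> (\<integral>x. real N * f x \<partial>\<mu>)"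
    by (intro integral_mono int_s integrable_mult_right int_f)
      (unfold s_eq, rule sum_level_indicators(1)[OF bound])
  moreover have "(\<integral>x. real N * f x \<partial>\<mu>) \<le> (\<integral>x. 1 + ?s x \<partial>\<mu>)"
    by (intro integral_mono int_s integrable_mult_right int_f Bochner_Integration.integrable_add
         integrable_const) (unfold s_eq, rule sum_level_indicators(2)[OF bound])
  moreover have "(\<integral>x. 1 + ?s x \<partial>\<mu>) = 1 + (\<integral>x. ?s x \<partial>\<mu>)"
    using int_s by (subst Bochner_Integration.integral_add) (auto simp: prob_space)
  ultimately show "(\<Sum>i=1..N. measure \<mu> {x. real i \<le> real N * f x}) \<le> real N * (\<integral>x. f x \<partial>\<mu>)"
    and "real N * (\<integral>x. f x \<partial>\<mu>) \<le> 1 + (\<Sum>i=1..N. measure \<mu> {x. real i \<le> real N * f x})"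
    by simp_all
qed

text \<open>Only finitely many levels matter up to a given error, so the eventual inequalities for the single
superlevel sets can be combined. Constant sequences of measures are a useful special case.\<close>

lemma eventually_integral_le_of_superlevels:
  fixes f :: "'a::topological_space \<Rightarrow> real"
  assumes mu: "\<And>n. borel_prob (\<mu> n)" and nu: "borel_prob \<nu>"
    and f: "f \<in> borel_measurable borel" and f01: "\<And>x. 0 \<le> f x" "\<And>x. f x \<le> 1"
    and lev: "\<And>t e. 0 < t \<Longrightarrow> 0 < e \<Longrightarrow>
        eventually (\<lambda>n. measure (\<mu> n) {x. t \<le> f x} \<le> measure \<nu> {x. t \<le> f x} + e) F"
    and e: "0 < e"
  shows "eventually (\<lambda>n. (\<integral>x. f x \<partial>\<mu> n) \<le> (\<integral>x. f x \<partial>\<nu>) + e) F"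
proof -
  obtain N :: nat where N: "2 / e < real N" using reals_Archimedean2 by blast
  have Npos: "0 < real N" using N e by (smt (verit) divide_pos_pos)
  have "eventually (\<lambda>n. \<forall>i\<in>{1..N}. measure (\<mu> n) {x. real i / N \<le> f x}
      \<le> measure \<nu> {x. real i / N \<le> f x} + e/2) F"
    by (intro eventually_ball_finite ballI lev) (use Npos e in auto)
  then show ?thesis
  proof eventually_elim
    case (elim n)
    have eq: "{x. real i / N \<le> f x} = {x. real i \<le> real N * f x}" for i
      using Npos by (auto simp: field_simps)
    have "real N * (\<integral>x. f x \<partial>\<mu> n) \<le> 1 + (\<Sum>i=1..N. measure (\<mu> n) {x. real i \<le> real N * f x})"
      by (rule layer_sum_bounds(2)[OF mu f f01])
    also have "\<dots> \<le> 1 + (\<Sum>i=1..N. measure \<nu> {x. real i \<le> real N * f x} + e/2)"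
      using elim unfolding eq by (intro add_left_mono sum_mono) auto
    also have "\<dots> \<le> 1 + real N * (\<integral>x. f x \<partial>\<nu>) + real N * (e/2)"
      using layer_sum_bounds(1)[OF nu f f01, of N] by (simp add: sum.distrib)
    also have "1 \<le> real N * (e/2)" using N e by (simp add: field_simps)
    finally have "real N * (\<integral>x. f x \<partial>\<mu> n) \<le> real N * ((\<integral>x. f x \<partial>\<nu>) + e)"
      by (simp add: algebra_simps)
    then show ?case using Npos by simp
  qed
qed

lemma integral_le_of_superlevels:
  fixes f :: "'a::topological_space \<Rightarrow> real"
  assumes mu: "borel_prob \<mu>" and nu: "borel_prob \<nu>"
    and f: "f \<in> borel_measurable borel" and f01: "\<And>x. 0 \<le> f x" "\<And>x. f x \<le> 1"
    and lev: "\<And>t. 0 < t \<Longrightarrow> measure \<mu> {x. t \<le> f x} \<le> measure \<nu> {x. t \<le> f x}"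
  shows "(\<integral>x. f x \<partial>\<mu>) \<le> (\<integral>x. f x \<partial>\<nu>)"
proof (rule field_le_epsilon)
  fix e :: real assume "0 < e"
  have "eventually (\<lambda>n::nat. (\<integral>x. f x \<partial>\<mu>) \<le> (\<integral>x. f x \<partial>\<nu>) + e) sequentially"
    by (rule eventually_integral_le_of_superlevels[OF mu nu f f01 _ \<open>0 < e\<close>])
      (use lev in \<open>auto intro!: always_eventually add_increasing2\<close>)
  then show "(\<integral>x. f x \<partial>\<mu>) \<le> (\<integral>x. f x \<partial>\<nu>) + e" by simp
qed

text \<open>Inner regularity by compact sets; the strict inequality lets a single compact set be chosen.\<close>

lemma borel_prob_inner_compact:
  fixes \<mu> :: "'a::polish_space measure"
  assumes mu: "borel_prob \<mu>" and B: "B \<in> sets borel" and c: "c < measure \<mu> B"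
  shows "\<exists>K\<subseteq>B. compact K \<and> c < measure \<mu> K"
proof (cases "c < 0")
  case True
  then show ?thesis by (intro exI[of _ "{}"]) auto
next
  case False
  interpret prob_space \<mu> using borel_probD[OF mu] by simp
  have "emeasure \<mu> B = (SUP K\<in>{K. K \<subseteq> B \<and> compact K}. emeasure \<mu> K)"
    by (rule inner_regular) (use borel_probD[OF mu] B in auto)
  moreover have "ennreal c < emeasure \<mu> B"
    using c False by (simp add: emeasure_eq_measure ennreal_lessI)
  ultimately obtain K where "K \<subseteq> B" "compact K" "ennreal c < emeasure \<mu> K"
    by (auto simp: less_SUP_iff)
  then show ?thesis using False by (auto simp: emeasure_eq_measure ennreal_less_iff)
qed

lemma borel_prob_compact_exhaust:
  fixes \<mu> :: "'a::polish_space measure"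
  assumes mu: "borel_prob \<mu>" and e: "0 < e"
  shows "\<exists>K. compact K \<and> 1 - e < measure \<mu> K"
  using borel_prob_inner_compact[OF mu, of UNIV "1 - e"] e borel_probD[OF mu]
    prob_space.prob_space[of \<mu>] by auto

lemma borel_prob_compl:
  assumes mu: "borel_prob \<mu>" and A: "A \<in> sets borel"
  shows "measure \<mu> (- A) = 1 - measure \<mu> A"
  using prob_space.prob_compl[of \<mu> A] borel_probD[OF mu] A by (simp add: Compl_eq_Diff_UNIV)

lemma borel_prob_closed_sets [simp]:
  assumes "borel_prob \<mu>" "closed A" shows "A \<in> sets \<mu>"
  using borel_probD(2)[OF assms(1)] assms(2) by auto

section \<open>Ordered Polish spaces and the stochastic order\<close>

locale ordered_space =
  fixes le :: "'a::polish_space \<Rightarrow> 'a \<Rightarrow> bool" (infix "\<preceq>" 50)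
  assumes ordered_polish: "ordered_polish le"
begin

lemma le_refl [simp, intro]: "x \<preceq> x"
  and le_trans [trans]: "x \<preceq> y \<Longrightarrow> y \<preceq> z \<Longrightarrow> x \<preceq> z"
  and le_antisym: "x \<preceq> y \<Longrightarrow> y \<preceq> x \<Longrightarrow> x = y"
  and closed_graph: "closed (order_graph le)"
  using ordered_polish unfolding ordered_polish_def
  by (blast dest: reflpD, blast dest: transpD, blast dest: antisympD, blast)

lemma le_limit_eventually:
  assumes "s \<longlonglongrightarrow> x" "t \<longlonglongrightarrow> y" "eventually (\<lambda>n. s n \<preceq> t n) sequentially"
  shows "x \<preceq> y"
proof -
  have "(\<lambda>n. (s n, t n)) \<longlonglongrightarrow> (x, y)" using assms by (intro tendsto_Pair)
  then have "(x, y) \<in> order_graph le"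
    by (rule Lim_in_closed_set[OF closed_graph, rotated 2])
      (use assms in \<open>auto simp: order_graph_def\<close>)
  then show ?thesis by (simp add: order_graph_def)
qed

lemma le_limit: "s \<longlonglongrightarrow> x \<Longrightarrow> t \<longlonglongrightarrow> y \<Longrightarrow> (\<And>n. s n \<preceq> t n) \<Longrightarrow> x \<preceq> y"
  by (rule le_limit_eventually) (auto intro: always_eventually)

lemma dual: "ordered_space (\<lambda>x y. y \<preceq> x)"
proof
  have "order_graph (\<lambda>x y. y \<preceq> x) = prod.swap -` order_graph le"
    by (auto simp: order_graph_def)
  moreover have "closed (prod.swap -` order_graph le :: ('a \<times> 'a) set)"
    using closed_graph by (rule closed_vimage) (auto intro!: continuous_intros simp: prod.swap_def)
  ultimately show "ordered_polish (\<lambda>x y. y \<preceq> x)"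
    unfolding ordered_polish_def
    by (metis (mono_tags, lifting) antisympI le_antisym le_refl le_trans reflpI transpI)
qed

text \<open>Witnesses below a convergent sequence of points have a cluster point by compactness, and the order
is closed. The up-hull of a merely closed set can fail to be closed.\<close>

lemma closed_up_hull:
  assumes "compact K" shows "closed (up_hull le K)"
  unfolding closed_sequential_limits
proof (intro allI impI, elim conjE)
  fix s x assume s: "\<forall>n. s n \<in> up_hull le K" and lim: "s \<longlonglongrightarrow> x"
  from s obtain t where t: "\<And>n. t n \<in> K" "\<And>n. t n \<preceq> s n"
    unfolding up_hull_def by simp metis
  from assms t(1) obtain y r where y: "y \<in> K" and r: "strict_mono r" "(t \<circ> r) \<longlonglongrightarrow> y"
    unfolding compact_def by blast
  have "y \<preceq> x"
    by (rule le_limit[OF r(2) LIMSEQ_subseq_LIMSEQ[OF lim r(1)]]) (use t in auto)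
  then show "x \<in> up_hull le K" using y by (auto simp: up_hull_def)
qed

lemma closed_up_set: "closed {z. x \<preceq> z}"
proof -
  have "{z. x \<preceq> z} = up_hull le {x}" by (auto simp: up_hull_def)
  then show ?thesis using closed_up_hull[of "{x}"] by simp
qed

lemma up_hull_superset: "K \<subseteq> up_hull le K"
  by (auto simp: up_hull_def)

lemma up_hull_mono: "K \<subseteq> L \<Longrightarrow> up_hull le K \<subseteq> up_hull le L"
  by (auto simp: up_hull_def)

lemma up_hull_upward: "x \<in> up_hull le K \<Longrightarrow> x \<preceq> y \<Longrightarrow> y \<in> up_hull le K"
  by (auto simp: up_hull_def intro: le_trans)

lemma up_hull_increasing: "compact K \<Longrightarrow> up_hull le K \<in> increasing_sets le"
  using closed_up_hull by (auto simp: increasing_sets_def intro: up_hull_upward)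

lemma increasing_functionsD:
  assumes "g \<in> increasing_functions le"
  shows "g \<in> borel_measurable borel" "0 \<le> g x" "g x \<le> 1" "\<bar>g x\<bar> \<le> 1" "x \<preceq> y \<Longrightarrow> g x \<le> g y"
  using assms by (auto simp: increasing_functions_def monotone_on_def)

lemma indicator_increasing:
  assumes "I \<in> increasing_sets le" shows "(indicator I :: 'a \<Rightarrow> real) \<in> increasing_functions le"
  using assms by (auto simp: increasing_functions_def increasing_sets_def monotone_on_def indicator_def)

lemma superlevel_increasing:
  assumes "g \<in> increasing_functions le" shows "{x. t \<le> g x} \<in> increasing_sets le"
proof -
  have [measurable]: "g \<in> borel_measurable borel" by (rule increasing_functionsD(1)[OF assms])
  have "{x. t \<le> g x} \<in> sets borel" by measurable
  then show ?thesis
    using increasing_functionsD(5)[OF assms] by (fastforce simp: increasing_sets_def)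
qed

lemma reverse_increasing:
  "g \<in> increasing_functions (\<lambda>x y. y \<preceq> x) \<Longrightarrow> (\<lambda>x. 1 - g x) \<in> increasing_functions le"
  by (auto simp: increasing_functions_def monotone_on_def)

lemma reverse_increasing':
  "g \<in> increasing_functions le \<Longrightarrow> (\<lambda>x. 1 - g x) \<in> increasing_functions (\<lambda>x y. y \<preceq> x)"
  by (auto simp: increasing_functions_def monotone_on_def)

definition stoch_le :: "'a measure \<Rightarrow> 'a measure \<Rightarrow> bool" where
  "stoch_le \<mu> \<nu> \<longleftrightarrow> (\<forall>g\<in>increasing_functions le. (\<integral>x. g x \<partial>\<mu>) \<le> (\<integral>x. g x \<partial>\<nu>))"

lemma stoch_le_trans: "stoch_le \<mu> \<nu> \<Longrightarrow> stoch_le \<nu> \<rho> \<Longrightarrow> stoch_le \<mu> \<rho>"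
  unfolding stoch_le_def by (meson order_trans)

lemma stoch_le_refl: "stoch_le \<mu> \<mu>"
  unfolding stoch_le_def by simp

text \<open>An increasing Borel set contains the up-hull of each of its compact subsets, so inner regularity
reduces the stochastic order to these hulls. They are closed, which makes the stochastic order
accessible to weak convergence although test functions are merely measurable.\<close>

lemma stoch_leI_compact:
  assumes mu: "borel_prob \<mu>" and nu: "borel_prob \<nu>"
    and K: "\<And>K. compact K \<Longrightarrow> measure \<mu> K \<le> measure \<nu> (up_hull le K)"
  shows "stoch_le \<mu> \<nu>"
  unfolding stoch_le_def
proof
  fix g assume g: "g \<in> increasing_functions le"
  interpret nu: prob_space \<nu> using borel_probD[OF nu] by simp
  have sets: "measure \<mu> I \<le> measure \<nu> I" if I: "I \<in> increasing_sets le" for I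
  proof (rule ccontr)
    assume "\<not> ?thesis"
    then have "measure \<nu> I < measure \<mu> I" by simp
    moreover have "I \<in> sets borel" using I by (simp add: increasing_sets_def)
    ultimately obtain K where K': "K \<subseteq> I" "compact K" "measure \<nu> I < measure \<mu> K"
      using borel_prob_inner_compact[OF mu] by blast
    have "up_hull le K \<subseteq> I"
      using K'(1) I by (auto simp: up_hull_def increasing_sets_def)
    then have "measure \<nu> (up_hull le K) \<le> measure \<nu> I"
      using I borel_probD[OF nu] by (intro nu.finite_measure_mono) (auto simp: increasing_sets_def)
    with K(1)[OF K'(2)] K'(3) show False by simp
  qed
  show "(\<integral>x. g x \<partial>\<mu>) \<le> (\<integral>x. g x \<partial>\<nu>)"
    by (rule integral_le_of_superlevels[OF mu nu])
      (use g in \<open>auto intro!: sets superlevel_increasing increasing_functionsD\<close>)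
qed

lemma stoch_le_increasing_set:
  assumes "stoch_le \<mu> \<nu>" "borel_prob \<mu>" "borel_prob \<nu>"
    "I \<in> increasing_sets le"
  shows "measure \<mu> I \<le> measure \<nu> I"
  using bspec[OF assms(1)[unfolded stoch_le_def] indicator_increasing[OF assms(4)]]
    borel_probD[OF assms(2)] borel_probD[OF assms(3)] assms(4) by (simp add: increasing_sets_def)

end

section \<open>Test functions determine laws and weak limits\<close>

lemma closed_neighborhood_measure_tendsto:
  fixes C :: "'a::polish_space set"
  assumes pi: "borel_prob \<pi>" and C: "closed C" "C \<noteq> {}"
  shows "(\<lambda>n. measure \<pi> {x. infdist x C \<le> 1 / real (Suc n)}) \<longlonglongrightarrow> measure \<pi> C"
proof -
  interpret pi: prob_space \<pi> using borel_probD[OF pi] by simp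
  let ?N = "\<lambda>n::nat. {x. infdist x C \<le> 1 / real (Suc n)}"
  have cN: "closed (?N n)" for n
    by (intro closed_Collect_le continuous_intros)
  have "(\<lambda>n. measure \<pi> (?N n)) \<longlonglongrightarrow> measure \<pi> (\<Inter>n. ?N n)"
  proof (rule pi.finite_Lim_measure_decseq)
    show "range ?N \<subseteq> sets \<pi>" using cN pi by auto
    have "1 / real (Suc n) \<le> 1 / real (Suc m)" if "m \<le> n" for m n
      using that by (intro divide_left_mono) auto
    then show "decseq ?N" unfolding decseq_def by (auto intro: order_trans)
  qed
  moreover have "(\<Inter>n. ?N n) = C"
  proof -
    have "x \<in> C" if x: "x \<in> (\<Inter>n. ?N n)" for x
    proof -
      have "infdist x C \<le> inverse (real (Suc n))" for n
        using INT_D[OF x UNIV_I[of n]] by (simp add: inverse_eq_divide)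
      then have "infdist x C \<le> 0"
        by (intro LIMSEQ_le_const[OF LIMSEQ_inverse_real_of_nat] exI[of _ 0]) blast
      then show ?thesis
        using in_closed_iff_infdist_zero[OF C] infdist_nonneg[of x C] by simp
    qed
    then show ?thesis using infdist_zero by fastforce
  qed
  ultimately show ?thesis by simp
qed

context ordered_space begin

text \<open>The vector lattice spanned by the test functions. Convergence of integrals passes from test
functions to this space by linearity, and the lattice operations allow separation arguments.\<close>

definition increasing_differences :: "('a \<Rightarrow> real) set" where
  "increasing_differences = {h. \<exists>f\<in>increasing_functions le. \<exists>g\<in>increasing_functions le. \<exists>c>0.
     \<forall>x. h x = c * (f x - g x)}"

lemma increasing_differencesI:
  assumes "f \<in> increasing_functions le" "g \<in> increasing_functions le" "c > 0"
    "\<And>x. h x = c * (f x - g x)"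
  shows "h \<in> increasing_differences"
  using assms unfolding increasing_differences_def by blast

lemma increasing_functions_convex:
  assumes "f \<in> increasing_functions le" "g \<in> increasing_functions le" "0 \<le> a" "0 \<le> b" "a + b = 1"
  shows "(\<lambda>x. a * f x + b * g x) \<in> increasing_functions le"
proof -
  note f = increasing_functionsD[OF assms(1)] and g = increasing_functionsD[OF assms(2)]
  have "a * f x + b * g x \<le> a * 1 + b * 1" for x
    by (intro add_mono mult_left_mono f(3) g(3) assms)
  moreover have "a * f x + b * g x \<le> a * f y + b * g y" if "x \<preceq> y" for x y
    by (intro add_mono mult_left_mono f(5) g(5) assms that)
  moreover have "0 \<le> a * f x + b * g x" for x
    by (intro add_nonneg_nonneg mult_nonneg_nonneg f(2) g(2) assms)
  moreover have "(\<lambda>x. a * f x + b * g x) \<in> borel_measurable borel"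
    by (intro borel_measurable_add borel_measurable_times borel_measurable_const f(1) g(1))
  ultimately show ?thesis
    using assms(5) unfolding increasing_functions_def monotone_on_def by simp
qed

lemma increasing_functions_max:
  assumes "f \<in> increasing_functions le" "g \<in> increasing_functions le"
  shows "(\<lambda>x. max (f x) (g x)) \<in> increasing_functions le"
proof -
  have [measurable]: "f \<in> borel_measurable borel" "g \<in> borel_measurable borel"
    using assms increasing_functionsD(1) by auto
  have "(\<lambda>x. max (f x) (g x)) \<in> borel_measurable borel" by measurable
  then show ?thesis
    using increasing_functionsD[OF assms(1)] increasing_functionsD[OF assms(2)]
    unfolding increasing_functions_def monotone_on_def
    by (simp add: le_max_iff_disj) (meson linear order_trans)
qed

lemma increasing_functions_const: "0 \<le> c \<Longrightarrow> c \<le> 1 \<Longrightarrow> (\<lambda>_. c) \<in> increasing_functions le"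
  by (auto simp: increasing_functions_def monotone_on_def)

lemma increasing_differences_uminus:
  assumes "h \<in> increasing_differences" shows "(\<lambda>x. - h x) \<in> increasing_differences"
proof -
  obtain f g c where *: "f \<in> increasing_functions le" "g \<in> increasing_functions le" "c > 0"
    "\<And>x. h x = c * (f x - g x)" using assms by (auto simp: increasing_differences_def)
  then have "\<forall>x. - h x = c * (g x - f x)" by (simp add: algebra_simps)
  with * show ?thesis unfolding increasing_differences_def by blast
qed

text \<open>This is \<open>max (f - g) (f' - g') = max (f + g') (f' + g) - (g + g')\<close>, where the weights \<open>a\<close> and \<open>b\<close>
normalise the sums so that they take values in the unit interval.\<close>

lemma increasing_differences_max:
  assumes "h \<in> increasing_differences" "h' \<in> increasing_differences"
  shows "(\<lambda>x. max (h x) (h' x)) \<in> increasing_differences"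
proof -
  obtain f g c where h: "f \<in> increasing_functions le" "g \<in> increasing_functions le" "c > 0"
    "\<And>x. h x = c * (f x - g x)" using assms by (auto simp: increasing_differences_def)
  obtain f' g' c' where h': "f' \<in> increasing_functions le" "g' \<in> increasing_functions le" "c' > 0"
    "\<And>x. h' x = c' * (f' x - g' x)" using assms by (auto simp: increasing_differences_def)
  define a where "a = c / (c + c')"
  define b where "b = c' / (c + c')"
  have ab: "0 \<le> a" "0 \<le> b" "a + b = 1" "(c + c') * a = c" "(c + c') * b = c'"
    using h(3) h'(3) by (auto simp: a_def b_def add_divide_distrib[symmetric])
  have "max (h x) (h' x) = (c + c') * (max (a * f x + b * g' x) (a * g x + b * f' x) - (a * g x + b * g' x))"
    for x
  proof -
    have "max (a * f x + b * g' x) (a * g x + b * f' x) - (a * g x + b * g' x)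
        = max (a * f x - a * g x) (b * f' x - b * g' x)"
      by (simp add: max_diff_distrib_left)
    then have "(c + c') * (max (a * f x + b * g' x) (a * g x + b * f' x) - (a * g x + b * g' x))
       = max ((c + c') * (a * f x - a * g x)) ((c + c') * (b * f' x - b * g' x))"
      using max_mult_distrib_left[of "c + c'" "a * f x - a * g x" "b * f' x - b * g' x"] h(3) h'(3)
      by (simp del: max.bounded_iff)
    also have "(c + c') * (a * f x - a * g x) = ((c + c') * a) * (f x - g x)" by (simp add: algebra_simps)
    also have "(c + c') * (b * f' x - b * g' x) = ((c + c') * b) * (f' x - g' x)" by (simp add: algebra_simps)
    finally show ?thesis using h h' ab by simp
  qed
  moreover have "(\<lambda>x. max (a * f x + b * g' x) (a * g x + b * f' x)) \<in> increasing_functions le"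
    using h h' ab by (intro increasing_functions_max increasing_functions_convex)
  moreover have "(\<lambda>x. a * g x + b * g' x) \<in> increasing_functions le"
    using h h' ab by (intro increasing_functions_convex)
  moreover have "c + c' > 0" using h h' by simp
  ultimately show ?thesis by (intro increasing_differencesI) auto
qed

lemma increasing_differences_min:
  assumes "h \<in> increasing_differences" "h' \<in> increasing_differences"
  shows "(\<lambda>x. min (h x) (h' x)) \<in> increasing_differences"
proof -
  have "(\<lambda>x. - max (- h x) (- h' x)) \<in> increasing_differences"
    by (intro increasing_differences_uminus increasing_differences_max assms)
  then show ?thesis by (simp add: minus_max_eq_min)
qed

lemma increasing_differences_of_increasing:
  assumes "f \<in> increasing_functions le" shows "f \<in> increasing_differences"
    and "(\<lambda>x. 1 - f x) \<in> increasing_differences"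
proof -
  show "f \<in> increasing_differences"
    by (rule increasing_differencesI[where f=f and g="\<lambda>_. 0" and c=1])
      (use assms in \<open>simp_all add: increasing_functions_const\<close>)
  show "(\<lambda>x. 1 - f x) \<in> increasing_differences"
    by (rule increasing_differencesI[where f="\<lambda>_. 1" and g=f and c=1])
      (use assms in \<open>simp_all add: increasing_functions_const\<close>)
qed

definition separated :: "'a set \<Rightarrow> 'a set \<Rightarrow> bool" where
  "separated A B \<longleftrightarrow> (\<exists>h\<in>increasing_differences. (\<forall>x. 0 \<le> h x \<and> h x \<le> 1) \<and>
     (\<forall>x\<in>A. h x = 1) \<and> (\<forall>x\<in>B. h x = 0))"

lemma separated_mono: "separated A B \<Longrightarrow> A' \<subseteq> A \<Longrightarrow> B' \<subseteq> B \<Longrightarrow> separated A' B'"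
  unfolding separated_def by blast

lemma separatedI:
  assumes "h \<in> increasing_differences" "\<And>x. 0 \<le> h x" "\<And>x. h x \<le> 1"
    "\<And>x. x \<in> A \<Longrightarrow> h x = 1" "\<And>x. x \<in> B \<Longrightarrow> h x = 0"
  shows "separated A B"
  using assms unfolding separated_def by blast

lemma separatedE:
  assumes "separated A B"
  obtains h where "h \<in> increasing_differences" "\<And>x. 0 \<le> h x" "\<And>x. h x \<le> 1"
    "\<And>x. x \<in> A \<Longrightarrow> h x = 1" "\<And>x. x \<in> B \<Longrightarrow> h x = 0"
  using assms unfolding separated_def by blast

lemma separated_empty: "separated A {}" "separated {} B"
proof -
  have c: "(\<lambda>_. c) \<in> increasing_differences" if "0 \<le> c" "c \<le> 1" for c
    by (intro increasing_differences_of_increasing(1) increasing_functions_const that)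
  show "separated A {}" by (rule separatedI[OF c[of 1]]) simp_all
  show "separated {} B" by (rule separatedI[OF c[of 0]]) simp_all
qed

lemma separated_Un_right:
  assumes "separated A B" "separated A B'" shows "separated A (B \<union> B')"
proof -
  obtain h where h: "h \<in> increasing_differences" "\<And>x. 0 \<le> h x" "\<And>x. h x \<le> 1"
    "\<And>x. x \<in> A \<Longrightarrow> h x = 1" "\<And>x. x \<in> B \<Longrightarrow> h x = 0" using assms(1) by (rule separatedE) blast
  obtain h' where h': "h' \<in> increasing_differences" "\<And>x. 0 \<le> h' x" "\<And>x. h' x \<le> 1"
    "\<And>x. x \<in> A \<Longrightarrow> h' x = 1" "\<And>x. x \<in> B' \<Longrightarrow> h' x = 0" using assms(2) by (rule separatedE) blast
  show ?thesis
  proof (rule separatedI[OF increasing_differences_min[OF h(1) h'(1)]])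
    fix x
    show "0 \<le> min (h x) (h' x)" using h(2) h'(2) by simp
    show "min (h x) (h' x) \<le> 1" using h(3)[of x] by (rule min.coboundedI1)
    show "min (h x) (h' x) = 1" if "x \<in> A" using h(4) h'(4) that by simp
    show "min (h x) (h' x) = 0" if "x \<in> B \<union> B'"
      using that h(2)[of x] h'(2)[of x] h(5)[of x] h'(5)[of x] by (auto simp: min_def)
  qed
qed

lemma separated_Un_left:
  assumes "separated A B" "separated A' B" shows "separated (A \<union> A') B"
proof -
  obtain h where h: "h \<in> increasing_differences" "\<And>x. 0 \<le> h x" "\<And>x. h x \<le> 1"
    "\<And>x. x \<in> A \<Longrightarrow> h x = 1" "\<And>x. x \<in> B \<Longrightarrow> h x = 0" using assms(1) by (rule separatedE) blast
  obtain h' where h': "h' \<in> increasing_differences" "\<And>x. 0 \<le> h' x" "\<And>x. h' x \<le> 1"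
    "\<And>x. x \<in> A' \<Longrightarrow> h' x = 1" "\<And>x. x \<in> B \<Longrightarrow> h' x = 0" using assms(2) by (rule separatedE) blast
  show ?thesis
  proof (rule separatedI[OF increasing_differences_max[OF h(1) h'(1)]])
    fix x
    show "0 \<le> max (h x) (h' x)" using h(2)[of x] by (rule max.coboundedI1)
    show "max (h x) (h' x) \<le> 1" using h(3) h'(3) by simp
    show "max (h x) (h' x) = 0" if "x \<in> B" using h(5) h'(5) that by simp
    show "max (h x) (h' x) = 1" if "x \<in> A \<union> A'"
      using that h(3)[of x] h'(3)[of x] h(4)[of x] h'(4)[of x] by (auto simp: max_def)
  qed
qed

lemma separated_UN:
  assumes "finite S"
  shows "(\<And>y. y \<in> S \<Longrightarrow> separated A (B y)) \<Longrightarrow> separated A (\<Union>y\<in>S. B y)"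
    and "(\<And>y. y \<in> S \<Longrightarrow> separated (B y) A) \<Longrightarrow> separated (\<Union>y\<in>S. B y) A"
  using assms by (induction S) (auto intro: separated_Un_left separated_Un_right separated_empty)

text \<open>As the order is closed, no point of a small ball about \<open>x\<close> is below a point near \<open>y\<close>. The up-hull
of that ball then avoids a neighbourhood of \<open>y\<close>; intersecting the closed ball with the compact set
\<open>K\<close> first makes the hull closed, hence its indicator a test function.\<close>

lemma separated_near_incomparable:
  assumes K: "compact K" and xy: "\<not> x \<preceq> y"
  shows "\<exists>U W. open U \<and> open W \<and> x \<in> U \<and> y \<in> W \<and> separated (U \<inter> K) (W \<inter> K) \<and> separated (W \<inter> K) (U \<inter> K)"
proof -
  have "open (- order_graph le)" "(x, y) \<in> - order_graph le"
    using closed_graph xy by (auto simp: order_graph_def)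
  then obtain A B where AB: "open A" "open B" "x \<in> A" "y \<in> B" "A \<times> B \<subseteq> - order_graph le"
    by (metis open_prod_elim mem_Sigma_iff)
  obtain r where r: "0 < r" "cball x r \<subseteq> A" using AB open_contains_cball by blast
  let ?I = "up_hull le (K \<inter> cball x r)"
  have cI: "compact (K \<inter> cball x r)" using K by (rule compact_Int_closed) simp
  let ?h = "indicator ?I :: 'a \<Rightarrow> real"
  have h: "?h \<in> increasing_functions le" by (rule indicator_increasing[OF up_hull_increasing[OF cI]])
  have 1: "?h z = 1" if "z \<in> ball x r \<inter> K" for z
    using that up_hull_superset[of "K \<inter> cball x r"] by (auto simp: indicator_def)
  have 0: "?h z = 0" if "z \<in> B" for z
    using that AB(5) r(2) by (auto simp: indicator_def up_hull_def order_graph_def)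
  have "separated (ball x r \<inter> K) (B \<inter> K)"
    by (rule separatedI[OF increasing_differences_of_increasing(1)[OF h]]) (use 0 1 in auto)
  moreover have "separated (B \<inter> K) (ball x r \<inter> K)"
    by (rule separatedI[OF increasing_differences_of_increasing(2)[OF h]]) (use 0 1 in auto)
  ultimately show ?thesis
    using AB r(1) by (intro exI[of _ "ball x r"] exI[of _ B]) auto
qed

text \<open>By antisymmetry two distinct points are not comparable in at least one direction, so they have
separated neighbourhoods. Two compactness arguments, first in \<open>D\<close> for a fixed point of \<open>C\<close> and
then in \<open>C\<close>, combine finitely many of them by minima and maxima.\<close>

lemma separated_compact:
  assumes C: "compact C" and D: "compact D" and disj: "C \<inter> D = {}"
  shows "separated C D"
proof -
  let ?K = "C \<union> D"
  have K: "compact ?K" using C D by (rule compact_Un)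
  have pts: "\<exists>U W. open U \<and> open W \<and> x \<in> U \<and> y \<in> W \<and> separated (U \<inter> ?K) (W \<inter> ?K)"
    if "x \<in> C" "y \<in> D" for x y
  proof -
    have "\<not> x \<preceq> y \<or> \<not> y \<preceq> x" using that disj le_antisym by blast
    then show ?thesis using separated_near_incomparable[OF K] by blast
  qed
  have "\<exists>U. open U \<and> x \<in> U \<and> separated (U \<inter> ?K) D" if x: "x \<in> C" for x
  proof -
    obtain U W where UW: "\<And>y. y \<in> D \<Longrightarrow> open (U y) \<and> open (W y) \<and> x \<in> U y \<and> y \<in> W y \<and>
        separated (U y \<inter> ?K) (W y \<inter> ?K)"
      using pts[OF x] by metis
    obtain S where S: "S \<subseteq> D" "finite S" "D \<subseteq> (\<Union>y\<in>S. W y)"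
      by (rule compactE_image[OF D, of D W]) (use UW in auto)
    let ?U = "\<Inter>y\<in>S. U y"
    have "separated (?U \<inter> ?K) (\<Union>y\<in>S. W y \<inter> ?K)"
    proof (rule separated_UN(1)[OF S(2)])
      fix y assume y: "y \<in> S"
      then have "separated (U y \<inter> ?K) (W y \<inter> ?K)" using S UW by blast
      then show "separated (?U \<inter> ?K) (W y \<inter> ?K)" by (rule separated_mono) (use y in auto)
    qed
    then have "separated (?U \<inter> ?K) D" by (rule separated_mono) (use S in auto)
    moreover have "open ?U" "x \<in> ?U" using S UW by (auto intro!: open_INT)
    ultimately show ?thesis by blast
  qed
  then obtain U where U: "\<And>x. x \<in> C \<Longrightarrow> open (U x) \<and> x \<in> U x \<and> separated (U x \<inter> ?K) D" by metis
  obtain S where S: "S \<subseteq> C" "finite S" "C \<subseteq> (\<Union>x\<in>S. U x)"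
    by (rule compactE_image[OF C, of C U]) (use U in auto)
  have "separated (\<Union>x\<in>S. U x \<inter> ?K) D"
    by (rule separated_UN(2)[OF S(2)]) (use S U in blast)
  then show ?thesis by (rule separated_mono) (use S in auto)
qed

lemma increasing_differences_measurable:
  assumes "h \<in> increasing_differences" shows "h \<in> borel_measurable borel"
proof -
  obtain f g c where *: "f \<in> increasing_functions le" "g \<in> increasing_functions le"
    "h = (\<lambda>x. c * (f x - g x))" using assms unfolding increasing_differences_def by (auto simp: fun_eq_iff)
  have [measurable]: "f \<in> borel_measurable borel" "g \<in> borel_measurable borel"
    using * increasing_functionsD(1) by auto
  show ?thesis unfolding *(3) by measurable
qed

lemma integral_tendsto_increasing_differences:
  assumes mu: "\<And>n. borel_prob (\<mu> n)" and pi: "borel_prob \<pi>"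
    and conv: "\<And>g. g \<in> increasing_functions le \<Longrightarrow> ((\<lambda>n. \<integral>x. g x \<partial>\<mu> n) \<longlongrightarrow> (\<integral>x. g x \<partial>\<pi>)) F"
    and h: "h \<in> increasing_differences"
  shows "((\<lambda>n. \<integral>x. h x \<partial>\<mu> n) \<longlongrightarrow> (\<integral>x. h x \<partial>\<pi>)) F"
proof -
  obtain f g c where *: "f \<in> increasing_functions le" "g \<in> increasing_functions le"
    "h = (\<lambda>x. c * (f x - g x))" using h unfolding increasing_differences_def by (auto simp: fun_eq_iff)
  have int: "integrable \<mu> f" "integrable \<mu> g" if "borel_prob \<mu>" for \<mu>
    using * increasing_functionsD by (auto intro!: borel_prob_integrable[OF that, where B=1])
  have "(\<integral>x. h x \<partial>\<mu>) = c * ((\<integral>x. f x \<partial>\<mu>) - (\<integral>x. g x \<partial>\<mu>))"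
    if "borel_prob \<mu>" for \<mu>
    using int[OF that] by (simp add: *(3))
  then show ?thesis
    using mu pi conv[OF *(1)] conv[OF *(2)] by (auto intro!: tendsto_intros)
qed

text \<open>The separating function \<open>h\<close> is \<open>1\<close> on \<open>C\<close> and vanishes on the part \<open>D\<close> of a large compact set that
keeps a distance from \<open>C\<close>. So \<open>h\<close> bounds the indicator of \<open>C\<close> from above, its integrals converge,
and under \<open>\<pi>\<close> it exceeds the indicator by little: the neighbourhoods of \<open>C\<close> shrink to \<open>C\<close>.\<close>

lemma eventually_compact_le:
  assumes mu: "\<And>n. borel_prob (\<mu> n)" and pi: "borel_prob \<pi>"
    and conv: "\<And>g. g \<in> increasing_functions le \<Longrightarrow> ((\<lambda>n. \<integral>x. g x \<partial>\<mu> n) \<longlongrightarrow> (\<integral>x. g x \<partial>\<pi>)) F"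
    and C: "compact C" and e: "0 < e"
  shows "eventually (\<lambda>n. measure (\<mu> n) C \<le> measure \<pi> C + e) F"
proof (cases "C = {}")
  case True
  then show ?thesis using e by simp
next
  case False
  interpret pi: prob_space \<pi> using borel_probD[OF pi] by simp
  have closed_C: "closed C" using C by (rule compact_imp_closed)
  obtain K where K: "compact K" "1 - e/3 < measure \<pi> K"
    using borel_prob_compact_exhaust[OF pi, of "e/3"] e by auto
  let ?N = "\<lambda>n::nat. {x. infdist x C \<le> 1 / real (Suc n)}"
  have cN: "closed (?N n)" for n
    by (intro closed_Collect_le continuous_intros)
  have "(\<lambda>n. measure \<pi> (?N n)) \<longlonglongrightarrow> measure \<pi> C"
    by (rule closed_neighborhood_measure_tendsto[OF pi closed_C False])
  then have "eventually (\<lambda>n. measure \<pi> (?N n) < measure \<pi> C + e/3) sequentially"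
    using e by (intro order_tendstoD(2)[where y="measure \<pi> C"]) auto
  then obtain n where n: "measure \<pi> (?N n) < measure \<pi> C + e/3"
    by (auto dest: eventually_happens)
  define D where "D = K \<inter> {x. 1 / Suc n \<le> infdist x C}"
  have D: "compact D" unfolding D_def
    by (intro compact_Int_closed[OF K(1)] closed_Collect_le continuous_intros)
  have "C \<inter> D = {}" by (auto simp: D_def)
  then have "separated C D" by (rule separated_compact[OF C D])
  then obtain h where h: "h \<in> increasing_differences" "\<And>x. 0 \<le> h x" "\<And>x. h x \<le> 1"
      "\<And>x. x \<in> C \<Longrightarrow> h x = 1" "\<And>x. x \<in> D \<Longrightarrow> h x = 0"
    by (rule separatedE) blast
  have hm: "h \<in> borel_measurable borel" by (rule increasing_differences_measurable[OF h(1)])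
  have ih: "integrable \<mu> h" if "borel_prob \<mu>" for \<mu>
    by (rule borel_prob_integrable[OF that hm, of 1]) (use h in auto)
  have le: "measure (\<mu> n) C \<le> (\<integral>x. h x \<partial>\<mu> n)" for n
  proof -
    interpret prob_space "\<mu> n" using borel_probD[OF mu] by simp
    have "measure (\<mu> n) C = (\<integral>x. indicator C x \<partial>\<mu> n)"
      using closed_C borel_probD[OF mu] by simp
    also have "\<dots> \<le> (\<integral>x. h x \<partial>\<mu> n)"
      using borel_closed[OF closed_C] h
      by (intro integral_mono ih[OF mu] borel_prob_integrable[OF mu, where B=1])
        (auto split: split_indicator)
    finally show ?thesis .
  qed
  have "(\<integral>x. h x \<partial>\<pi>) \<le> (\<integral>x. indicator (?N n \<union> - K) x \<partial>\<pi>)"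
  proof (intro integral_mono ih[OF pi] borel_prob_integrable[OF pi, where B=1])
    show "indicator (?N n \<union> - K) \<in> borel_measurable borel"
      using cN[of n] K(1)[THEN compact_imp_closed] by (intro borel_measurable_indicator) auto
    show "h x \<le> indicator (?N n \<union> - K) x" for x
      using h(2,3)[of x] h(5)[of x] by (auto simp: indicator_def D_def)
  qed (auto simp: indicator_def)
  also have "\<dots> = measure \<pi> (?N n \<union> - K)"
    using cN[of n] K(1)[THEN compact_imp_closed] borel_probD[OF pi] by simp
  also have "\<dots> \<le> measure \<pi> (?N n) + measure \<pi> (- K)"
    using cN[of n] K(1)[THEN compact_imp_closed] borel_probD[OF pi]
    by (intro measure_Un_le) auto
  also have "measure \<pi> (- K) = 1 - measure \<pi> K"
    using K(1)[THEN compact_imp_closed] by (intro borel_prob_compl[OF pi] borel_closed)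
  finally have "(\<integral>x. h x \<partial>\<pi>) < measure \<pi> C + e" using n K(2) e by linarith
  moreover have "((\<lambda>n. \<integral>x. h x \<partial>\<mu> n) \<longlongrightarrow> (\<integral>x. h x \<partial>\<pi>)) F"
    by (rule integral_tendsto_increasing_differences[OF mu pi conv h(1)])
  ultimately have "eventually (\<lambda>n. (\<integral>x. h x \<partial>\<mu> n) < measure \<pi> C + e) F"
    by (simp add: order_tendstoD(2))
  then show ?thesis by eventually_elim (use le in \<open>meson le_less_trans less_imp_le\<close>)
qed

text \<open>The bound for constant sequences shows that the two measures agree on compact sets, and these
determine a Borel measure by inner regularity.\<close>

theorem increasing_functions_determine:
  assumes mu: "borel_prob \<mu>" and nu: "borel_prob \<nu>"
    and eq: "\<And>g. g \<in> increasing_functions le \<Longrightarrow> (\<integral>x. g x \<partial>\<mu>) = (\<integral>x. g x \<partial>\<nu>)"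
  shows "\<mu> = \<nu>"
proof (rule measure_eqI)
  interpret mu: prob_space \<mu> using borel_probD[OF mu] by simp
  interpret nu: prob_space \<nu> using borel_probD[OF nu] by simp
  have le: "measure \<mu> C \<le> measure \<nu> C"
    if "compact C" "borel_prob \<mu>" "borel_prob \<nu>"
      "\<And>g. g \<in> increasing_functions le \<Longrightarrow> (\<integral>x. g x \<partial>\<mu>) = (\<integral>x. g x \<partial>\<nu>)" for C \<mu> \<nu>
  proof (rule field_le_epsilon)
    fix e :: real assume "0 < e"
    then have "eventually (\<lambda>n::nat. measure \<mu> C \<le> measure \<nu> C + e) sequentially"
      by (intro eventually_compact_le) (use that in auto)
    then show "measure \<mu> C \<le> measure \<nu> C + e" by simp
  qed
  have C: "measure \<mu> C = measure \<nu> C" if "compact C" for C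
    using le[OF that mu nu eq] le[OF that nu mu eq[symmetric]] by (simp add: antisym)
  show "sets \<mu> = sets \<nu>" using borel_probD[OF mu] borel_probD[OF nu] by simp
  fix A assume A: "A \<in> sets \<mu>"
  have "emeasure \<mu> A = (SUP K\<in>{K. K \<subseteq> A \<and> compact K}. emeasure \<mu> K)"
    by (rule inner_regular) (use borel_probD[OF mu] A in auto)
  also have "\<dots> = (SUP K\<in>{K. K \<subseteq> A \<and> compact K}. emeasure \<nu> K)"
    by (intro SUP_cong) (auto simp: mu.emeasure_eq_measure nu.emeasure_eq_measure C)
  also have "\<dots> = emeasure \<nu> A"
    by (rule inner_regular[symmetric]) (use borel_probD[OF mu] borel_probD[OF nu] A in auto)
  finally show "emeasure \<mu> A = emeasure \<nu> A" .
qed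

text \<open>Tightness extends the upper bound from compact to closed sets. Superlevel sets of a continuous
function are closed, so it holds for integrals; applied to \<open>f\<close> and to \<open>1 - f\<close> it gives convergence.\<close>

theorem tight_converges_weakly:
  assumes mu: "\<And>n. borel_prob (\<mu> n)" and pi: "borel_prob \<pi>"
    and conv: "\<And>g. g \<in> increasing_functions le \<Longrightarrow> (\<lambda>n. \<integral>x. g x \<partial>\<mu> n) \<longlonglongrightarrow> (\<integral>x. g x \<partial>\<pi>)"
    and tight: "tight_laws \<mu>"
  shows "weakly_converges \<mu> \<pi>"
proof -
  interpret pi: prob_space \<pi> using borel_probD[OF pi] by simp
  have cl: "eventually (\<lambda>n. measure (\<mu> n) A \<le> measure \<pi> A + e) sequentially"
    if A: "closed A" and e: "0 < e" for A e
  proof -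
    obtain K where K: "compact K" "\<And>n. 1 - e/2 \<le> measure (\<mu> n) K"
      using tight e unfolding tight_laws_def by (meson half_gt_zero)
    have closed_K: "closed K" using K(1) by (rule compact_imp_closed)
    have "compact (A \<inter> K)" using A K(1) by (rule closed_Int_compact)
    have "eventually (\<lambda>n. measure (\<mu> n) (A \<inter> K) \<le> measure \<pi> (A \<inter> K) + e/2) sequentially"
      by (rule eventually_compact_le[OF mu pi conv \<open>compact (A \<inter> K)\<close> half_gt_zero[OF e]])
    then show ?thesis
    proof eventually_elim
      case (elim n)
      interpret prob_space "\<mu> n" using borel_probD[OF mu] by simp
      have "measure (\<mu> n) A \<le> measure (\<mu> n) ((A \<inter> K) \<union> - K)"
        using A closed_K borel_probD[OF mu] by (intro finite_measure_mono) auto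
      also have "\<dots> \<le> measure (\<mu> n) (A \<inter> K) + measure (\<mu> n) (- K)"
        using A closed_K borel_probD[OF mu] by (intro measure_Un_le) auto
      also have "measure (\<mu> n) (- K) = 1 - measure (\<mu> n) K"
        using closed_K by (intro borel_prob_compl[OF mu] borel_closed)
      finally have "measure (\<mu> n) A \<le> measure (\<mu> n) (A \<inter> K) + e/2" using K(2)[of n] by simp
      moreover have "measure \<pi> (A \<inter> K) \<le> measure \<pi> A"
        using A closed_K borel_probD[OF pi] by (intro pi.finite_measure_mono) auto
      ultimately show ?case using elim by linarith
    qed
  qed
  have upper: "eventually (\<lambda>n. (\<integral>x. f x \<partial>\<mu> n) \<le> (\<integral>x. f x \<partial>\<pi>) + e) sequentially"
    if f: "continuous_on UNIV f" "\<And>x. 0 \<le> f x" "\<And>x. f x \<le> 1" and e: "0 < e" for f :: "'a \<Rightarrow> real" and e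
    using f(1) by (intro eventually_integral_le_of_superlevels[OF mu pi _ f(2,3) cl e]
        borel_measurable_continuous_onI closed_Collect_le continuous_intros) auto
  have lim: "(\<lambda>n. \<integral>x. f x \<partial>\<mu> n) \<longlonglongrightarrow> (\<integral>x. f x \<partial>\<pi>)"
    if f: "continuous_on UNIV f" "\<And>x. 0 \<le> f x" "\<And>x. f x \<le> 1" for f :: "'a \<Rightarrow> real"
  proof (rule tendstoI)
    fix e :: real assume e: "0 < e"
    have int: "integrable \<mu> f" if "borel_prob \<mu>" for \<mu>
      by (rule borel_prob_integrable[OF that, of _ 1])
        (use f borel_measurable_continuous_onI in auto)
    have compl: "(\<integral>x. 1 - f x \<partial>\<mu>) = 1 - (\<integral>x. f x \<partial>\<mu>)" if "borel_prob \<mu>" for \<mu>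
    proof -
      interpret prob_space \<mu> using borel_probD[OF that] by simp
      show ?thesis using int[OF that] by (simp add: prob_space)
    qed
    have "eventually (\<lambda>n. (\<integral>x. f x \<partial>\<mu> n) \<le> (\<integral>x. f x \<partial>\<pi>) + e/2) sequentially"
      by (rule upper) (use f e in auto)
    moreover have "eventually (\<lambda>n. (\<integral>x. 1 - f x \<partial>\<mu> n) \<le> (\<integral>x. 1 - f x \<partial>\<pi>) + e/2) sequentially"
      by (rule upper) (use f e in \<open>auto intro!: continuous_intros\<close>)
    ultimately show "eventually (\<lambda>n. dist (\<integral>x. f x \<partial>\<mu> n) (\<integral>x. f x \<partial>\<pi>) < e) sequentially"
      by eventually_elim (use e in \<open>simp add: compl mu pi dist_real_def abs_le_iff\<close>)
  qed
  show ?thesis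
    unfolding weakly_converges_def
  proof (intro allI impI, elim conjE)
    fix f :: "'a \<Rightarrow> real" assume f: "continuous_on UNIV f" "bounded (range f)"
    then obtain B where B: "0 < B" "\<And>x. \<bar>f x\<bar> \<le> B" unfolding bounded_pos by auto
    let ?f = "\<lambda>x. (f x + B) / (2 * B)"
    have int: "integrable \<mu> f" if "borel_prob \<mu>" for \<mu>
      by (rule borel_prob_integrable[OF that, of _ B])
        (use f B borel_measurable_continuous_onI in auto)
    have "(\<lambda>n. \<integral>x. ?f x \<partial>\<mu> n) \<longlonglongrightarrow> (\<integral>x. ?f x \<partial>\<pi>)"
    proof (rule lim)
      show "continuous_on UNIV ?f" using f B by (auto intro!: continuous_intros)
      show "0 \<le> ?f x" "?f x \<le> 1" for x using B(1) B(2)[of x] by (auto simp: field_simps abs_le_iff)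
    qed
    moreover have scaled: "(\<integral>x. ?f x \<partial>\<mu>) = ((\<integral>x. f x \<partial>\<mu>) + B) / (2 * B)" if "borel_prob \<mu>" for \<mu>
    proof -
      interpret prob_space \<mu> using borel_probD[OF that] by simp
      show ?thesis using int[OF that] by (simp add: prob_space)
    qed
    ultimately have "(\<lambda>n. ((\<integral>x. f x \<partial>\<mu> n) + B) / (2 * B)) \<longlonglongrightarrow> ((\<integral>x. f x \<partial>\<pi>) + B) / (2 * B)"
      by (simp only: scaled[OF mu] scaled[OF pi])
    then have "(\<lambda>n. ((\<integral>x. f x \<partial>\<mu> n) + B) / (2 * B) * (2 * B) - B)
        \<longlonglongrightarrow> ((\<integral>x. f x \<partial>\<pi>) + B) / (2 * B) * (2 * B) - B"
      by (rule tendsto_diff[OF tendsto_mult_right tendsto_const])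
    then show "(\<lambda>n. \<integral>x. f x \<partial>\<mu> n) \<longlonglongrightarrow> (\<integral>x. f x \<partial>\<pi>)" using B(1) by simp
  qed
qed

end

section \<open>Weak limits of tight sequences\<close>

text \<open>A countable product of metric spaces is metrizable, so Tychonoff's theorem yields sequential
compactness.\<close>

lemma compact_PiE_seq:
  fixes J :: "'i::countable \<Rightarrow> 'a::metric_space set"
  assumes J: "\<And>j. compact (J j)" and x: "\<And>n j. x n j \<in> J j"
  shows "\<exists>r y. strict_mono (r :: nat \<Rightarrow> nat) \<and> (\<forall>j. y j \<in> J j \<and> (\<lambda>n. x (r n) j) \<longlonglongrightarrow> y j)"
proof -
  have "compactin (product_topology (\<lambda>_. euclidean) UNIV) (PiE UNIV J)"
    using J by (subst compactin_PiE) auto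
  then have "compact (PiE UNIV J)" by (simp add: euclidean_product_topology)
  then have "seq_compact (PiE UNIV J)" by (rule compact_imp_seq_compact)
  moreover have "\<forall>n. x n \<in> PiE UNIV J" using x by auto
  ultimately obtain y r where r: "y \<in> PiE UNIV J" "strict_mono (r :: nat \<Rightarrow> nat)" "(x \<circ> r) \<longlonglongrightarrow> y"
    by (rule seq_compactE) blast
  have "(\<lambda>n. x (r n) j) \<longlonglongrightarrow> y j" for j
    using continuous_on_tendsto_compose[OF continuous_on_product_coordinates[of j] r(3)]
    by (simp add: o_def)
  with r(1,2) show ?thesis by (intro exI[of _ r] exI[of _ y]) auto
qed

lemma discrete_integral_approx:
  fixes h :: "'b \<Rightarrow> real"
  assumes \<nu>: "prob_space \<nu>" "sets \<nu> = UNIV" and h: "\<And>s. \<bar>h s\<bar> \<le> 1" and S: "finite S"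
  shows "\<bar>(\<integral>s. h s \<partial>\<nu>) - (\<Sum>s\<in>S. h s * measure \<nu> {s})\<bar> \<le> 1 - measure \<nu> S"
proof -
  interpret prob_space \<nu> by fact
  have sp: "space \<nu> = UNIV" using \<nu>(2) sets.top[of \<nu>] sets.sets_into_space[of UNIV \<nu>] by auto
  have meas: "f \<in> borel_measurable \<nu>" for f :: "'b \<Rightarrow> real"
    using \<nu>(2) by (auto simp: measurable_def sp)
  have int: "integrable \<nu> f" if "\<And>s. \<bar>f s\<bar> \<le> 1" for f :: "'b \<Rightarrow> real"
    using that by (intro integrable_const_bound[where B=1] meas) auto
  have "(\<Sum>s\<in>S. h s * measure \<nu> {s}) = (\<Sum>s\<in>S. \<integral>t. h s * indicator {s} t \<partial>\<nu>)"
    using \<nu>(2) sp by simp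
  also have "\<dots> = (\<integral>t. (\<Sum>s\<in>S. h s * indicator {s} t) \<partial>\<nu>)"
    using h by (intro Bochner_Integration.integral_sum[symmetric] int)
      (auto simp: indicator_def)
  also have "\<dots> = (\<integral>t. h t * indicator S t \<partial>\<nu>)"
    using S by (intro Bochner_Integration.integral_cong) (auto simp: indicator_def sum.delta if_distrib[of "\<lambda>x. _ * x"] cong: if_cong)
  finally have "(\<integral>s. h s \<partial>\<nu>) - (\<Sum>s\<in>S. h s * measure \<nu> {s}) = (\<integral>s. h s - h s * indicator S s \<partial>\<nu>)"
    using h by (subst Bochner_Integration.integral_diff) (auto intro!: int simp: indicator_def)
  also have "\<bar>\<dots>\<bar> \<le> (\<integral>s. 1 - indicator S s \<partial>\<nu>)"
    using h by (intro integral_abs_bound[THEN order_trans] integral_mono int)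
      (auto simp: indicator_def)
  also have "\<dots> = 1 - measure \<nu> S"
    using \<nu>(2) sp by (subst Bochner_Integration.integral_diff) (use prob_space in \<open>auto intro!: int\<close>)
  finally show ?thesis .
qed

text \<open>The pointwise limits of the masses have total mass at most \<open>1\<close> by Fatou's lemma and at least \<open>1\<close> by
tightness, and the finite sets that carry almost all mass control the integrals.\<close>

lemma tight_discrete_limit:
  fixes \<nu> :: "nat \<Rightarrow> 'b::countable measure"
  assumes \<nu>: "\<And>n. prob_space (\<nu> n)" "\<And>n. sets (\<nu> n) = UNIV"
    and lim: "\<And>s. (\<lambda>n. measure (\<nu> n) {s}) \<longlonglongrightarrow> l s"
    and tight: "\<And>e. 0 < e \<Longrightarrow> \<exists>S. finite S \<and> (\<forall>n. 1 - e \<le> measure (\<nu> n) S)"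
  shows "\<exists>p :: 'b pmf. (\<forall>s. pmf p s = l s) \<and>
     (\<forall>h :: 'b \<Rightarrow> real. (\<forall>s. \<bar>h s\<bar> \<le> 1) \<longrightarrow> (\<lambda>n. \<integral>s. h s \<partial>\<nu> n) \<longlonglongrightarrow> (\<integral>s. h s \<partial>p))"
proof -
  have sp: "space (\<nu> n) = UNIV" for n
    using \<nu>(2) sets.top[of "\<nu> n"] sets.sets_into_space[of UNIV "\<nu> n"] by auto
  have em: "emeasure (\<nu> n) S = ennreal (measure (\<nu> n) S)" for n S
    using \<nu>(1)[of n] by (intro finite_measure.emeasure_eq_measure prob_space.axioms)
  have meas_sum: "measure (\<nu> n) S = (\<Sum>s\<in>S. measure (\<nu> n) {s})" if "finite S" for n S
    using that \<nu> by (intro finite_measure.finite_measure_eq_sum_singleton prob_space.axioms) auto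
  have l0: "0 \<le> l s" for s by (rule LIMSEQ_le_const[OF lim]) auto
  have sum_lim: "(\<lambda>n. measure (\<nu> n) S) \<longlonglongrightarrow> sum l S" if "finite S" for S
    unfolding meas_sum[OF that] by (intro tendsto_sum lim)
  have "(\<integral>\<^sup>+s. ennreal (l s) \<partial>count_space UNIV) \<le> 1"
  proof -
    have "(\<lambda>n. emeasure (\<nu> n) {s}) \<longlonglongrightarrow> ennreal (l s)" for s
      unfolding em by (intro tendsto_ennrealI lim)
    then have "(\<integral>\<^sup>+s. ennreal (l s) \<partial>count_space UNIV)
        = (\<integral>\<^sup>+s. liminf (\<lambda>n. emeasure (\<nu> n) {s}) \<partial>count_space UNIV)"
      by (intro nn_integral_cong lim_imp_Liminf[symmetric]) auto
    also have "\<dots> \<le> liminf (\<lambda>n. \<integral>\<^sup>+s. emeasure (\<nu> n) {s} \<partial>count_space UNIV)"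
      by (intro nn_integral_liminf) auto
    also have "\<dots> = liminf (\<lambda>n. 1)"
    proof (intro arg_cong[where f=liminf] ext)
      show "(\<integral>\<^sup>+s. emeasure (\<nu> n) {s} \<partial>count_space UNIV) = 1" for n
      using emeasure_countable_singleton[of UNIV "\<nu> n"] \<nu>(2)[of n] prob_space.emeasure_space_1[OF \<nu>(1)[of n]] sp
      by simp
    qed
    finally show ?thesis by (simp add: Liminf_const)
  qed
  moreover have "1 \<le> (\<integral>\<^sup>+s. ennreal (l s) \<partial>count_space UNIV)"
  proof (rule ennreal_le_epsilon)
    fix e :: real assume e: "0 < e"
    obtain S where S: "finite S" "\<And>n. 1 - e \<le> measure (\<nu> n) S" using tight[OF e] by blast
    have "1 - e \<le> sum l S" by (rule LIMSEQ_le_const[OF sum_lim[OF S(1)]]) (use S in auto)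
    then have "1 \<le> ennreal (sum l S) + ennreal e"
      using e l0 by (subst ennreal_plus[symmetric]) (auto intro!: sum_nonneg simp: ennreal_ge_1)
    also have "ennreal (sum l S) = (\<Sum>s\<in>S. ennreal (l s))" using l0 by (simp add: sum_ennreal)
    also have "\<dots> = (\<integral>\<^sup>+s. ennreal (l s) * indicator S s \<partial>count_space UNIV)"
      using S(1) by (simp add: nn_integral_count_space_indicator[symmetric] nn_integral_count_space_finite)
    also have "\<dots> \<le> (\<integral>\<^sup>+s. ennreal (l s) \<partial>count_space UNIV)"
      by (intro nn_integral_mono) (auto simp: indicator_def)
    finally show "1 \<le> (\<integral>\<^sup>+s. ennreal (l s) \<partial>count_space UNIV) + ennreal e"
      by (simp add: add_right_mono)
  qed
  ultimately have "(\<integral>\<^sup>+s. ennreal (l s) \<partial>count_space UNIV) = 1" by (rule antisym)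
  then have p: "pmf (embed_pmf l) s = l s" for s using l0 by (intro pmf_embed_pmf) auto
  let ?p = "embed_pmf l"
  have "(\<lambda>n. \<integral>s. h s \<partial>\<nu> n) \<longlonglongrightarrow> (\<integral>s. h s \<partial>?p)" if h: "\<And>s. \<bar>h s\<bar> \<le> 1" for h :: "'b \<Rightarrow> real"
  proof (rule tendstoI)
    fix e :: real assume e: "0 < e"
    obtain S where S: "finite S" "\<And>n. 1 - e/4 \<le> measure (\<nu> n) S" using tight[of "e/4"] e by auto
    have "1 - e/4 \<le> sum l S" by (rule LIMSEQ_le_const[OF sum_lim[OF S(1)]]) (use S in auto)
    also have "sum l S = measure ?p S" using S(1) by (simp add: measure_measure_pmf_finite p)
    finally have pS: "1 - e/4 \<le> measure ?p S" .
    have ap: "\<bar>(\<integral>s. h s \<partial>?p) - (\<Sum>s\<in>S. h s * l s)\<bar> \<le> e/4"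
      using discrete_integral_approx[where h=h, OF prob_space_measure_pmf[of ?p] _ h S(1)] pS
      by (simp add: measure_pmf_single p)
    have an: "\<bar>(\<integral>s. h s \<partial>\<nu> n) - (\<Sum>s\<in>S. h s * measure (\<nu> n) {s})\<bar> \<le> e/4" for n
      using discrete_integral_approx[where h=h, OF \<nu> h S(1), of n] S(2)[of n] by simp
    have "(\<lambda>n. \<Sum>s\<in>S. h s * measure (\<nu> n) {s}) \<longlonglongrightarrow> (\<Sum>s\<in>S. h s * l s)"
      by (intro tendsto_intros lim)
    then have "eventually (\<lambda>n. dist (\<Sum>s\<in>S. h s * measure (\<nu> n) {s}) (\<Sum>s\<in>S. h s * l s) < e/4) sequentially"
      using e by (intro tendstoD) auto
    then show "eventually (\<lambda>n. dist (\<integral>s. h s \<partial>\<nu> n) (\<integral>s. h s \<partial>?p) < e) sequentially"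
    proof eventually_elim
      case (elim n)
      show ?case using elim an[of n] ap e unfolding dist_real_def by linarith
    qed
  qed
  with p show ?thesis by blast
qed

lemma geometric_steps_limit:
  fixes s :: "nat \<Rightarrow> 'a::complete_space"
  assumes s: "\<And>k. dist (s k) (s (Suc k)) \<le> 2 * (1/2)^k"
  shows "convergent s" "dist (s k) (lim s) \<le> 4 * (1/2)^k"
proof -
  have *: "dist (s k) (s (k + n)) \<le> 4 * (1/2)^k - 4 * (1/2)^(k + n)" for k n
  proof (induction n)
    case (Suc n)
    have "dist (s k) (s (k + Suc n)) \<le> dist (s k) (s (k + n)) + dist (s (k + n)) (s (Suc (k + n)))"
      by (simp add: dist_triangle)
    also have "\<dots> \<le> 4 * (1/2)^k - 4 * (1/2)^(k + n) + 2 * (1/2)^(k + n)"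
      by (intro add_mono Suc s)
    finally show ?case by simp
  qed simp
  then have bound: "dist (s k) (s n) \<le> 4 * (1/2)^k" if "k \<le> n" for k n
  proof -
    have "dist (s k) (s n) \<le> 4 * (1/2)^k - 4 * (1/2)^n" using *[of k "n - k"] that by simp
    moreover have "0 \<le> (1/2::real)^n" by (rule zero_le_power) simp
    ultimately show ?thesis by linarith
  qed
  have "Cauchy s"
    unfolding Cauchy_altdef2
  proof (intro allI impI)
    fix e :: real assume e: "0 < e"
    have "(\<lambda>k. 4 * (1/2::real)^k) \<longlonglongrightarrow> 4 * 0"
      by (intro tendsto_mult_left LIMSEQ_realpow_zero) auto
    then have "eventually (\<lambda>k. 4 * (1/2::real)^k < e) sequentially"
      using e by (intro order_tendstoD(2)) auto
    then obtain N where "4 * (1/2::real)^N < e" by (auto dest: eventually_happens)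
    then show "\<exists>N. \<forall>n\<ge>N. dist (s n) (s N) < e"
      using bound[of N] by (intro exI[of _ N]) (auto simp: dist_commute intro: le_less_trans)
  qed
  then show "convergent s" by (rule Cauchy_convergent)
  then have "s \<longlonglongrightarrow> lim s" by (simp add: convergent_LIMSEQ_iff)
  then have "(\<lambda>n. dist (s k) (s n)) \<longlonglongrightarrow> dist (s k) (lim s)" by (intro tendsto_intros)
  then show "dist (s k) (lim s) \<le> 4 * (1/2)^k"
    by (rule LIMSEQ_le_const2) (use bound in blast)
qed

text \<open>A point \<open>x\<close> is coded by the indices of points of a dense sequence within \<open>2^-k\<close> of \<open>x\<close>, for
\<open>k = 0, 1, \<dots>\<close>. Only finitely many prefixes of a given length occur on a compact set, so that the
laws of the prefixes of a tight sequence are tight laws on a countable set.\<close>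

locale dense_sequence =
  fixes c :: "nat \<Rightarrow> 'a::polish_space"
  assumes dense: "\<And>x e. 0 < e \<Longrightarrow> \<exists>i. dist x (c i) < e"
begin

definition near :: "nat \<Rightarrow> 'a \<Rightarrow> nat" where
  "near k x = (LEAST i. dist x (c i) < (1/2)^k)"

definition code :: "nat \<Rightarrow> 'a \<Rightarrow> nat list" where
  "code m x = map (\<lambda>k. near k x) [0..<m]"

lemma dist_near: "dist x (c (near k x)) < (1/2)^k"
  unfolding near_def by (rule LeastI_ex) (rule dense, simp)

lemma near_measurable: "near k \<in> borel \<rightarrow>\<^sub>M count_space UNIV"
  unfolding near_def by measurable

lemma length_code [simp]: "length (code m x) = m"
  and nth_code [simp]: "k < m \<Longrightarrow> code m x ! k = near k x"
  and take_code: "m \<le> m' \<Longrightarrow> take m (code m' x) = code m x"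
  by (simp_all add: code_def take_map)

lemma code_measurable: "code m \<in> borel \<rightarrow>\<^sub>M count_space UNIV"
proof (subst measurable_count_space_eq2_countable, intro conjI ballI)
  fix s :: "nat list"
  note near_measurable[measurable]
  have "code m -` {s} \<inter> space borel = {x. length s = m \<and> (\<forall>k<m. near k x = s ! k)}"
    by (auto simp: list_eq_iff_nth_eq)
  also have "\<dots> \<in> sets borel" by measurable
  finally show "code m -` {s} \<inter> space borel \<in> sets borel" .
qed auto

lemma finite_code_image:
  assumes K: "compact K" shows "finite (code m ` K)"
proof -
  have "\<exists>N. \<forall>x\<in>K. near k x \<le> N" for k
  proof -
    obtain S where S: "finite S" "K \<subseteq> (\<Union>i\<in>S. ball (c i) ((1/2)^k))"
    proof (rule compactE_image[OF K, of UNIV "\<lambda>i. ball (c i) ((1/2)^k)"])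
      show "K \<subseteq> (\<Union>i. ball (c i) ((1/2)^k))"
        using dist_near[where k=k] by (auto simp: dist_commute intro!: exI[of _ "near k _"])
    qed auto
    have "near k x \<le> Max S" if x: "x \<in> K" for x
    proof -
      obtain i where i: "i \<in> S" "dist x (c i) < (1/2)^k"
        using S(2) x by (force simp: dist_commute)
      have "near k x \<le> i" unfolding near_def by (rule Least_le) (rule i(2))
      also have "i \<le> Max S" using S(1) i(1) by simp
      finally show ?thesis .
    qed
    then show ?thesis by blast
  qed
  then obtain N where N: "\<And>k x. x \<in> K \<Longrightarrow> near k x \<le> N k" by metis
  have "code m ` K \<subseteq> {s. set s \<subseteq> {..Max (N ` {..<m})} \<and> length s = m}"
  proof safe
    fix x i assume "x \<in> K" "i \<in> set (code m x)"
    then obtain k where "k < m" "i = near k x" by (auto simp: code_def)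
    then show "i \<le> Max (N ` {..<m})"
      using N[OF \<open>x \<in> K\<close>, of k] by (auto intro: order_trans[OF _ Max_ge])
  qed simp
  then show ?thesis by (rule finite_subset) (rule finite_lists_length_eq, simp)
qed

end

lemma dense_sequence_exists: "\<exists>c :: nat \<Rightarrow> 'a::polish_space. dense_sequence c"
proof -
  obtain D :: "'a set" where D: "countable D" "\<And>X. open X \<Longrightarrow> X \<noteq> {} \<Longrightarrow> \<exists>d\<in>D. d \<in> X"
    using countable_dense_setE by blast
  have "D \<noteq> {}" using D(2)[of UNIV] by auto
  then have range: "range (from_nat_into D) = D" using D(1) by (rule range_from_nat_into)
  have "\<exists>i. dist x (from_nat_into D i) < e" if "0 < e" for x e
    using D(2)[of "ball x e"] that range by (metis centre_in_ball emptyE imageE mem_ball open_ball)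
  then show ?thesis by (intro exI[of _ "from_nat_into D"]) (unfold_locales)
qed

context dense_sequence begin

definition decode :: "nat set \<Rightarrow> nat list \<Rightarrow> nat \<Rightarrow> 'a" where
  "decode J s = (\<lambda>k\<in>J. c (s ! k))"

lemma decode_space: "decode J s \<in> space (PiM J (\<lambda>_. borel))"
  by (auto simp: decode_def space_PiM)

lemma decode_measurable: "decode J \<in> measurable (measure_pmf p) (PiM J (\<lambda>_. borel))"
  using decode_space by (auto simp: measurable_def)

text \<open>The length of code prefixes that determines all coordinates in \<open>J\<close>.\<close>

definition depth :: "nat set \<Rightarrow> nat" where
  "depth J = Max (insert 0 (Suc ` J))"

lemma depth_less: "finite J \<Longrightarrow> k \<in> J \<Longrightarrow> k < depth J"
  unfolding depth_def by (rule Suc_le_lessD, rule Max_ge) auto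

lemma depth_mono: "J \<subseteq> H \<Longrightarrow> finite H \<Longrightarrow> depth J \<le> depth H"
  unfolding depth_def by (intro Max_mono) (auto intro: finite_subset)

definition code_law :: "(nat \<Rightarrow> nat list pmf) \<Rightarrow> nat set \<Rightarrow> (nat \<Rightarrow> 'a) measure" where
  "code_law p J = distr (measure_pmf (p (depth J))) (PiM J (\<lambda>_. borel)) (decode J)"

text \<open>A prefix of a code is the shorter code of the same point, which is the consistency condition needed
for Kolmogorov's extension theorem.\<close>

lemma code_law_projective:
  assumes p: "\<And>m m'. m \<le> m' \<Longrightarrow> map_pmf (take m) (p m') = p m"
  shows "polish_projective UNIV (code_law p)"
proof -
  have proj: "code_law p J = distr (code_law p H) (PiM J (\<lambda>_. borel)) (\<lambda>f. restrict f J)"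
    if JH: "J \<subseteq> H" "finite H" for J H
  proof -
  have [measurable]: "(\<lambda>f. restrict f J) \<in> measurable (PiM H (\<lambda>_. borel)) (PiM J (\<lambda>_. borel :: 'a measure))"
    using JH(1) by (rule measurable_restrict_subset)
  have finJ: "finite J" using JH finite_subset by blast
  have "code_law p J = distr (measure_pmf (map_pmf (take (depth J)) (p (depth H)))) (PiM J (\<lambda>_. borel)) (decode J)"
    unfolding code_law_def using p[OF depth_mono[OF JH]] by simp
  also have "\<dots> = distr (measure_pmf (p (depth H))) (PiM J (\<lambda>_. borel)) (decode J \<circ> take (depth J))"
    unfolding map_pmf_rep_eq by (intro distr_distr) (use decode_space in auto)
  also have "decode J \<circ> take (depth J) = (\<lambda>f. restrict f J) \<circ> decode H"
    using JH(1) depth_less[OF finJ] by (auto simp: decode_def fun_eq_iff restrict_def)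
  also have "distr (measure_pmf (p (depth H))) (PiM J (\<lambda>_. borel)) ((\<lambda>f. restrict f J) \<circ> decode H)
      = distr (code_law p H) (PiM J (\<lambda>_. borel)) (\<lambda>f. restrict f J)"
    unfolding code_law_def by (rule distr_distr[OF _ decode_measurable, symmetric]) measurable
    finally show ?thesis .
  qed
  have "prob_space (code_law p J)" for J
    unfolding code_law_def
    by (intro prob_space.prob_space_distr[OF prob_space_measure_pmf] decode_measurable)
  then show ?thesis
    unfolding polish_projective_def projective_family_def using proj by blast
qed

lemma code_limits_exist:
  fixes \<mu> :: "nat \<Rightarrow> 'a measure"
  assumes mu: "\<And>n. borel_prob (\<mu> n)" and tight: "tight_laws \<mu>"
  shows "\<exists>r p. strict_mono (r :: nat \<Rightarrow> nat) \<and>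
    (\<forall>m (h :: nat list \<Rightarrow> real). (\<forall>s. \<bar>h s\<bar> \<le> 1) \<longrightarrow>
       (\<lambda>n. \<integral>x. h (code m x) \<partial>\<mu> (r n)) \<longlonglongrightarrow> (\<integral>s. h s \<partial>measure_pmf (p m))) \<and>
    (\<forall>m s. s \<in> set_pmf (p m) \<longrightarrow> (\<exists>x. code m x = s))"
proof -
  define \<nu> where "\<nu> m n = distr (\<mu> n) (count_space UNIV) (code m)" for m n
  have meas: "code m \<in> measurable (\<mu> n) (count_space UNIV)" for m n
    using code_measurable by (simp add: borel_prob_measurable[OF mu])
  have \<nu>: "prob_space (\<nu> m n)" "sets (\<nu> m n) = UNIV" for m n
    unfolding \<nu>_def by (auto intro!: prob_space.prob_space_distr meas borel_probD[OF mu])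
  have \<nu>_meas: "measure (\<nu> m n) S = measure (\<mu> n) (code m -` S)" for m n S
    unfolding \<nu>_def by (subst measure_distr[OF meas]) (auto simp: borel_probD[OF mu])
  have "\<exists>r l. strict_mono (r :: nat \<Rightarrow> nat) \<and>
      (\<forall>ms :: nat \<times> nat list. l ms \<in> {0..1} \<and> (\<lambda>n. measure (\<nu> (fst ms) (r n)) {snd ms}) \<longlonglongrightarrow> l ms)"
    by (rule compact_PiE_seq[where x="\<lambda>n ms. measure (\<nu> (fst ms) n) {snd ms}"])
      (simp_all add: prob_space.prob_le_1[OF \<nu>(1)])
  then obtain r l where r: "strict_mono (r :: nat \<Rightarrow> nat)"
    and l: "\<forall>ms. (\<lambda>n. measure (\<nu> (fst ms) (r n)) {snd ms}) \<longlonglongrightarrow> l ms" by blast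
  from l have l: "(\<lambda>n. measure (\<nu> m (r n)) {s}) \<longlonglongrightarrow> l (m, s)" for m s by auto
  have t: "\<exists>S. finite S \<and> (\<forall>n. 1 - e \<le> measure (\<nu> m (r n)) S)" if "0 < e" for m e
  proof -
    obtain K where K: "compact K" "\<And>n. 1 - e \<le> measure (\<mu> n) K"
      using tight \<open>0 < e\<close> unfolding tight_laws_def by blast
    have "measure (\<mu> n) K \<le> measure (\<nu> m n) (code m ` K)" for n
    proof -
      interpret prob_space "\<mu> n" using borel_probD[OF mu] by simp
      have "code m -` (code m ` K) \<in> sets (\<mu> n)"
        using measurable_sets[OF meas, of "code m ` K" m n] borel_probD[OF mu] by simp
      then show ?thesis unfolding \<nu>_meas by (intro finite_measure_mono) auto
    qed
    then show ?thesis using K finite_code_image[OF K(1), of m]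
      by (intro exI[of _ "code m ` K"]) (auto intro: order_trans)
  qed
  have "\<exists>p :: nat list pmf. (\<forall>s. pmf p s = l (m, s)) \<and>
     (\<forall>h :: nat list \<Rightarrow> real. (\<forall>s. \<bar>h s\<bar> \<le> 1) \<longrightarrow> (\<lambda>n. \<integral>s. h s \<partial>\<nu> m (r n)) \<longlonglongrightarrow> (\<integral>s. h s \<partial>p))" for m
    by (rule tight_discrete_limit) (use \<nu> l[of m] t in auto)
  then obtain p where p: "\<And>m s. pmf (p m) s = l (m, s)"
    "\<And>m (h :: nat list \<Rightarrow> real). (\<And>s. \<bar>h s\<bar> \<le> 1) \<Longrightarrow> (\<lambda>n. \<integral>s. h s \<partial>\<nu> m (r n)) \<longlonglongrightarrow> (\<integral>s. h s \<partial>p m)"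
    by metis
  have "\<exists>x. code m x = s" if "s \<in> set_pmf (p m)" for m s
  proof (rule ccontr)
    assume "\<nexists>x. code m x = s"
    then have "code m -` {s} = {}" by auto
    then have "(\<lambda>n. 0) \<longlonglongrightarrow> l (m, s)" using l[of m s] by (simp add: \<nu>_meas)
    then have "l (m, s) = 0" by (simp add: LIMSEQ_const_iff)
    then show False using that p(1)[of m s] by (simp add: set_pmf_iff)
  qed
  moreover have "(\<lambda>n. \<integral>x. h (code m x) \<partial>\<mu> (r n)) \<longlonglongrightarrow> (\<integral>s. h s \<partial>p m)"
    if "\<forall>s. \<bar>h s\<bar> \<le> 1" for m and h :: "nat list \<Rightarrow> real"
  proof -
    have "(\<integral>s. h s \<partial>\<nu> m n) = (\<integral>x. h (code m x) \<partial>\<mu> n)" for n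
      unfolding \<nu>_def by (rule integral_distr[OF meas]) simp
    then show ?thesis using p(2)[of h m] that by simp
  qed
  ultimately show ?thesis using r by blast
qed

end

text \<open>Prokhorov's theorem. Along a subsequence the laws of all code prefixes converge. By Kolmogorov's
theorem their limits are the laws of the prefixes of a random sequence of points \<open>\<omega> k\<close>. A prefix of
positive mass is the code of an actual point, so consecutive entries are within \<open>2 * 2^-k\<close>, and the
sequence converges almost surely; \<open>\<pi>\<close> is the law of its limit \<open>\<xi>\<close>. Replacing a point by the \<open>k\<close>-th
entry of its code changes a Lipschitz function by a multiple of \<open>2^-k\<close>, uniformly in \<open>n\<close>, and the
integrals of the modified function depend on a finite prefix only.\<close>

theorem tight_subsequence_converges:
  fixes \<mu> :: "nat \<Rightarrow> 'a::polish_space measure"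
  assumes mu: "\<And>n. borel_prob (\<mu> n)" and tight: "tight_laws \<mu>"
  obtains r \<pi> where "strict_mono (r :: nat \<Rightarrow> nat)" "borel_prob \<pi>"
    "\<And>(f :: 'a \<Rightarrow> real) L. (\<And>x. 0 \<le> f x) \<Longrightarrow> (\<And>x. f x \<le> 1) \<Longrightarrow>
       (\<And>x y. \<bar>f x - f y\<bar> \<le> L * dist x y) \<Longrightarrow>
       (\<lambda>n. \<integral>x. f x \<partial>\<mu> (r n)) \<longlonglongrightarrow> (\<integral>x. f x \<partial>\<pi>)"
proof -
  obtain c :: "nat \<Rightarrow> 'a" where "dense_sequence c" using dense_sequence_exists by blast
  then interpret dense_sequence c .
  obtain r p where r: "strict_mono (r :: nat \<Rightarrow> nat)"
    and p: "\<And>m (h :: nat list \<Rightarrow> real). \<forall>s. \<bar>h s\<bar> \<le> 1 \<Longrightarrow>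
       (\<lambda>n. \<integral>x. h (code m x) \<partial>\<mu> (r n)) \<longlonglongrightarrow> (\<integral>s. h s \<partial>measure_pmf (p m))"
    and supp: "\<And>m s. s \<in> set_pmf (p m) \<Longrightarrow> \<exists>x. code m x = s"
    using code_limits_exist[OF mu tight] by blast
  have "map_pmf (take m) (p m') = p m" if mm: "m \<le> m'" for m m'
  proof (rule pmf_eqI)
    fix s
    have "(\<lambda>n. \<integral>x. indicator {s} (take m (code m' x)) \<partial>\<mu> (r n) :: real) \<longlonglongrightarrow>
        (\<integral>t. indicator {s} (take m t) \<partial>measure_pmf (p m'))"
      by (rule p[where h="\<lambda>t. indicator {s} (take m t)"]) (simp add: indicator_def)
    moreover have "(\<lambda>n. \<integral>x. indicator {s} (code m x) \<partial>\<mu> (r n) :: real) \<longlonglongrightarrow>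
        (\<integral>t. indicator {s} t \<partial>measure_pmf (p m))"
      by (rule p) (simp add: indicator_def)
    ultimately have "(\<integral>t. indicator {s} (take m t) \<partial>measure_pmf (p m'))
        = (\<integral>t. indicator {s} t \<partial>measure_pmf (p m) :: real)"
      unfolding take_code[OF mm] by (rule LIMSEQ_unique)
    moreover have "pmf q s = (\<integral>t. indicator {s} t \<partial>measure_pmf q)" for q :: "nat list pmf"
      by (simp add: measure_pmf_single)
    ultimately show "pmf (map_pmf (take m) (p m')) s = pmf (p m) s"
      by (simp only: integral_map_pmf)
  qed
  then interpret Q: polish_projective UNIV "code_law p" by (rule code_law_projective)
  let ?Q = "Q.lim"
  have distr_Q: "distr ?Q (PiM J (\<lambda>_. borel)) (\<lambda>\<omega>. restrict \<omega> J) = code_law p J" if J: "finite J" for J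
  proof (rule measure_eqI)
    show "sets (distr ?Q (PiM J (\<lambda>_. borel)) (\<lambda>\<omega>. restrict \<omega> J)) = sets (code_law p J)"
      by (simp add: code_law_def)
    fix A assume "A \<in> sets (distr ?Q (PiM J (\<lambda>_. borel)) (\<lambda>\<omega>. restrict \<omega> J))"
    then have A: "A \<in> sets (PiM J (\<lambda>_. borel))" by simp
    have "emeasure (distr ?Q (PiM J (\<lambda>_. borel)) (\<lambda>\<omega>. restrict \<omega> J)) A
        = emeasure ?Q ((\<lambda>\<omega>. restrict \<omega> J) -` A \<inter> space ?Q)"
      using A by (intro emeasure_distr) (auto intro!: measurable_restrict_subset[of J UNIV] simp: measurable_cong_sets[OF Q.sets_lim refl])
    also have "(\<lambda>\<omega>. restrict \<omega> J) -` A \<inter> space ?Q = prod_emb UNIV (\<lambda>_. borel) J A"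
      by (auto simp: prod_emb_def space_PiM)
    also have "emeasure ?Q \<dots> = emeasure (code_law p J) A"
      by (rule Q.emeasure_lim_emb) (use J A in auto)
    finally show "emeasure (distr ?Q (PiM J (\<lambda>_. borel)) (\<lambda>\<omega>. restrict \<omega> J)) A = emeasure (code_law p J) A" .
  qed
  have restr: "(\<lambda>\<omega>. restrict \<omega> J) \<in> measurable ?Q (PiM J (\<lambda>_. borel))" for J
    by (auto intro!: measurable_restrict_subset[of J UNIV] simp: measurable_cong_sets[OF Q.sets_lim refl])
  have coord [measurable]: "(\<lambda>\<omega>. \<omega> k) \<in> borel_measurable ?Q" for k
    by (auto intro!: measurable_component_singleton simp: measurable_cong_sets[OF Q.sets_lim refl])
  have step: "AE \<omega> in ?Q. dist (\<omega> k) (\<omega> (Suc k)) < 2 * (1/2)^k" for k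
  proof -
    let ?J = "{k, Suc k}" and ?D = "\<lambda>\<omega> :: nat \<Rightarrow> 'a. dist (\<omega> k) (\<omega> (Suc k)) < 2 * (1/2::real)^k"
    have [measurable]: "(\<lambda>\<omega>. \<omega> k) \<in> borel_measurable (PiM ?J (\<lambda>_. borel :: 'a measure))"
       "(\<lambda>\<omega>. \<omega> (Suc k)) \<in> borel_measurable (PiM ?J (\<lambda>_. borel :: 'a measure))"
      by (rule measurable_component_singleton; simp)+
    have meas: "{\<omega> \<in> space (PiM ?J (\<lambda>_. borel)). ?D \<omega>} \<in> sets (PiM ?J (\<lambda>_. borel))"
      by measurable
    have "AE s in p (depth ?J). ?D (decode ?J s)"
    proof (rule AE_pmfI)
      fix s assume "s \<in> set_pmf (p (depth ?J))"
      then obtain x where x: "code (depth ?J) x = s" using supp by blast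
      have "k < depth ?J" "Suc k < depth ?J" by (auto intro: depth_less)
      then have "decode ?J s k = c (near k x)" "decode ?J s (Suc k) = c (near (Suc k) x)"
        using x[symmetric] by (auto simp: decode_def)
      moreover have "dist (c (near k x)) (c (near (Suc k) x)) < 2 * (1/2)^k"
      proof -
        have "(1/2::real)^Suc k \<le> (1/2)^k" by (rule power_decreasing) auto
        then show ?thesis
          using dist_triangle3[of "c (near k x)" "c (near (Suc k) x)" x]
            dist_near[of x k] dist_near[of x "Suc k"] by linarith
      qed
      ultimately show "?D (decode ?J s)" by simp
    qed
    then have "AE \<omega> in code_law p ?J. ?D \<omega>"
      unfolding code_law_def using decode_measurable meas by (subst AE_distr_iff) auto
    then have "AE \<omega> in distr ?Q (PiM ?J (\<lambda>_. borel)) (\<lambda>\<omega>. restrict \<omega> ?J). ?D \<omega>"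
      by (subst distr_Q) auto
    then have "AE \<omega> in ?Q. ?D (restrict \<omega> ?J)"
      using restr meas by (subst (asm) AE_distr_iff) auto
    then show ?thesis by simp
  qed
  define N where "N \<omega> \<longleftrightarrow> (\<forall>k. dist (\<omega> k) (\<omega> (Suc k)) < 2 * (1/2::real)^k)" for \<omega> :: "nat \<Rightarrow> 'a"
  \<comment> \<open>Off the event \<open>N\<close> of full measure the sequence is made constant, so that it converges everywhere.\<close>
  define u where "u k \<omega> = (if N \<omega> then \<omega> k else c 0)" for k \<omega>
  define \<xi> where "\<xi> \<omega> = lim (\<lambda>k. u k \<omega>)" for \<omega>
  have AE_N: "AE \<omega> in ?Q. N \<omega>" unfolding N_def using step by (simp add: AE_all_countable)
  have u_step: "dist (u k \<omega>) (u (Suc k) \<omega>) \<le> 2 * (1/2)^k" for k \<omega>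
    by (cases "N \<omega>") (auto simp: u_def N_def less_imp_le)
  have u_lim: "(\<lambda>k. u k \<omega>) \<longlonglongrightarrow> \<xi> \<omega>" for \<omega>
    unfolding \<xi>_def using geometric_steps_limit(1)[of "\<lambda>k. u k \<omega>", OF u_step] by (simp add: convergent_LIMSEQ_iff)
  have u_dist: "dist (u k \<omega>) (\<xi> \<omega>) \<le> 4 * (1/2)^k" for k \<omega>
    unfolding \<xi>_def by (rule geometric_steps_limit(2)[of "\<lambda>k. u k \<omega>", OF u_step])
  have [measurable]: "Measurable.pred ?Q N" unfolding N_def by measurable
  have u_meas: "u k \<in> borel_measurable ?Q" for k unfolding u_def by measurable
  have \<xi>_meas: "\<xi> \<in> borel_measurable ?Q"
    by (rule borel_measurable_LIMSEQ_metric[OF u_meas u_lim])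
  define \<pi> where "\<pi> = distr ?Q borel \<xi>"
  have \<pi>: "borel_prob \<pi>"
    unfolding \<pi>_def using \<xi>_meas Q.P.prob_space_distr by (intro borel_probI) auto
  have "(\<lambda>n. \<integral>x. f x \<partial>\<mu> (r n)) \<longlonglongrightarrow> (\<integral>x. f x \<partial>\<pi>)"
    if f01: "\<And>x. 0 \<le> f x" "\<And>x. f x \<le> 1" and Lip: "\<And>x y. \<bar>f x - f y\<bar> \<le> L * dist x y"
    for f :: "'a \<Rightarrow> real" and L
  proof -
    define L' where "L' = max L 0"
    have L': "0 \<le> L'" "\<bar>f x - f y\<bar> \<le> L' * dist x y" for x y
      using Lip[of x y] mult_right_mono[of L L' "dist x y"] by (auto simp: L'_def intro: order_trans)
    have "L'-lipschitz_on UNIV f"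
      by (rule lipschitz_onI) (use L' in \<open>auto simp: dist_real_def\<close>)
    then have "continuous_on UNIV f" by (rule lipschitz_on_continuous_on)
    then have fm [measurable]: "f \<in> borel_measurable borel" by (rule borel_measurable_continuous_onI)
    have f_abs: "\<bar>f x\<bar> \<le> 1" for x using f01[of x] by simp
    have \<pi>_near: "\<bar>(\<integral>x. f x \<partial>\<pi>) - (\<integral>s. f (c (s ! k)) \<partial>measure_pmf (p (Suc k)))\<bar> \<le> L' * (4 * (1/2)^k)" for k
    proof -
      have depth: "depth {k} = Suc k" by (simp add: depth_def)
      have [measurable]: "(\<lambda>\<omega>. \<omega> k) \<in> borel_measurable (PiM {k} (\<lambda>_. borel :: 'a measure))"
        by (auto intro!: measurable_component_singleton)
      have "(\<integral>s. f (c (s ! k)) \<partial>measure_pmf (p (Suc k))) = (\<integral>s. f (decode {k} s k) \<partial>measure_pmf (p (depth {k})))"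
        by (simp add: depth decode_def)
      also have "\<dots> = (\<integral>\<omega>. f (\<omega> k) \<partial>code_law p {k})"
        unfolding code_law_def by (intro integral_distr[symmetric] decode_measurable) measurable
      also have "\<dots> = (\<integral>\<omega>. f (\<omega> k) \<partial>distr ?Q (PiM {k} (\<lambda>_. borel)) (\<lambda>\<omega>. restrict \<omega> {k}))"
        by (subst distr_Q) auto
      also have "\<dots> = (\<integral>\<omega>. f (restrict \<omega> {k} k) \<partial>?Q)"
        by (intro integral_distr restr) measurable
      also have "\<dots> = (\<integral>\<omega>. f (u k \<omega>) \<partial>?Q)"
        using u_meas by (intro integral_cong_AE) (use AE_N in \<open>auto simp: u_def\<close>)
      finally have 1: "(\<integral>s. f (c (s ! k)) \<partial>measure_pmf (p (Suc k))) = (\<integral>\<omega>. f (u k \<omega>) \<partial>?Q)" .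
      have 2: "(\<integral>x. f x \<partial>\<pi>) = (\<integral>\<omega>. f (\<xi> \<omega>) \<partial>?Q)"
        unfolding \<pi>_def by (intro integral_distr \<xi>_meas fm)
      have i: "integrable ?Q (\<lambda>\<omega>. f (\<xi> \<omega>))" "integrable ?Q (\<lambda>\<omega>. f (u k \<omega>))"
        by (rule Q.P.integrable_const_bound[where B=1],
            use f_abs \<xi>_meas u_meas in \<open>auto intro: measurable_compose[OF _ fm]\<close>)+
      have "\<bar>(\<integral>\<omega>. f (\<xi> \<omega>) \<partial>?Q) - (\<integral>\<omega>. f (u k \<omega>) \<partial>?Q)\<bar> = \<bar>\<integral>\<omega>. f (\<xi> \<omega>) - f (u k \<omega>) \<partial>?Q\<bar>"
        using i by simp
      also have "\<dots> \<le> (\<integral>\<omega>. L' * (4 * (1/2)^k) \<partial>?Q)"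
      proof (rule order_trans[OF integral_abs_bound integral_mono])
        show "\<bar>f (\<xi> \<omega>) - f (u k \<omega>)\<bar> \<le> L' * (4 * (1/2)^k)" for \<omega>
          using L'(2)[of "\<xi> \<omega>" "u k \<omega>"] mult_left_mono[OF u_dist[of k \<omega>] L'(1)]
          by (simp add: dist_commute)
      qed (use i in auto)
      also have "\<dots> = L' * (4 * (1/2)^k)" using Q.P.prob_space by simp
      finally show ?thesis unfolding 1 2 .
    qed
    have \<mu>_near: "\<bar>(\<integral>x. f x \<partial>\<mu> n) - (\<integral>x. f (c (near k x)) \<partial>\<mu> n)\<bar> \<le> L' * (1/2)^k" for n k
    proof -
      interpret prob_space "\<mu> n" using borel_probD[OF mu] by simp
      have "(\<lambda>x. f (c (near k x))) \<in> borel_measurable borel"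
        using measurable_compose[OF near_measurable, of "\<lambda>i. f (c i)" borel k] by simp
      then have i: "integrable (\<mu> n) f" "integrable (\<mu> n) (\<lambda>x. f (c (near k x)))"
        using f_abs fm by (auto intro!: borel_prob_integrable[OF mu, where B=1])
      have "\<bar>(\<integral>x. f x \<partial>\<mu> n) - (\<integral>x. f (c (near k x)) \<partial>\<mu> n)\<bar> = \<bar>\<integral>x. f x - f (c (near k x)) \<partial>\<mu> n\<bar>"
        using i by simp
      also have "\<dots> \<le> (\<integral>x. L' * (1/2)^k \<partial>\<mu> n)"
      proof (rule order_trans[OF integral_abs_bound integral_mono])
        show "\<bar>f x - f (c (near k x))\<bar> \<le> L' * (1/2)^k" for x
          using L'(2)[of x "c (near k x)"] mult_left_mono[OF less_imp_le[OF dist_near[of x k]] L'(1)]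
          by simp
      qed (use i in auto)
      also have "\<dots> = L' * (1/2)^k" by (simp add: prob_space)
      finally show ?thesis .
    qed
    show ?thesis
    proof (rule tendstoI)
      fix e :: real assume e: "0 < e"
      have "(\<lambda>k. L' * (4 * (1/2::real)^k)) \<longlonglongrightarrow> L' * (4 * 0)"
        by (intro tendsto_mult_left LIMSEQ_realpow_zero) auto
      then have "eventually (\<lambda>k. L' * (4 * (1/2::real)^k) < e/3) sequentially"
        using e by (intro order_tendstoD(2)) auto
      then obtain k where k: "L' * (4 * (1/2::real)^k) < e/3" by (auto dest: eventually_happens)
      have k': "L' * (1/2::real)^k \<le> L' * (4 * (1/2::real)^k)" using L'(1) by (intro mult_left_mono) auto
      have "(\<lambda>n. \<integral>x. f (c (code (Suc k) x ! k)) \<partial>\<mu> (r n)) \<longlonglongrightarrow> (\<integral>s. f (c (s ! k)) \<partial>measure_pmf (p (Suc k)))"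
        by (rule p) (use f_abs in auto)
      then have "(\<lambda>n. \<integral>x. f (c (near k x)) \<partial>\<mu> (r n)) \<longlonglongrightarrow> (\<integral>s. f (c (s ! k)) \<partial>measure_pmf (p (Suc k)))"
        by simp
      then have "eventually (\<lambda>n. dist (\<integral>x. f (c (near k x)) \<partial>\<mu> (r n)) (\<integral>s. f (c (s ! k)) \<partial>measure_pmf (p (Suc k))) < e/3) sequentially"
        using e by (intro tendstoD) auto
      then show "eventually (\<lambda>n. dist (\<integral>x. f x \<partial>\<mu> (r n)) (\<integral>x. f x \<partial>\<pi>) < e) sequentially"
      proof eventually_elim
        case (elim n)
        show ?case using elim \<pi>_near[of k] \<mu>_near[of "r n" k] k k' unfolding dist_real_def by linarith
      qed
    qed
  qed
  with r \<pi> show ?thesis by (rule that)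
qed

section \<open>Ptak's combinatorial lemma\<close>

definition prob_weight :: "(nat \<Rightarrow> real) \<Rightarrow> bool" where
  "prob_weight w \<longleftrightarrow> (\<forall>j. 0 \<le> w j) \<and> finite {j. w j \<noteq> 0} \<and> sum w {j. w j \<noteq> 0} = 1"

text \<open>Convex sets of weights that contain weights supported arbitrarily far out.\<close>

definition cofinal_convex :: "(nat \<Rightarrow> real) set \<Rightarrow> bool" where
  "cofinal_convex C \<longleftrightarrow> (\<forall>w\<in>C. prob_weight w) \<and>
     (\<forall>u\<in>C. \<forall>v\<in>C. \<forall>t\<in>{0..1}. (\<lambda>j. t * u j + (1 - t) * v j) \<in> C) \<and>
     (\<forall>a. \<exists>w\<in>C. \<forall>j\<le>a. w j = 0)"

text \<open>Coordinate indicators \<open>F \<mapsto> (if j \<in> F then 1 else 0)\<close>, as functions on the family \<open>\<F>\<close>, have convex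
combinations that are uniformly small. By Mazur's theorem this is what weak convergence to zero
would give. It is required inside every cofinal convex set, and not only for some weight, to make
it stable under finite unions.\<close>

definition weakly_null :: "nat set set \<Rightarrow> bool" where
  "weakly_null \<F> \<longleftrightarrow>
     (\<forall>C e. cofinal_convex C \<and> 0 < e \<longrightarrow> (\<exists>w\<in>C. \<forall>F\<in>\<F>. sum w F \<le> e))"

definition link :: "nat set set \<Rightarrow> nat \<Rightarrow> nat set set" where
  "link \<F> n = {F. insert n F \<in> \<F> \<and> (\<forall>j\<in>F. n < j)}"

lemma prob_weight_sum_le:
  assumes "prob_weight w" "finite F" shows "sum w F \<le> 1"
proof -
  have "sum w F = sum w (F \<inter> {j. w j \<noteq> 0})"
    using assms by (intro sum.mono_neutral_right) auto
  also have "\<dots> \<le> sum w {j. w j \<noteq> 0}"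
    using assms by (intro sum_mono2) (auto simp: prob_weight_def)
  finally show ?thesis using assms by (simp add: prob_weight_def)
qed

lemma cofinal_convex_tail:
  assumes "cofinal_convex C" shows "cofinal_convex {w\<in>C. \<forall>j\<le>a. w j = 0}"
  unfolding cofinal_convex_def
proof (intro conjI ballI allI)
  fix b
  obtain w where "w \<in> C" "\<forall>j\<le>max a b. w j = 0"
    using assms unfolding cofinal_convex_def by blast
  then show "\<exists>w\<in>{w\<in>C. \<forall>j\<le>a. w j = 0}. \<forall>j\<le>b. w j = 0" by (intro bexI[of _ w]) auto
qed (use assms in \<open>auto simp: cofinal_convex_def\<close>)

lemma weakly_null_tail:
  assumes "weakly_null \<F>" "cofinal_convex C" "0 < e"
  shows "\<exists>w\<in>C. (\<forall>j\<le>a. w j = 0) \<and> (\<forall>F\<in>\<F>. sum w F \<le> e)"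
  using assms(1)[unfolded weakly_null_def, rule_format, of "{w\<in>C. \<forall>j\<le>a. w j = 0}" e]
    cofinal_convex_tail[OF assms(2), of a] assms(3) by blast

lemma weakly_null_empty: "weakly_null {}"
  unfolding weakly_null_def cofinal_convex_def by blast

text \<open>The weights that are small on the first family form again a cofinal convex set, in which one looks
for a weight that is small on the second family.\<close>

lemma weakly_null_Un:
  assumes "weakly_null \<F>" "weakly_null \<F>'" shows "weakly_null (\<F> \<union> \<F>')"
  unfolding weakly_null_def
proof (intro allI impI, elim conjE)
  fix C and e :: real assume C: "cofinal_convex C" and e: "0 < e"
  let ?D = "{w\<in>C. \<forall>F\<in>\<F>. sum w F \<le> e}"
  have "(\<Sum>j\<in>F. t * u j + (1 - t) * v j) \<le> e"
    if "sum u F \<le> e" "sum v F \<le> e" "t \<in> {0..1}" for u v :: "nat \<Rightarrow> real" and F t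
  proof -
    have "(\<Sum>j\<in>F. t * u j + (1 - t) * v j) = t * sum u F + (1 - t) * sum v F"
      by (simp add: sum.distrib sum_distrib_left)
    also have "\<dots> \<le> t * e + (1 - t) * e"
      using that by (intro add_mono mult_left_mono) auto
    finally show ?thesis by (simp add: algebra_simps)
  qed
  moreover have "\<exists>w\<in>?D. \<forall>j\<le>a. w j = 0" for a
    using weakly_null_tail[OF assms(1) C e, of a] by blast
  ultimately have "cofinal_convex ?D"
    using C by (simp add: cofinal_convex_def)
  then obtain w where "w \<in> ?D" "\<forall>F\<in>\<F>'. sum w F \<le> e"
    using assms(2) e unfolding weakly_null_def by blast
  then show "\<exists>w\<in>C. \<forall>F\<in>\<F> \<union> \<F>'. sum w F \<le> e" by auto
qed

lemma weakly_null_UN_lessThan: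
  assumes "\<And>n::nat. weakly_null (\<F> n)" shows "weakly_null (\<Union>n<a. \<F> n)"
  by (induction a) (auto simp: lessThan_Suc intro!: weakly_null_empty weakly_null_Un assms)

text \<open>Average weights with successive supports. Let \<open>w\<close> be the average of the first ones, with support
below \<open>a\<close>, and choose the next weight \<open>u\<close> with support above \<open>a\<close> and small on the links of all
\<open>n < a\<close>. If \<open>F\<close> has an element below \<open>a\<close>, then \<open>u\<close> does not see its minimum \<open>n\<close>, and \<open>F - {n}\<close> is in
the link of \<open>n\<close>, so \<open>u\<close> is small on \<open>F\<close>. Otherwise \<open>w\<close> vanishes on \<open>F\<close>, and only the coefficient
of \<open>u\<close> in the new average counts.\<close>

lemma weakly_null_of_links:
  assumes fin: "\<And>F. F \<in> \<F> \<Longrightarrow> finite F" and links: "\<And>n. weakly_null (link \<F> n)"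
  shows "weakly_null \<F>"
  unfolding weakly_null_def
proof (intro allI impI, elim conjE)
  fix C and e :: real assume C: "cofinal_convex C" and e: "0 < e"
  have step: "\<exists>w\<in>C. \<forall>F\<in>\<F>. sum w F \<le> 1 / real (Suc i) + e / 2" for i
  proof (induction i)
    case 0
    obtain w where w: "w \<in> C" using C unfolding cofinal_convex_def by blast
    have "sum w F \<le> 1 / real (Suc 0) + e / 2" if "F \<in> \<F>" for F
      using prob_weight_sum_le[OF _ fin[OF that], of w] w C e by (auto simp: cofinal_convex_def)
    with w show ?case by blast
  next
    case (Suc i)
    then obtain w where w: "w \<in> C" "\<And>F. F \<in> \<F> \<Longrightarrow> sum w F \<le> 1 / real (Suc i) + e / 2" by blast
    have pw: "prob_weight w" using w C by (auto simp: cofinal_convex_def)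
    obtain a where a: "\<And>j. a \<le> j \<Longrightarrow> w j = 0"
    proof -
      have "finite {j. w j \<noteq> 0}" using pw by (simp add: prob_weight_def)
      then obtain a where "\<forall>j\<in>{j. w j \<noteq> 0}. j < a" using finite_nat_set_iff_bounded by blast
      then show ?thesis by (intro that[of a]) (use leD in blast)
    qed
    obtain u where u: "u \<in> C" "\<And>j. j \<le> a \<Longrightarrow> u j = 0"
        "\<And>F n. n < a \<Longrightarrow> F \<in> link \<F> n \<Longrightarrow> sum u F \<le> e / 2"
      using weakly_null_tail[OF weakly_null_UN_lessThan[of "link \<F>" a, OF links] C half_gt_zero[OF e], of a]
      by blast
    have pu: "prob_weight u" using u C by (auto simp: cofinal_convex_def)
    define t where "t = real (Suc i) / real (Suc (Suc i))"
    have t: "t \<in> {0..1}" "1 - t = 1 / real (Suc (Suc i))" "t * (1 / real (Suc i)) = 1 - t"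
      by (auto simp: t_def field_simps)
    let ?v = "\<lambda>j. t * w j + (1 - t) * u j"
    have "?v \<in> C" using C w(1) u(1) t(1) unfolding cofinal_convex_def by blast
    moreover have "sum ?v F \<le> 1 / real (Suc (Suc i)) + e / 2" if F: "F \<in> \<F>" for F
    proof -
      have sum_v: "sum ?v F = t * sum w F + (1 - t) * sum u F"
        by (simp add: sum.distrib sum_distrib_left)
      show ?thesis
      proof (cases "\<exists>n\<in>F. n < a")
        case False
        then have "sum w F = 0" using a by (intro sum.neutral) (auto simp: not_less)
        moreover have "(1 - t) * sum u F \<le> (1 - t) * 1"
          using prob_weight_sum_le[OF pu fin[OF F]] t(1) by (intro mult_left_mono) auto
        ultimately show ?thesis using sum_v t(2) e by simp
      next
        case True
        define n where "n = Min F"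
        have n: "n \<in> F" "n < a"
          using True Min_in[OF fin[OF F]] Min_le[OF fin[OF F]] unfolding n_def
          by (metis empty_iff, metis le_less_trans)
        have "F - {n} \<in> link \<F> n"
          using n F Min_le[OF fin[OF F]] unfolding link_def n_def[symmetric]
          by (auto simp: insert_absorb le_neq_implies_less)
        then have "sum u (F - {n}) \<le> e / 2" using u(3) n(2) by blast
        moreover have "sum u F = sum u (F - {n})"
          using n u(2)[of n] fin[OF F] by (subst sum.remove[of _ n]) auto
        ultimately have "(1 - t) * sum u F \<le> (1 - t) * (e / 2)"
          using t(1) by (intro mult_left_mono) auto
        moreover have "t * sum w F \<le> t * (1 / real (Suc i) + e / 2)"
          using w(2)[OF F] t(1) by (intro mult_left_mono) auto
        ultimately have "sum ?v F \<le> t * (1 / real (Suc i) + e / 2) + (1 - t) * (e / 2)"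
          unfolding sum_v by (intro add_mono)
        also have "\<dots> = t * (1 / real (Suc i)) + t * (e / 2) + (1 - t) * (e / 2)"
          by (simp only: distrib_left)
        also have "\<dots> = 1 / real (Suc (Suc i)) + e / 2"
          unfolding t(3) t(2)[symmetric] add.assoc distrib_right[symmetric] by simp
        finally show ?thesis .
      qed
    qed
    ultimately show ?case by blast
  qed
  obtain i :: nat where "2 / e < real i" using reals_Archimedean2 by blast
  then have "1 / real (Suc i) \<le> e / 2"
    using e by (simp add: field_simps)
  then have "1 / real (Suc i) + e / 2 \<le> e" by linarith
  moreover obtain w where "w \<in> C" "\<forall>F\<in>\<F>. sum w F \<le> 1 / real (Suc i) + e / 2" using step[of i] by blast
  ultimately show "\<exists>w\<in>C. \<forall>F\<in>\<F>. sum w F \<le> e" by (meson order_trans)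
qed

fun iter_link :: "nat set set \<Rightarrow> (nat \<Rightarrow> nat) \<Rightarrow> nat \<Rightarrow> nat set set" where
  "iter_link \<F> n 0 = \<F>"
| "iter_link \<F> n (Suc k) = link (iter_link \<F> n k) (n k)"

lemma iter_link_mem:
  assumes "F \<in> iter_link \<F> n k"
  shows "F \<union> n ` {..<k} \<in> \<F>"
  using assms
proof (induction k arbitrary: F)
  case (Suc k)
  then have "insert (n k) F \<in> iter_link \<F> n k" by (simp add: link_def)
  from Suc.IH[OF this] show ?case by (simp add: lessThan_Suc)
qed simp

text \<open>A family on which every weight is large somewhere is not weakly null, so some link is not weakly
null either. Iterating gives a sequence all of whose iterated links are not weakly null, in
particular not empty; a member of the \<open>k\<close>-th link extends the first \<open>k\<close> vertices to a set in \<open>\<F>\<close>.\<close>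

theorem ptak_combinatorial:
  assumes fin: "\<And>F. F \<in> \<F> \<Longrightarrow> finite F"
    and hered: "\<And>F G. F \<in> \<F> \<Longrightarrow> G \<subseteq> F \<Longrightarrow> G \<in> \<F>"
    and c: "0 < c" and large: "\<And>w. prob_weight w \<Longrightarrow> \<exists>F\<in>\<F>. c \<le> sum w F"
  shows "\<exists>n :: nat \<Rightarrow> nat. strict_mono n \<and> (\<forall>k. n ` {..<k} \<in> \<F>)"
proof -
  let ?C = "{w. prob_weight w}"
  have conv: "prob_weight (\<lambda>j. t * u j + (1 - t) * v j)"
    if u: "prob_weight u" and v: "prob_weight v" and t: "t \<in> {0..1}" for u v t
  proof -
    let ?w = "\<lambda>j. t * u j + (1 - t) * v j"
    let ?S = "{j. u j \<noteq> 0} \<union> {j. v j \<noteq> 0}"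
    have S: "finite ?S" using u v by (simp add: prob_weight_def)
    have sub: "{j. ?w j \<noteq> 0} \<subseteq> ?S" by auto
    have "sum ?w {j. ?w j \<noteq> 0} = sum ?w ?S"
      by (intro sum.mono_neutral_left S sub) auto
    also have "\<dots> = t * sum u ?S + (1 - t) * sum v ?S"
      by (simp add: sum.distrib sum_distrib_left)
    also have "sum u ?S = sum u {j. u j \<noteq> 0}" by (intro sum.mono_neutral_right S) auto
    also have "sum v ?S = sum v {j. v j \<noteq> 0}" by (intro sum.mono_neutral_right S) auto
    finally show ?thesis
      using u v t finite_subset[OF sub S] by (simp add: prob_weight_def)
  qed
  have "cofinal_convex ?C"
    unfolding cofinal_convex_def
  proof (intro conjI ballI allI)
    fix a
    have "prob_weight (\<lambda>j. if j = Suc a then 1 else 0)" by (simp add: prob_weight_def)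
    then show "\<exists>w\<in>?C. \<forall>j\<le>a. w j = 0" by force
  qed (use conv in auto)
  have not_null: "\<not> weakly_null \<F>"
  proof
    assume "weakly_null \<F>"
    then obtain w where "prob_weight w" "\<forall>F\<in>\<F>. sum w F \<le> c / 2"
      using \<open>cofinal_convex ?C\<close> c unfolding weakly_null_def by (metis half_gt_zero mem_Collect_eq)
    then show False using large[of w] c by force
  qed
  define P where "P \<G> \<longleftrightarrow> (\<forall>F\<in>\<G>. finite F) \<and> \<not> weakly_null \<G>" for \<G> :: "nat set set"
  have P_step: "\<exists>n. P (link \<G> n)" if "P \<G>" for \<G>
    using that weakly_null_of_links[of \<G>] by (force simp: P_def link_def)
  define pick where "pick \<G> = (SOME n. P (link \<G> n))" for \<G>
  define \<G> where "\<G> = rec_nat \<F> (\<lambda>_ \<G>. link \<G> (pick \<G>))"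
  define n where "n k = pick (\<G> k)" for k
  have \<G>_iter: "\<G> k = iter_link \<F> n k" for k
    by (induction k) (auto simp: \<G>_def n_def)
  have P: "P (\<G> k)" for k
  proof (induction k)
    case 0
    show ?case using fin not_null by (simp add: \<G>_def P_def)
  next
    case (Suc k)
    have "\<G> (Suc k) = link (\<G> k) (pick (\<G> k))" by (simp add: \<G>_def)
    then show ?case using someI_ex[OF P_step[OF Suc]] by (simp add: pick_def)
  qed
  have nonempty: "\<G> k \<noteq> {}" for k
    using P[of k] weakly_null_empty by (auto simp: P_def)
  show ?thesis
  proof (intro exI conjI allI)
    show "n ` {..<k} \<in> \<F>" for k
    proof -
      obtain F where "F \<in> iter_link \<F> n k" using nonempty[of k] \<G>_iter by auto
      from iter_link_mem[OF this] show ?thesis by (rule hered) simp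
    qed
    have "n k < n (Suc k)" for k
    proof -
      obtain F where "F \<in> iter_link \<F> n (Suc (Suc k))"
        using nonempty[of "Suc (Suc k)"] \<G>_iter by auto
      then show ?thesis by (auto simp: link_def)
    qed
    then show "strict_mono n" by (simp add: strict_mono_Suc_iff)
  qed
qed

section \<open>Bounded increasing sequences of laws are tight\<close>

text \<open>Intersecting finite covers by balls of radius \<open>2^-k\<close> gives a closed and totally bounded set, hence
a compact one; the errors \<open>e * 2^-(k+1)\<close> add up to \<open>e\<close>.\<close>

lemma tight_lawsI_finite_covers:
  fixes \<mu> :: "nat \<Rightarrow> 'a::polish_space measure"
  assumes mu: "\<And>n. borel_prob (\<mu> n)"
    and cover: "\<And>\<delta> e. 0 < \<delta> \<Longrightarrow> 0 < e \<Longrightarrow>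
      \<exists>A. finite A \<and> (\<forall>n. 1 - e \<le> measure (\<mu> n) (\<Union>c\<in>A. cball c \<delta>))"
  shows "tight_laws \<mu>"
  unfolding tight_laws_def
proof (intro allI impI)
  fix e :: real assume e: "0 < e"
  have "\<exists>A. finite A \<and> (\<forall>n. 1 - e * (1/2)^Suc k \<le> measure (\<mu> n) (\<Union>c\<in>A. cball c ((1/2)^k)))" for k
    using e by (intro cover) auto
  then obtain A where A: "\<And>k. finite (A k)"
    "\<And>k n. 1 - e * (1/2)^Suc k \<le> measure (\<mu> n) (\<Union>c\<in>A k. cball c ((1/2)^k))" by metis
  define U where "U k = (\<Union>c\<in>A k. cball c ((1/2)^k))" for k
  have U: "closed (U k)" for k unfolding U_def using A(1) by (intro closed_UN) auto
  define K where "K = (\<Inter>k. U k)"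
  have closed_K: "closed K" unfolding K_def using U by (intro closed_INT) auto
  have "\<exists>A. finite A \<and> K \<subseteq> (\<Union>c\<in>A. ball c r)" if r: "0 < r" for r
  proof -
    obtain k where k: "(1/2)^k < r" using real_arch_pow_inv[OF r, of "1/2"] by auto
    have "K \<subseteq> U k" unfolding K_def by blast
    also have "\<dots> \<subseteq> (\<Union>c\<in>A k. ball c r)" unfolding U_def using k by fastforce
    finally show ?thesis using A(1) by blast
  qed
  then have "compact K"
    using closed_K by (simp add: compact_eq_totally_bounded complete_eq_closed)
  moreover have "1 - e \<le> measure (\<mu> n) K" for n
  proof -
    interpret prob_space "\<mu> n" using borel_probD[OF mu] by simp
    have sets: "B \<in> sets (\<mu> n) \<longleftrightarrow> B \<in> sets borel" for B using borel_probD[OF mu] by simp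
    have compl: "measure (\<mu> n) (- B) = 1 - measure (\<mu> n) B" if "closed B" for B
      using that by (intro borel_prob_compl[OF mu] borel_closed)
    have bound: "measure (\<mu> n) (- U k) \<le> e * (1/2)^Suc k" for k
      using A(2)[of k n] by (simp add: compl[OF U] U_def[symmetric])
    have sums: "(\<lambda>k. e * (1/2)^Suc k) sums (e * 1)" by (intro sums_mult power_half_series)
    have summable: "summable (\<lambda>k. measure (\<mu> n) (- U k))"
      by (rule summable_comparison_test[OF _ sums_summable[OF sums]]) (use bound in auto)
    have "measure (\<mu> n) (- K) = measure (\<mu> n) (\<Union>k. - U k)" by (simp add: K_def Compl_INT)
    also have "\<dots> \<le> (\<Sum>k. measure (\<mu> n) (- U k))"
      using U sets summable by (intro finite_measure_subadditive_countably) auto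
    also have "\<dots> \<le> (\<Sum>k. e * (1/2)^Suc k)"
      by (intro suminf_le bound summable sums_summable[OF sums])
    also have "\<dots> = e" using sums_unique[OF sums] by simp
    finally show ?thesis by (simp add: compl[OF closed_K])
  qed
  ultimately show "\<exists>K. compact K \<and> (\<forall>n. 1 - e \<le> measure (\<mu> n) K)" by blast
qed

context ordered_space begin

text \<open>The upper bounds of chains that pass through \<open>J j\<close> at the times \<open>j \<in> F\<close>. The set \<open>F\<close> may be
infinite.\<close>

definition above_chain :: "(nat \<Rightarrow> 'a set) \<Rightarrow> nat set \<Rightarrow> 'a set" where
  "above_chain J F = {y. \<exists>x. (\<forall>j\<in>F. x j \<in> J j \<and> x j \<preceq> y) \<and> (\<forall>i\<in>F. \<forall>j\<in>F. i \<le> j \<longrightarrow> x i \<preceq> x j)}"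

lemma above_chain_antimono: "G \<subseteq> F \<Longrightarrow> above_chain J F \<subseteq> above_chain J G"
  unfolding above_chain_def by blast

lemma above_chain_upward: "y \<in> above_chain J F \<Longrightarrow> y \<preceq> z \<Longrightarrow> z \<in> above_chain J F"
  unfolding above_chain_def using le_trans by blast

lemma above_chain_insert:
  assumes y: "y \<in> above_chain J F" "y \<in> J m" and F: "\<And>j. j \<in> F \<Longrightarrow> j < m"
  shows "y \<in> above_chain J (insert m F)"
proof -
  obtain x where x: "\<forall>j\<in>F. x j \<in> J j \<and> x j \<preceq> y" "\<forall>i\<in>F. \<forall>j\<in>F. i \<le> j \<longrightarrow> x i \<preceq> x j"
    using y(1) unfolding above_chain_def by blast
  have m: "m \<notin> F" using F by blast
  have ne: "j \<noteq> m" "\<not> m \<le> j" if "j \<in> F" for j using F[OF that] by auto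
  have "(\<forall>j\<in>insert m F. (x(m := y)) j \<in> J j \<and> (x(m := y)) j \<preceq> y) \<and>
     (\<forall>i\<in>insert m F. \<forall>j\<in>insert m F. i \<le> j \<longrightarrow> (x(m := y)) i \<preceq> (x(m := y)) j)"
    using x y(2) ne by (simp add: m)
  then show ?thesis unfolding above_chain_def by blast
qed

text \<open>Chains live in a product of compact sets, so they have a cluster point. With a constant sequence
\<open>F\<close> this shows that \<open>above_chain J F\<close> is closed; with an increasing one it assembles an infinite
chain from finite ones.\<close>

lemma above_chain_limit:
  assumes J: "\<And>j. compact (J j)" "\<And>j. J j \<noteq> {}" and F: "incseq F"
    and y: "\<And>n. y n \<in> above_chain J (F n)" "y \<longlonglongrightarrow> z"
  shows "z \<in> above_chain J (\<Union>n. F n)"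
proof -
  from y(1) have "\<forall>n. \<exists>x. (\<forall>j\<in>F n. x j \<in> J j \<and> x j \<preceq> y n) \<and> (\<forall>i\<in>F n. \<forall>j\<in>F n. i \<le> j \<longrightarrow> x i \<preceq> x j)"
    unfolding above_chain_def by simp
  then obtain x where x: "\<And>n j. j \<in> F n \<Longrightarrow> x n j \<in> J j" "\<And>n j. j \<in> F n \<Longrightarrow> x n j \<preceq> y n"
    "\<And>n i j. i \<in> F n \<Longrightarrow> j \<in> F n \<Longrightarrow> i \<le> j \<Longrightarrow> x n i \<preceq> x n j" by metis
  define x' where "x' n j = (if j \<in> F n then x n j else SOME z. z \<in> J j)" for n j
  have "x' n j \<in> J j" for n j
    using x(1) J(2)[of j] by (auto simp: x'_def some_in_eq)
  then obtain r u where r: "strict_mono (r :: nat \<Rightarrow> nat)" and u: "\<And>j. u j \<in> J j" "\<And>j. (\<lambda>n. x' (r n) j) \<longlonglongrightarrow> u j"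
    using compact_PiE_seq[where J=J and x=x', OF J(1)] by blast
  have ev: "eventually (\<lambda>n. j \<in> F (r n)) sequentially" if j: "j \<in> (\<Union>n. F n)" for j
  proof -
    obtain k where "j \<in> F k" using j by blast
    then have "j \<in> F (r n)" if "k \<le> n" for n
      using that F seq_suble[OF r, of n] by (meson incseqD le_trans subsetD)
    then show ?thesis unfolding eventually_sequentially by blast
  qed
  have yr: "(\<lambda>n. y (r n)) \<longlonglongrightarrow> z" using LIMSEQ_subseq_LIMSEQ[OF y(2) r] by (simp add: o_def)
  have "u j \<preceq> z" if "j \<in> (\<Union>n. F n)" for j
    by (rule le_limit_eventually[OF u(2) yr], use ev[OF that] in eventually_elim) (simp add: x'_def x)
  moreover have "u i \<preceq> u j" if "i \<in> (\<Union>n. F n)" "j \<in> (\<Union>n. F n)" "i \<le> j" for i j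
    by (rule le_limit_eventually[OF u(2) u(2)], use ev[OF that(1)] ev[OF that(2)] in eventually_elim)
      (simp add: x'_def x that)
  ultimately show ?thesis unfolding above_chain_def using u(1) by blast
qed

lemma closed_above_chain:
  assumes J: "\<And>j. compact (J j)" "\<And>j. J j \<noteq> {}" shows "closed (above_chain J F)"
  unfolding closed_sequential_limits
  using above_chain_limit[where J=J and F="\<lambda>_. F", OF J] by (auto simp: incseq_def)

text \<open>The largest weight of a set of times below \<open>m\<close> at which a chain below \<open>x\<close> can pass through the sets
\<open>J j\<close>.\<close>

definition chain_potential :: "(nat \<Rightarrow> 'a set) \<Rightarrow> (nat \<Rightarrow> real) \<Rightarrow> nat \<Rightarrow> 'a \<Rightarrow> real" where
  "chain_potential J w m x = Max ((\<lambda>F. sum w F * indicator (above_chain J F) x) ` Pow {..<m})"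

lemma chain_potential_attained:
  "\<exists>F\<subseteq>{..<m}. chain_potential J w m x = sum w F * indicator (above_chain J F) x"
proof -
  have "chain_potential J w m x \<in> (\<lambda>F. sum w F * indicator (above_chain J F) x) ` Pow {..<m}"
    unfolding chain_potential_def by (rule Max_in) auto
  then show ?thesis by auto
qed

lemma chain_potential_ge:
  "F \<subseteq> {..<m} \<Longrightarrow> sum w F * indicator (above_chain J F) x \<le> chain_potential J w m x"
  unfolding chain_potential_def by (rule Max_ge) auto

lemma chain_potential_increasing:
  assumes J: "\<And>j. compact (J j)" "\<And>j. J j \<noteq> {}" and w: "prob_weight w"
  shows "chain_potential J w m \<in> increasing_functions le"
proof -
  have w0: "0 \<le> sum w F" for F using w by (intro sum_nonneg) (auto simp: prob_weight_def)
  have [measurable]: "above_chain J F \<in> sets borel" for F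
    using closed_above_chain[where J=J, OF J] by (rule borel_closed)
  have "chain_potential J w m \<in> borel_measurable borel"
    unfolding chain_potential_def by (intro borel_measurable_Max) auto
  moreover have "0 \<le> chain_potential J w m x \<and> chain_potential J w m x \<le> 1" for x
  proof -
    obtain F where F: "F \<subseteq> {..<m}" "chain_potential J w m x = sum w F * indicator (above_chain J F) x"
      using chain_potential_attained by blast
    have "finite F" using F(1) finite_subset by blast
    then show ?thesis
      using F(2) w0[of F] prob_weight_sum_le[OF w] by (auto simp: indicator_def)
  qed
  moreover have "chain_potential J w m x \<le> chain_potential J w m y" if xy: "x \<preceq> y" for x y
  proof -
    obtain F where F: "F \<subseteq> {..<m}" "chain_potential J w m x = sum w F * indicator (above_chain J F) x"
      using chain_potential_attained by blast
    have "sum w F * indicator (above_chain J F) x \<le> sum w F * indicator (above_chain J F) y"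
      using w0[of F] above_chain_upward[OF _ xy] by (intro mult_left_mono) (auto simp: indicator_def)
    also have "\<dots> \<le> chain_potential J w m y" by (rule chain_potential_ge[OF F(1)])
    finally show ?thesis using F(2) by simp
  qed
  ultimately show ?thesis by (simp add: increasing_functions_def monotone_on_def)
qed

lemma chain_potential_Suc:
  assumes w: "prob_weight w"
  shows "chain_potential J w m x + w m * indicator (J m) x \<le> chain_potential J w (Suc m) x"
proof -
  obtain F where F: "F \<subseteq> {..<m}" "chain_potential J w m x = sum w F * indicator (above_chain J F) x"
    using chain_potential_attained by blast
  have finF: "finite F" "m \<notin> F" using F(1) finite_subset by auto
  show ?thesis
  proof (cases "x \<in> J m")
    case False
    have "F \<subseteq> {..<Suc m}" using F(1) by auto
    then show ?thesis using chain_potential_ge[of F "Suc m"] F(2) False by simp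
  next
    case True
    have w0: "0 \<le> w m" using w by (simp add: prob_weight_def)
    have single: "x \<in> above_chain J {}" by (simp add: above_chain_def)
    show ?thesis
    proof (cases "x \<in> above_chain J F")
      case False
      have "x \<in> above_chain J {m}" using above_chain_insert[OF single True] by simp
      then show ?thesis using chain_potential_ge[of "{m}" "Suc m" w J x] F(2) True False by simp
    next
      case True2: True
      have "x \<in> above_chain J (insert m F)" using F(1) by (intro above_chain_insert True True2) auto
      moreover have "insert m F \<subseteq> {..<Suc m}" using F(1) by auto
      ultimately show ?thesis
        using chain_potential_ge[of "insert m F" "Suc m" w J x] F(2) True True2 finF by simp
    qed
  qed
qed

text \<open>If increasing random points with laws \<open>\<mu> j\<close> were given, then the expected weight of the times at
which they are in \<open>J j\<close> would be at least \<open>e\<close> times the total weight. The potential has the same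
lower bound without a coupling: at a point of \<open>J m\<close> the best chain can be prolonged, so the
potential gains \<open>w m\<close> there, and since it is a test function its integral does not drop when \<open>\<mu> m\<close>
is replaced by a larger law.\<close>

lemma chain_potential_integral:
  assumes J: "\<And>j. compact (J j)" "\<And>j. J j \<noteq> {}" and w: "prob_weight w"
    and mu: "\<And>n. borel_prob (\<mu> n)" and mono: "\<And>i j. i \<le> j \<Longrightarrow> stoch_le (\<mu> i) (\<mu> j)"
    and mass: "\<And>j. e \<le> measure (\<mu> j) (J j)"
    and \<rho>: "borel_prob \<rho>" "\<And>j. j < m \<Longrightarrow> stoch_le (\<mu> j) \<rho>"
  shows "e * sum w {..<m} \<le> (\<integral>x. chain_potential J w m x \<partial>\<rho>)"
  using \<rho>
proof (induction m arbitrary: \<rho>)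
  case 0
  show ?case
    using increasing_functionsD(2)[OF chain_potential_increasing[where J=J, OF J w]] by (simp add: integral_nonneg)
next
  case (Suc m)
  interpret prob_space "\<mu> m" using borel_probD[OF mu] by simp
  have inc: "chain_potential J w k \<in> increasing_functions le" for k
    by (rule chain_potential_increasing[where J=J, OF J w])
  have closed_J: "closed (J m)" by (rule compact_imp_closed[OF J(1)])
  have int: "integrable (\<mu> m) (chain_potential J w k)" for k
    using increasing_functionsD[OF inc] by (intro borel_prob_integrable[OF mu, where B=1]) auto
  have intJ: "integrable (\<mu> m) (\<lambda>x. w m * indicator (J m) x)"
    using closed_J by (intro integrable_mult_right borel_prob_integrable[OF mu, where B=1]) auto
  have "w m * e \<le> w m * measure (\<mu> m) (J m)"
    using w mass by (intro mult_left_mono) (auto simp: prob_weight_def)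
  moreover have "e * sum w {..<m} \<le> (\<integral>x. chain_potential J w m x \<partial>\<mu> m)"
    using mono by (intro Suc.IH mu) auto
  moreover have "(\<integral>x. chain_potential J w m x + w m * indicator (J m) x \<partial>\<mu> m)
      = (\<integral>x. chain_potential J w m x \<partial>\<mu> m) + w m * measure (\<mu> m) (J m)"
    using int intJ closed_J borel_probD[OF mu] by simp
  moreover have "(\<integral>x. chain_potential J w m x + w m * indicator (J m) x \<partial>\<mu> m)
      \<le> (\<integral>x. chain_potential J w (Suc m) x \<partial>\<mu> m)"
    by (intro integral_mono int intJ Bochner_Integration.integrable_add chain_potential_Suc w)
  moreover have "(\<integral>x. chain_potential J w (Suc m) x \<partial>\<mu> m) \<le> (\<integral>x. chain_potential J w (Suc m) x \<partial>\<rho>)"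
    using Suc.prems(2)[of m] inc unfolding stoch_le_def by blast
  ultimately show ?case by (simp add: algebra_simps)
qed

text \<open>A compact set \<open>K\<close> of large \<open>\<nu>\<close>-measure contains, for every weight, a point above a chain of weight
at least \<open>e / 2\<close>. Ptak's lemma turns this into arbitrarily long finite chains along one sequence of
times, with upper bounds in \<open>K\<close>; cluster points give an infinite chain and its upper bound.\<close>

lemma increasing_chain_through:
  assumes J: "\<And>j. compact (J j)" "\<And>j. J j \<noteq> {}"
    and mu: "\<And>n. borel_prob (\<mu> n)" and mono: "\<And>i j. i \<le> j \<Longrightarrow> stoch_le (\<mu> i) (\<mu> j)"
    and mass: "\<And>j. e \<le> measure (\<mu> j) (J j)" and e: "0 < e"
    and \<nu>: "borel_prob \<nu>" "\<And>j. stoch_le (\<mu> j) \<nu>"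
  shows "\<exists>n s y. strict_mono (n :: nat \<Rightarrow> nat) \<and> (\<forall>k. s k \<in> J (n k) \<and> s k \<preceq> s (Suc k) \<and> s k \<preceq> y)"
proof -
  interpret nu: prob_space \<nu> using borel_probD[OF \<nu>(1)] by simp
  obtain K where K: "compact K" "1 - e/2 < measure \<nu> K"
    using borel_prob_compact_exhaust[OF \<nu>(1), of "e/2"] e by auto
  have closed_K: "closed K" using K(1) by (rule compact_imp_closed)
  define \<F> where "\<F> = {F. finite F \<and> above_chain J F \<inter> K \<noteq> {}}"
  have "\<exists>F\<in>\<F>. e/2 \<le> sum w F" if w: "prob_weight w" for w
  proof -
    have "finite {j. w j \<noteq> 0}" using w by (simp add: prob_weight_def)
    then obtain m where m: "{j. w j \<noteq> 0} \<subseteq> {..<m}"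
      using finite_nat_set_iff_bounded by auto
    have "sum w {..<m} = sum w {j. w j \<noteq> 0}"
      using m by (intro sum.mono_neutral_right) auto
    then have "sum w {..<m} = 1" using w by (simp add: prob_weight_def)
    then have large: "e \<le> (\<integral>x. chain_potential J w m x \<partial>\<nu>)"
      using chain_potential_integral[where J=J and \<mu>=\<mu> and m=m, OF J w mu mono mass \<nu>(1)] \<nu>(2) by simp
    have inc: "chain_potential J w m \<in> increasing_functions le"
      by (rule chain_potential_increasing[where J=J, OF J w])
    have "\<exists>y\<in>K. e/2 \<le> chain_potential J w m y"
    proof (rule ccontr)
      assume "\<not> ?thesis"
      then have small: "chain_potential J w m y \<le> e/2 + indicator (- K) y" for y
        using increasing_functionsD(3)[OF inc, of y] e by (cases "y \<in> K") force+
      have iK: "integrable \<nu> (indicator (- K) :: 'a \<Rightarrow> real)"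
        using closed_K by (intro borel_prob_integrable[OF \<nu>(1), where B=1]) auto
      have "(\<integral>x. chain_potential J w m x \<partial>\<nu>) \<le> (\<integral>x. e/2 + indicator (- K) x \<partial>\<nu>)"
        using increasing_functionsD[OF inc]
        by (intro integral_mono small Bochner_Integration.integrable_add iK nu.integrable_const
            borel_prob_integrable[OF \<nu>(1), of "chain_potential J w m" 1])
      also have "\<dots> = e/2 + measure \<nu> (- K)"
        using iK borel_probD[OF \<nu>(1)] closed_K by (simp add: nu.prob_space[simplified borel_probD[OF \<nu>(1)]])
      also have "measure \<nu> (- K) = 1 - measure \<nu> K"
        using closed_K by (intro borel_prob_compl[OF \<nu>(1)]) auto
      finally show False using large K(2) by linarith
    qed
    then obtain y where y: "y \<in> K" "e/2 \<le> chain_potential J w m y" by blast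
    obtain F where F: "F \<subseteq> {..<m}" "chain_potential J w m y = sum w F * indicator (above_chain J F) y"
      using chain_potential_attained by blast
    have "finite F" using F(1) finite_subset by blast
    with F(2) y e show ?thesis
      by (intro bexI[of _ F]) (cases "y \<in> above_chain J F"; auto simp: \<F>_def)+
  qed
  note large = this
  have hered: "G \<in> \<F>" if "F \<in> \<F>" "G \<subseteq> F" for F G
    using that above_chain_antimono[OF that(2), of J] finite_subset[OF that(2)] unfolding \<F>_def by blast
  have "\<exists>n :: nat \<Rightarrow> nat. strict_mono n \<and> (\<forall>k. n ` {..<k} \<in> \<F>)"
    by (rule ptak_combinatorial[OF _ hered half_gt_zero[OF e] large]) (simp_all add: \<F>_def)
  then obtain n where n: "strict_mono (n :: nat \<Rightarrow> nat)" "\<And>k. n ` {..<k} \<in> \<F>" by blast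
  then obtain y where y: "\<And>k. y k \<in> above_chain J (n ` {..<k})" "\<And>k. y k \<in> K"
    by (simp add: \<F>_def ex_in_conv[symmetric]) metis
  obtain z r where r: "strict_mono (r :: nat \<Rightarrow> nat)" "(y \<circ> r) \<longlonglongrightarrow> z"
    using K(1) y(2) unfolding compact_def by blast
  have "incseq (\<lambda>k. n ` {..<r k})"
    using strict_mono_mono[OF r(1)] by (intro monoI image_mono) (auto dest: monoD)
  from above_chain_limit[where J=J and y="y \<circ> r" and z=z, OF J this] y(1) r(2)
  have "z \<in> above_chain J (\<Union>k. n ` {..<r k})" by simp
  moreover have "n k \<in> (\<Union>k. n ` {..<r k})" for k
    using seq_suble[OF r(1), of "Suc k"] by (intro UN_I[of "Suc k"]) (auto simp: Suc_le_eq)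
  moreover define R where "R = (\<Union>k. n ` {..<r k})"
  ultimately have R: "\<And>k. n k \<in> R" and "z \<in> above_chain J R" by simp_all
  then obtain x where x: "\<forall>j\<in>R. x j \<in> J j \<and> x j \<preceq> z" "\<forall>i\<in>R. \<forall>j\<in>R. i \<le> j \<longrightarrow> x i \<preceq> x j"
    by (simp add: above_chain_def) blast
  have "\<And>k. x (n k) \<in> J (n k) \<and> x (n k) \<preceq> z" "\<And>i j. n i \<le> n j \<Longrightarrow> x (n i) \<preceq> x (n j)"
    using x R by simp_all
  then have "\<forall>k. (x \<circ> n) k \<in> J (n k) \<and> (x \<circ> n) k \<preceq> (x \<circ> n) (Suc k) \<and> (x \<circ> n) k \<preceq> z"
    using strict_mono_mono[OF n(1)] by (simp add: mono_iff_le_Suc)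
  with n(1) show ?thesis by blast
qed

text \<open>If no finite union of balls works for all laws, then mass more than \<open>e\<close> repeatedly escapes from the
\<open>\<delta>\<close>-balls that contain the compact sets chosen before. The sets are built by dependent choice,
together with the centres of the balls avoided so far.\<close>

lemma escaping_compacts:
  fixes \<mu> :: "nat \<Rightarrow> 'a measure"
  assumes mu: "\<And>n. borel_prob (\<mu> n)" and nt: "\<not> tight_laws \<mu>"
  shows "\<exists>e \<delta> (n :: nat \<Rightarrow> nat) J. 0 < e \<and> 0 < \<delta> \<and> strict_mono n \<and> (\<forall>j. compact (J j)) \<and>
    (\<forall>j. e < measure (\<mu> (n j)) (J j)) \<and> (\<forall>i j x y. i < j \<longrightarrow> x \<in> J i \<longrightarrow> y \<in> J j \<longrightarrow> \<delta> < dist x y)"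
proof -
  obtain \<delta> e where de: "0 < \<delta>" "0 < e"
    and bad: "\<And>A. finite A \<Longrightarrow> \<exists>n. measure (\<mu> n) (\<Union>c\<in>A. cball c \<delta>) < 1 - e"
    using tight_lawsI_finite_covers[of \<mu>] mu nt by (meson not_le)
  have cl: "closed (\<Union>c\<in>A. cball c \<delta>)" if "finite A" for A :: "'a set"
    using that by (intro closed_UN) auto
  have fin_cover: "\<exists>A. finite A \<and> K \<subseteq> (\<Union>c\<in>A. ball c (\<delta>/2))" if "compact K" for K :: "'a set"
    using that de unfolding compact_eq_totally_bounded by (metis half_gt_zero)
  have "\<exists>A. finite A \<and> 1 - e \<le> measure (\<mu> n) (\<Union>c\<in>A. cball c \<delta>)" for n
  proof -
    interpret prob_space "\<mu> n" using borel_probD[OF mu] by simp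
    obtain K where K: "compact K" "1 - e < measure (\<mu> n) K"
      using borel_prob_compact_exhaust[OF mu de(2)] by blast
    obtain A where A: "finite A" "K \<subseteq> (\<Union>c\<in>A. ball c (\<delta>/2))" using fin_cover[OF K(1)] by blast
    have "K \<subseteq> (\<Union>c\<in>A. cball c \<delta>)" using A(2) de by force
    then have "measure (\<mu> n) K \<le> measure (\<mu> n) (\<Union>c\<in>A. cball c \<delta>)"
      using cl[OF A(1)] mu by (intro finite_measure_mono) auto
    then show ?thesis using A K by (intro exI[of _ A]) auto
  qed
  then obtain B where B: "\<And>n. finite (B n)" "\<And>n. 1 - e \<le> measure (\<mu> n) (\<Union>c\<in>B n. cball c \<delta>)" by metis
  have late: "\<exists>n>m. measure (\<mu> n) (\<Union>c\<in>A. cball c \<delta>) < 1 - e" if A: "finite A" for A m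
  proof -
    let ?A = "A \<union> (\<Union>i\<le>m. B i)"
    have finA: "finite ?A" using A B by auto
    obtain n where n: "measure (\<mu> n) (\<Union>c\<in>?A. cball c \<delta>) < 1 - e" using bad[OF finA] by blast
    interpret prob_space "\<mu> n" using borel_probD[OF mu] by simp
    have sub: "measure (\<mu> n) (\<Union>c\<in>C. cball c \<delta>) \<le> measure (\<mu> n) (\<Union>c\<in>?A. cball c \<delta>)" if "C \<subseteq> ?A" for C
      using that cl[OF finA] mu by (intro finite_measure_mono) auto
    have "m < n"
    proof (rule ccontr)
      assume "\<not> m < n"
      then have "B n \<subseteq> ?A" by auto
      from sub[OF this] B(2)[of n] n show False by linarith
    qed
    moreover have "measure (\<mu> n) (\<Union>c\<in>A. cball c \<delta>) < 1 - e" using sub[of A] n by auto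
    ultimately show ?thesis by blast
  qed
  have step: "\<exists>n>m. \<exists>J. compact J \<and> e < measure (\<mu> n) J \<and> J \<inter> (\<Union>c\<in>A. cball c \<delta>) = {}"
    if A: "finite A" for A m
  proof -
    obtain n where n: "m < n" "measure (\<mu> n) (\<Union>c\<in>A. cball c \<delta>) < 1 - e" using late[OF A] by blast
    interpret prob_space "\<mu> n" using borel_probD[OF mu] by simp
    have "measure (\<mu> n) (- (\<Union>c\<in>A. cball c \<delta>)) = 1 - measure (\<mu> n) (\<Union>c\<in>A. cball c \<delta>)"
      using cl[OF A] by (intro borel_prob_compl[OF mu] borel_closed)
    then have "e < measure (\<mu> n) (- (\<Union>c\<in>A. cball c \<delta>))" using n by simp
    moreover have "- (\<Union>c\<in>A. cball c \<delta>) \<in> sets borel"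
      using cl[OF A] by (intro borel_open open_Compl)
    ultimately obtain J where J: "J \<subseteq> - (\<Union>c\<in>A. cball c \<delta>)" "compact J" "e < measure (\<mu> n) J"
      using borel_prob_inner_compact[OF mu] by meson
    have "J \<inter> (\<Union>c\<in>A. cball c \<delta>) = {}" using J(1) by (simp only: disjoint_eq_subset_Compl)
    with n(1) J show ?thesis by (intro exI[of _ n] exI[of _ J] conjI)
  qed
  \<comment> \<open>A state consists of an index, a compact set, and the centres of the balls it avoids.\<close>
  define good where "good s \<longleftrightarrow> (case s of (n, J, A) \<Rightarrow> finite A \<and> compact J \<and> e < measure (\<mu> n) J \<and>
     J \<inter> (\<Union>c\<in>A. cball c \<delta>) = {})" for s
  define follows where "follows s s' \<longleftrightarrow> (case s of (n, J, A) \<Rightarrow> case s' of (n', J', A') \<Rightarrow>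
     n < n' \<and> A \<subseteq> A' \<and> J \<subseteq> (\<Union>c\<in>A'. ball c (\<delta>/2)))" for s s' :: "nat \<times> 'a set \<times> 'a set"
  obtain s where s: "\<And>k. good (s k)" "\<And>k. follows (s k) (s (Suc k))"
  proof (rule dependent_nat_choice[of "\<lambda>_. good" "\<lambda>_. follows", THEN exE])
    show "\<exists>x. good x" using step[of "{}" 0] by (auto simp: good_def)
    show "\<exists>y. good y \<and> follows x y" if x: "good x" for x
    proof -
      obtain n J A where [simp]: "x = (n, J, A)" by (cases x) auto
      have A: "finite A" "compact J" using x by (auto simp: good_def)
      obtain A' where A': "finite A'" "J \<subseteq> (\<Union>c\<in>A'. ball c (\<delta>/2))" using fin_cover[OF A(2)] by blast
      have "finite (A \<union> A')" using A(1) A'(1) by simp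
      from step[OF this, of n] obtain n' J' where "n < n'" "compact J'" "e < measure (\<mu> n') J'"
        "J' \<inter> (\<Union>c\<in>A \<union> A'. cball c \<delta>) = {}" by blast
      then have "good (n', J', A \<union> A') \<and> follows x (n', J', A \<union> A')"
        using A A' unfolding good_def follows_def by auto
      then show ?thesis by blast
    qed
  qed blast
  define n where "n k = fst (s k)" for k
  define J where "J k = fst (snd (s k))" for k
  define A where "A k = snd (snd (s k))" for k
  have good: "finite (A k)" "compact (J k)" "e < measure (\<mu> (n k)) (J k)" "J k \<inter> (\<Union>c\<in>A k. cball c \<delta>) = {}" for k
    using s(1)[of k] by (auto simp: good_def n_def J_def A_def split: prod.splits)
  have nxt: "n k < n (Suc k)" "A k \<subseteq> A (Suc k)" "J k \<subseteq> (\<Union>c\<in>A (Suc k). ball c (\<delta>/2))" for k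
    using s(2)[of k] by (auto simp: follows_def n_def J_def A_def split: prod.splits)
  have "\<delta>/2 < dist x y" if ij: "i < j" and x: "x \<in> J i" and y: "y \<in> J j" for i j x y
  proof -
    obtain c where c: "c \<in> A (Suc i)" "dist c x < \<delta>/2" using nxt(3)[of i] x by auto
    have "A (Suc i) \<subseteq> A j" by (rule lift_Suc_mono_le[of A, OF nxt(2) Suc_leI[OF ij]])
    then have "y \<notin> cball c \<delta>" using c(1) y good(4)[of j] by blast
    then have "\<delta> < dist c y" by simp
    then show ?thesis using c(2) dist_triangle[of c y x] by linarith
  qed
  then show ?thesis
    using de good(2,3) nxt(1)
    by (intro exI[of _ e] exI[of _ "\<delta>/2"] exI[of _ n] exI[of _ J]) (auto simp: strict_mono_Suc_iff)
qed

text \<open>Otherwise there are compact sets with positive mutual distances, and an increasing bounded sequence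
of points passing through infinitely many of them. Such a sequence does not converge.\<close>

theorem bounded_increasing_tight:
  assumes bmc: "bmc le" and mu: "\<And>n. borel_prob (\<mu> n)"
    and \<nu>: "borel_prob \<nu>"
    and inc: "\<And>n. stoch_le (\<mu> n) (\<mu> (Suc n))" and bdd: "\<And>n. stoch_le (\<mu> n) \<nu>"
  shows "tight_laws \<mu>"
proof (rule ccontr)
  assume "\<not> tight_laws \<mu>"
  from escaping_compacts[OF mu this] obtain e \<delta> n J where J: "0 < e" "0 < \<delta>" "strict_mono (n :: nat \<Rightarrow> nat)"
    "\<And>j. compact (J j)" "\<And>j. e < measure (\<mu> (n j)) (J j)"
    "\<And>i j x y. i < j \<Longrightarrow> x \<in> J i \<Longrightarrow> y \<in> J j \<Longrightarrow> \<delta> < dist x y" by blast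
  have mono: "stoch_le (\<mu> i) (\<mu> j)" if "i \<le> j" for i j
    using that by (induction j rule: dec_induct) (auto intro: stoch_le_refl stoch_le_trans inc)
  have ne: "J j \<noteq> {}" for j using J(1) J(5)[of j] by auto
  have "\<exists>m s y. strict_mono (m :: nat \<Rightarrow> nat) \<and> (\<forall>k. s k \<in> J (m k) \<and> s k \<preceq> s (Suc k) \<and> s k \<preceq> y)"
    using strict_mono_mono[OF J(3)] less_imp_le[OF J(5)]
    by (intro increasing_chain_through[where \<mu>="\<lambda>j. \<mu> (n j)" and \<nu>=\<nu>, OF J(4) ne mu mono _ J(1) \<nu> bdd])
      (auto dest: monoD)
  then obtain m s y where s: "strict_mono (m :: nat \<Rightarrow> nat)" "\<And>k. s k \<in> J (m k)" "\<And>k. s k \<preceq> s (Suc k)" "\<And>k. s k \<preceq> y"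
    by blast
  have "convergent s" using bmc s(3,4) unfolding bmc_def by blast
  then have "Cauchy s" by (rule convergent_Cauchy)
  then obtain k where "\<forall>i\<ge>k. \<forall>j\<ge>k. dist (s i) (s j) < \<delta>" using J(2) unfolding Cauchy_def by blast
  then have "dist (s k) (s (Suc k)) < \<delta>" by simp
  moreover have "\<delta> < dist (s k) (s (Suc k))"
    using s(1) by (intro J(6)[of "m k" "m (Suc k)"] s(2)) (simp add: strict_mono_Suc_iff)
  ultimately show False by simp
qed

end

section \<open>Kernels and processes\<close>

definition unit_functions :: "('a::topological_space \<Rightarrow> real) set" where
  "unit_functions = {g \<in> borel_measurable borel. \<forall>x. 0 \<le> g x \<and> g x \<le> 1}"

lemma unit_functionsD:
  assumes "g \<in> unit_functions"
  shows "g \<in> borel_measurable borel" "0 \<le> g x" "g x \<le> 1" "\<bar>g x\<bar> \<le> 1"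
  using assms by (auto simp: unit_functions_def)

lemma increasing_unit: "g \<in> increasing_functions le \<Longrightarrow> g \<in> unit_functions"
  by (simp add: increasing_functions_def unit_functions_def)

lemma indicator_unit: "A \<in> sets borel \<Longrightarrow> indicator A \<in> unit_functions"
  by (auto simp: unit_functions_def indicator_def)

lemma unit_integrable:
  assumes "borel_prob \<mu>" "g \<in> unit_functions"
  shows "integrable \<mu> g"
  using unit_functionsD[OF assms(2)] by (intro borel_prob_integrable[OF assms(1), of g 1])

lemma unit_integral_bounds:
  assumes mu: "borel_prob \<mu>" and g: "g \<in> unit_functions"
  shows "0 \<le> (\<integral>x. g x \<partial>\<mu>)" "(\<integral>x. g x \<partial>\<mu>) \<le> 1"
proof -
  interpret prob_space \<mu> using borel_probD[OF mu] by simp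
  show "0 \<le> (\<integral>x. g x \<partial>\<mu>)" using unit_functionsD(2)[OF g] by (intro Bochner_Integration.integral_nonneg)
  show "(\<integral>x. g x \<partial>\<mu>) \<le> 1"
    using unit_functionsD[OF g] unit_integrable[OF mu g] by (intro integral_le_const) auto
qed

lemma unit_nn_integral:
  assumes "borel_prob \<mu>" "g \<in> unit_functions"
  shows "(\<integral>\<^sup>+x. ennreal (g x) \<partial>\<mu>) = ennreal (\<integral>x. g x \<partial>\<mu>)"
  using unit_functionsD[OF assms(2)] by (intro nn_integral_eq_integral unit_integrable assms) auto

locale borel_kernel =
  fixes P :: "'a::polish_space \<Rightarrow> 'a measure"
  assumes kernel: "markov_kernel P"
begin

lemma kernel_prob: "borel_prob (P x)"
  using kernel by (auto simp: markov_kernel_def intro: borel_probI)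

lemma kernel_measurable: "P \<in> borel \<rightarrow>\<^sub>M subprob_algebra borel"
proof (rule measurable_subprob_algebra)
  fix x
  interpret prob_space "P x" using borel_probD[OF kernel_prob] by simp
  show "subprob_space (P x)" by unfold_locales
next
  fix A :: "'a set" assume A: "A \<in> sets borel"
  have "emeasure (P x) A = ennreal (measure (P x) A)" for x
    using borel_probD[OF kernel_prob] by (intro finite_measure.emeasure_eq_measure prob_space.axioms)
  then show "(\<lambda>x. emeasure (P x) A) \<in> borel_measurable borel"
    using kernel A by (simp add: markov_kernel_def)
qed (use borel_probD[OF kernel_prob] in auto)

definition transition :: "('a \<Rightarrow> real) \<Rightarrow> 'a \<Rightarrow> real" where
  "transition g x = (\<integral>y. g y \<partial>P x)"

lemma transition_unit: assumes g: "g \<in> unit_functions" shows "transition g \<in> unit_functions"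
proof -
  have "transition g \<in> borel_measurable borel"
    unfolding transition_def
    by (rule measurable_compose[OF kernel_measurable integral_measurable_subprob_algebra])
      (rule unit_functionsD(1)[OF g])
  then show ?thesis
    using unit_integral_bounds[OF kernel_prob g] by (auto simp: unit_functions_def transition_def)
qed

lemma transition_complement:
  assumes g: "g \<in> unit_functions"
  shows "transition (\<lambda>x. 1 - g x) = (\<lambda>x. 1 - transition g x)"
proof
  fix x
  interpret prob_space "P x" using borel_probD[OF kernel_prob] by simp
  show "transition (\<lambda>x. 1 - g x) x = 1 - transition g x"
    using unit_integrable[OF kernel_prob g] prob_space by (simp add: transition_def)
qed

lemma iterate_unit: "g \<in> unit_functions \<Longrightarrow> (transition ^^ n) g \<in> unit_functions"
  by (induction n) (auto intro: transition_unit)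

lemma bind_kernel:
  assumes mu: "borel_prob \<mu>"
  shows "borel_prob (\<mu> \<bind> P)"
    and "g \<in> unit_functions \<Longrightarrow> (\<integral>x. g x \<partial>(\<mu> \<bind> P)) = (\<integral>x. transition g x \<partial>\<mu>)"
proof -
  interpret prob_space \<mu> using borel_probD[OF mu] by simp
  have P: "P \<in> measurable \<mu> (subprob_algebra borel)"
    using kernel_measurable by (simp add: borel_prob_measurable[OF mu])
  have "AE x in \<mu>. prob_space (P x)" using borel_probD[OF kernel_prob] by simp
  then show "borel_prob (\<mu> \<bind> P)"
    using prob_space_bind[OF _ P] sets_bind[of \<mu> P borel] borel_probD[OF kernel_prob] borel_probD[OF mu]
    by (intro borel_probI) auto
  assume g: "g \<in> unit_functions"
  show "(\<integral>x. g x \<partial>(\<mu> \<bind> P)) = (\<integral>x. transition g x \<partial>\<mu>)"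
    unfolding transition_def
  proof (rule integral_bind[where K=borel and B=1 and B'=1])
    show "finite_measure \<mu>" by unfold_locales
    show "AE x in \<mu>. emeasure (P x) (space (P x)) \<le> ennreal 1"
      using prob_space.emeasure_space_1[OF borel_probD(1)[OF kernel_prob]] by simp
  qed (use P unit_functionsD[OF g] borel_probD[OF mu] in auto)
qed

lemma stationary_dist_iff:
  "stationary_dist P \<pi> \<longleftrightarrow> borel_prob \<pi> \<and> \<pi> \<bind> P = \<pi>"
proof -
  have eq: "(\<integral>x. measure (P x) A \<partial>\<pi>) = measure (\<pi> \<bind> P) A"
    if pi: "borel_prob \<pi>" and A: "A \<in> sets borel" for A
  proof -
    have "measure (\<pi> \<bind> P) A = (\<integral>x. indicator A x \<partial>(\<pi> \<bind> P))"
      using A borel_probD[OF bind_kernel(1)[OF pi]] by simp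
    also have "\<dots> = (\<integral>x. transition (indicator A) x \<partial>\<pi>)"
      by (rule bind_kernel(2)[OF pi indicator_unit[OF A]])
    also have "transition (indicator A) = (\<lambda>x. measure (P x) A)"
      using A borel_probD[OF kernel_prob] by (auto simp: transition_def)
    finally show ?thesis by simp
  qed
  show ?thesis
  proof
    assume s: "stationary_dist P \<pi>"
    then have pi: "borel_prob \<pi>"
      by (auto simp: stationary_dist_def intro: borel_probI)
    interpret \<pi>: prob_space \<pi> using borel_probD[OF pi] by simp
    interpret b: prob_space "\<pi> \<bind> P" using borel_probD[OF bind_kernel(1)[OF pi]] by simp
    have "\<pi> \<bind> P = \<pi>"
    proof (rule measure_eqI)
      fix A assume "A \<in> sets (\<pi> \<bind> P)"
      then have "A \<in> sets borel" using borel_probD[OF bind_kernel(1)[OF pi]] by simp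
      then show "emeasure (\<pi> \<bind> P) A = emeasure \<pi> A"
        using s eq[OF pi] by (simp add: stationary_dist_def b.emeasure_eq_measure \<pi>.emeasure_eq_measure)
    qed (use borel_probD[OF pi] borel_probD[OF bind_kernel(1)[OF pi]] in simp)
    with pi show "borel_prob \<pi> \<and> \<pi> \<bind> P = \<pi>" ..
  next
    assume "borel_prob \<pi> \<and> \<pi> \<bind> P = \<pi>"
    then show "stationary_dist P \<pi>"
      using eq borel_probD[of \<pi>] by (auto simp: stationary_dist_def)
  qed
qed

lemma stationary_iterate:
  assumes "stationary_dist P \<pi>" "g \<in> unit_functions"
  shows "(\<integral>x. (transition ^^ n) g x \<partial>\<pi>) = (\<integral>x. g x \<partial>\<pi>)"
proof -
  have pi: "borel_prob \<pi>" "\<pi> \<bind> P = \<pi>"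
    using assms(1) by (simp_all add: stationary_dist_iff)
  show ?thesis
  proof (induction n)
    case (Suc n)
    have "(\<integral>x. (transition ^^ Suc n) g x \<partial>\<pi>) = (\<integral>x. (transition ^^ n) g x \<partial>(\<pi> \<bind> P))"
      using bind_kernel(2)[OF pi(1) iterate_unit[OF assms(2)]] by simp
    with Suc pi(2) show ?case by simp
  qed simp
qed

end

lemma first_hit_gt_iff:
  "enat n < first_hit m Z H \<omega> \<longleftrightarrow> (\<forall>i. m \<le> i \<and> i \<le> n \<longrightarrow> Z i \<omega> \<notin> H)"
proof -
  have "enat n < first_hit m Z H \<omega> \<longleftrightarrow> enat (Suc n) \<le> first_hit m Z H \<omega>"
    by (simp add: Suc_ile_eq)
  also have "\<dots> \<longleftrightarrow> (\<forall>i. m \<le> i \<and> Z i \<omega> \<in> H \<longrightarrow> Suc n \<le> i)"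
    unfolding first_hit_def by (auto simp: le_Inf_iff)
  also have "\<dots> \<longleftrightarrow> (\<forall>i. m \<le> i \<and> i \<le> n \<longrightarrow> Z i \<omega> \<notin> H)"
    by (auto simp: not_less_eq_eq)
  finally show ?thesis .
qed

lemma first_hit_measurable:
  assumes X: "\<And>k. X k \<in> borel_measurable \<Omega>" and H: "H \<in> sets borel"
  shows "first_hit m X H \<in> measurable \<Omega> (count_space UNIV)"
proof (subst measurable_count_space_eq2_countable, intro conjI ballI)
  have gt: "{\<omega> \<in> space \<Omega>. enat n < first_hit m X H \<omega>} \<in> sets \<Omega>" for n
  proof -
    note X[measurable] H[measurable]
    have "{\<omega> \<in> space \<Omega>. \<forall>i. m \<le> i \<and> i \<le> n \<longrightarrow> X i \<omega> \<notin> H} \<in> sets \<Omega>" by measurable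
    then show ?thesis by (simp add: first_hit_gt_iff)
  qed
  fix a :: enat
  show "first_hit m X H -` {a} \<inter> space \<Omega> \<in> sets \<Omega>"
  proof (cases a)
    case (enat n)
    have eq: "f = enat n \<longleftrightarrow> \<not> enat n < f \<and> (\<forall>k\<in>{..<n}. enat k < f)" for f
    proof
      assume *: "\<not> enat n < f \<and> (\<forall>k\<in>{..<n}. enat k < f)"
      then obtain j where "f = enat j" "j \<le> n" by (cases f) auto
      with * show "f = enat n" by (cases "j < n") auto
    qed auto
    then have "first_hit m X H -` {a} \<inter> space \<Omega> = {\<omega> \<in> space \<Omega>. \<not> enat n < first_hit m X H \<omega> \<and>
        (\<forall>k\<in>{..<n}. enat k < first_hit m X H \<omega>)}"
      unfolding enat vimage_def singleton_iff eq[of "first_hit m X H _"] by blast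
    also have "\<dots> \<in> sets \<Omega>"
      by (intro sets.sets_Collect_conj sets.sets_Collect_neg sets.sets_Collect_finite_All gt) auto
    finally show ?thesis .
  next
    case infinity
    have eq: "f = \<infinity> \<longleftrightarrow> (\<forall>k. enat k < f)" for f by (cases f) auto
    then have "first_hit m X H -` {a} \<inter> space \<Omega> = {\<omega> \<in> space \<Omega>. \<forall>k. enat k < first_hit m X H \<omega>}"
      unfolding infinity vimage_def singleton_iff eq[of "first_hit m X H _"] by blast
    also have "\<dots> \<in> sets \<Omega>" by (intro sets.sets_Collect_countable_All gt)
    finally show ?thesis .
  qed
qed auto

lemma space_history [simp]: "space (history \<Omega> Z n) = space \<Omega>"
  unfolding history_def by (rule space_measure_of) auto

lemma sets_history:
  "sets (history \<Omega> Z n) = sigma_sets (space \<Omega>) {Z k -` A \<inter> space \<Omega> | k A. k \<le> n \<and> A \<in> sets borel}"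
  unfolding history_def by (rule sets_measure_of) auto

lemma history_subalgebra:
  assumes "\<And>k. Z k \<in> borel_measurable \<Omega>" shows "subalgebra \<Omega> (history \<Omega> Z n)"
  unfolding subalgebra_def
proof
  show "sets (history \<Omega> Z n) \<subseteq> sets \<Omega>"
    unfolding sets_history by (rule sets.sigma_sets_subset) (use assms measurable_sets in blast)
qed simp

lemma history_measurable:
  assumes "k \<le> n" shows "Z k \<in> borel_measurable (history \<Omega> Z n)"
proof (rule measurableI)
  fix A :: "'b set" assume "A \<in> sets borel"
  with assms show "Z k -` A \<inter> space (history \<Omega> Z n) \<in> sets (history \<Omega> Z n)"
    unfolding sets_history by (auto intro!: sigma_sets.Basic)
qed simp

text \<open>On an event \<open>B\<close> of the history at time \<open>n\<close>, the conditional law of the next state says that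
the restricted law of \<open>X (Suc n)\<close> is the image under \<open>P\<close> of the restricted law of \<open>X n\<close>. As an
equation between measures this extends from sets to functions.\<close>

lemma (in borel_kernel) evolve_nn_integral:
  assumes \<Omega>: "prob_space \<Omega>" and Z: "\<And>k. Z k \<in> borel_measurable \<Omega>" and X: "\<And>k. X k \<in> borel_measurable \<Omega>"
    and ev: "evolves_by P \<Omega> Z X" and B: "B \<in> sets (history \<Omega> Z n)"
    and g[measurable]: "g \<in> borel_measurable borel"
  shows "(\<integral>\<^sup>+\<omega>. indicator B \<omega> * g (X (Suc n) \<omega>) \<partial>\<Omega>) = (\<integral>\<^sup>+\<omega>. indicator B \<omega> * (\<integral>\<^sup>+y. g y \<partial>P (X n \<omega>)) \<partial>\<Omega>)"
proof -
  interpret prob_space \<Omega> by fact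
  note X[measurable]
  have sub: "subalgebra \<Omega> (history \<Omega> Z n)" by (rule history_subalgebra[OF Z])
  interpret finite_measure_subalgebra \<Omega> "history \<Omega> Z n" by unfold_locales (rule sub)
  have B_meas[measurable]: "B \<in> sets \<Omega>" using B sub by (auto simp: subalgebra_def)
  define \<rho> where "\<rho> k = distr (density \<Omega> (indicator B)) borel (X k)" for k
  have \<rho>_int: "(\<integral>\<^sup>+x. h x \<partial>\<rho> k) = (\<integral>\<^sup>+\<omega>. indicator B \<omega> * h (X k \<omega>) \<partial>\<Omega>)"
    if [measurable]: "h \<in> borel_measurable borel" for h k
    unfolding \<rho>_def by (simp add: nn_integral_distr nn_integral_density)
  have \<rho>_sets: "sets (\<rho> k) = sets borel" "space (\<rho> k) = UNIV" for k by (simp_all add: \<rho>_def)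
  have P: "P \<in> measurable (\<rho> n) (subprob_algebra borel)"
    using kernel_measurable by (simp add: measurable_cong_sets[OF \<rho>_sets(1) refl])
  have "\<rho> n \<bind> P = \<rho> (Suc n)"
  proof (rule measure_eqI)
    show "sets (\<rho> n \<bind> P) = sets (\<rho> (Suc n))"
      using sets_bind[of "\<rho> n" P borel] borel_probD[OF kernel_prob] by (simp add: \<rho>_sets)
    fix A assume "A \<in> sets (\<rho> n \<bind> P)"
    then have A[measurable]: "A \<in> sets borel"
      using sets_bind[of "\<rho> n" P borel] borel_probD[OF kernel_prob] by (simp add: \<rho>_sets)
    have Pm[measurable]: "(\<lambda>x. measure (P x) A) \<in> borel_measurable borel"
      using kernel A by (simp add: markov_kernel_def)
    have em: "emeasure (P x) A = ennreal (measure (P x) A)" for x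
      using borel_probD[OF kernel_prob] by (intro finite_measure.emeasure_eq_measure prob_space.axioms)
    have le1: "measure (P x) A \<le> 1" for x
      using borel_probD[OF kernel_prob] by (intro prob_space.prob_le_1)
    have "emeasure (\<rho> n \<bind> P) A = (\<integral>\<^sup>+x. ennreal (measure (P x) A) \<partial>\<rho> n)"
      by (subst emeasure_bind[OF _ P A]) (simp_all add: \<rho>_sets em)
    also have "\<dots> = (\<integral>\<^sup>+\<omega>. ennreal (indicator B \<omega> * measure (P (X n \<omega>)) A) \<partial>\<Omega>)"
      by (subst \<rho>_int) (auto intro!: nn_integral_cong simp: indicator_def)
    also have "\<dots> = ennreal (\<integral>\<omega>. indicator B \<omega> * measure (P (X n \<omega>)) A \<partial>\<Omega>)"
      by (intro nn_integral_eq_integral integrable_const_bound[where B=1]) (auto simp: indicator_def le1)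
    also have "(\<integral>\<omega>. indicator B \<omega> * measure (P (X n \<omega>)) A \<partial>\<Omega>)
        = (\<integral>\<omega>. indicator B \<omega> * real_cond_exp \<Omega> (history \<Omega> Z n) (\<lambda>\<omega>'. indicator A (X (Suc n) \<omega>')) \<omega> \<partial>\<Omega>)"
    proof (rule integral_cong_AE)
      have "AE \<omega> in \<Omega>. real_cond_exp \<Omega> (history \<Omega> Z n) (\<lambda>\<omega>'. indicator A (X (Suc n) \<omega>')) \<omega>
          = measure (P (X n \<omega>)) A"
        using ev A unfolding evolves_by_def by blast
      then show "AE \<omega> in \<Omega>. indicator B \<omega> * measure (P (X n \<omega>)) A
          = indicator B \<omega> * real_cond_exp \<Omega> (history \<Omega> Z n) (\<lambda>\<omega>'. indicator A (X (Suc n) \<omega>')) \<omega>"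
        by eventually_elim simp
    qed measurable
    also have "\<dots> = (\<integral>\<omega>. indicator B \<omega> * indicator A (X (Suc n) \<omega>) \<partial>\<Omega>)"
      using real_cond_exp_intA[OF _ B, of "\<lambda>\<omega>'. indicator A (X (Suc n) \<omega>')"]
      by (simp add: set_lebesgue_integral_def integrable_const_bound[where B=1])
    also have "ennreal \<dots> = (\<integral>\<^sup>+\<omega>. ennreal (indicator B \<omega> * indicator A (X (Suc n) \<omega>)) \<partial>\<Omega>)"
      by (intro nn_integral_eq_integral[symmetric] integrable_const_bound[where B=1]) (auto simp: indicator_def)
    also have "\<dots> = (\<integral>\<^sup>+x. indicator A x \<partial>\<rho> (Suc n))"
      by (subst \<rho>_int) (auto intro!: nn_integral_cong simp: indicator_def)
    also have "\<dots> = emeasure (\<rho> (Suc n)) A" by (simp add: \<rho>_sets)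
    finally show "emeasure (\<rho> n \<bind> P) A = emeasure (\<rho> (Suc n)) A" .
  qed
  then have "(\<integral>\<^sup>+x. g x \<partial>\<rho> (Suc n)) = (\<integral>\<^sup>+x. \<integral>\<^sup>+y. g y \<partial>P x \<partial>\<rho> n)"
    using nn_integral_bind[OF g P] by simp
  moreover have "(\<lambda>x. \<integral>\<^sup>+y. g y \<partial>P x) \<in> borel_measurable borel"
    by (rule measurable_compose[OF kernel_measurable nn_integral_measurable_subprob_algebra[OF g]])
  ultimately show ?thesis by (simp add: \<rho>_int)
qed

lemma (in borel_kernel) evolve_integral:
  assumes \<Omega>: "prob_space \<Omega>" and Z: "\<And>k. Z k \<in> borel_measurable \<Omega>" and X: "\<And>k. X k \<in> borel_measurable \<Omega>"
    and ev: "evolves_by P \<Omega> Z X" and B: "B \<in> sets (history \<Omega> Z n)" and g: "g \<in> unit_functions"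
  shows "(\<integral>\<omega>. indicator B \<omega> * g (X (Suc n) \<omega>) \<partial>\<Omega>) = (\<integral>\<omega>. indicator B \<omega> * transition g (X n \<omega>) \<partial>\<Omega>)"
proof -
  have [measurable]: "B \<in> sets \<Omega>" using B history_subalgebra[of Z, OF Z] by (auto simp: subalgebra_def)
  note X[measurable]
  have eq: "(\<integral>\<omega>. indicator B \<omega> * h (X k \<omega>) \<partial>\<Omega>) = enn2real (\<integral>\<^sup>+\<omega>. indicator B \<omega> * ennreal (h (X k \<omega>)) \<partial>\<Omega>)"
    if h: "h \<in> unit_functions" for h k
  proof -
    note unit_functionsD(1)[OF h, measurable]
    have "(\<integral>\<omega>. indicator B \<omega> * h (X k \<omega>) \<partial>\<Omega>) = enn2real (\<integral>\<^sup>+\<omega>. ennreal (indicator B \<omega> * h (X k \<omega>)) \<partial>\<Omega>)"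
      using unit_functionsD(2)[OF h] by (intro integral_eq_nn_integral) auto
    also have "(\<integral>\<^sup>+\<omega>. ennreal (indicator B \<omega> * h (X k \<omega>)) \<partial>\<Omega>) = (\<integral>\<^sup>+\<omega>. indicator B \<omega> * ennreal (h (X k \<omega>)) \<partial>\<Omega>)"
      by (intro nn_integral_cong) (auto simp: indicator_def)
    finally show ?thesis .
  qed
  have "(\<integral>\<^sup>+\<omega>. indicator B \<omega> * ennreal (g (X (Suc n) \<omega>)) \<partial>\<Omega>)
      = (\<integral>\<^sup>+\<omega>. indicator B \<omega> * ennreal (transition g (X n \<omega>)) \<partial>\<Omega>)"
    using evolve_nn_integral[OF \<Omega> Z X ev B, of "\<lambda>x. ennreal (g x)"] unit_functionsD(1)[OF g]
    by (simp add: unit_nn_integral[OF kernel_prob g] transition_def)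
  then show ?thesis by (simp add: eq g transition_unit)
qed

lemma (in borel_kernel) evolve_law:
  assumes \<Omega>: "prob_space \<Omega>" and Z: "\<And>k. Z k \<in> borel_measurable \<Omega>" and X: "\<And>k. X k \<in> borel_measurable \<Omega>"
    and ev: "evolves_by P \<Omega> Z X" and start: "AE \<omega> in \<Omega>. X 0 \<omega> = x" and g: "g \<in> unit_functions"
  shows "(\<integral>\<omega>. g (X n \<omega>) \<partial>\<Omega>) = (transition ^^ n) g x"
  using g
proof (induction n arbitrary: g)
  case 0
  interpret prob_space \<Omega> by fact
  note X[measurable] unit_functionsD(1)[OF 0, measurable]
  have "(\<integral>\<omega>. g (X 0 \<omega>) \<partial>\<Omega>) = (\<integral>\<omega>. g x \<partial>\<Omega>)"
    using start by (intro integral_cong_AE) auto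
  then show ?case by (simp add: prob_space)
next
  case (Suc n)
  have "space \<Omega> \<in> sets (history \<Omega> Z n)" using sets.top[of "history \<Omega> Z n"] by simp
  from evolve_integral[OF \<Omega> Z X ev this Suc.prems]
  have "(\<integral>\<omega>. g (X (Suc n) \<omega>) \<partial>\<Omega>) = (\<integral>\<omega>. transition g (X n \<omega>) \<partial>\<Omega>)"
    by (simp cong: Bochner_Integration.integral_cong)
  also have "\<dots> = (transition ^^ n) (transition g) x" by (rule Suc.IH[OF transition_unit[OF Suc.prems]])
  finally show ?case by (simp add: funpow_swap1)
qed

section \<open>Monotone kernels\<close>

locale monotone_kernel = ordered_space le + borel_kernel P
  for le :: "'a::polish_space \<Rightarrow> 'a \<Rightarrow> bool" (infix "\<preceq>" 50) and P :: "'a \<Rightarrow> 'a measure" +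
  assumes stoch_monotone: "stoch_monotone le P"
begin

lemma transition_increasing: "g \<in> increasing_functions le \<Longrightarrow> transition g \<in> increasing_functions le"
  using stoch_monotone unfolding stoch_monotone_def transition_def by blast

lemma iterate_increasing: "g \<in> increasing_functions le \<Longrightarrow> (transition ^^ n) g \<in> increasing_functions le"
  by (induction n) (auto intro: transition_increasing)

lemma bind_stoch_le:
  assumes "stoch_le \<mu> \<nu>" "borel_prob \<mu>" "borel_prob \<nu>"
  shows "stoch_le (\<mu> \<bind> P) (\<nu> \<bind> P)"
  using assms by (auto simp: stoch_le_def bind_kernel(2) increasing_unit transition_increasing)

text \<open>On the event \<open>S k\<close> that the pair has been ordered by time \<open>k\<close>, let \<open>D k m\<close> be the expected
difference of the two coordinates after \<open>m\<close> further steps. From time \<open>k\<close> to \<open>k + 1\<close> it does not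
increase: on \<open>S k\<close> one of the further steps is carried out, which leaves the expectation unchanged, and
on the rest of \<open>S (k + 1)\<close> the pair is ordered at time \<open>k + 1\<close>. So \<open>D n 0 \<le> 0\<close>, and the remaining event
contributes at most its probability.\<close>

lemma coupling_bound:
  assumes c: "mm_coupling P x y \<Omega> Z" and g: "g \<in> increasing_functions le"
  shows "(transition ^^ n) g x - (transition ^^ n) g y \<le> tail_prob \<Omega> Z (order_graph le) n"
proof -
  interpret prob_space \<Omega> using c by (simp add: mm_coupling_def)
  have Z: "\<And>k. Z k \<in> borel_measurable \<Omega>" and start: "AE \<omega> in \<Omega>. Z 0 \<omega> = (x, y)"
    and evX: "evolves_by P \<Omega> Z (\<lambda>n \<omega>. fst (Z n \<omega>))" and evY: "evolves_by P \<Omega> Z (\<lambda>n \<omega>. snd (Z n \<omega>))"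
    using c by (auto simp: mm_coupling_def)
  have X: "(\<lambda>\<omega>. fst (Z k \<omega>)) \<in> borel_measurable \<Omega>" and Y: "(\<lambda>\<omega>. snd (Z k \<omega>)) \<in> borel_measurable \<Omega>" for k
    by (auto intro!: measurable_compose[OF Z] borel_measurable_continuous_onI continuous_intros)
  let ?H = "order_graph le"
  have H: "?H \<in> sets borel" using closed_graph by (rule borel_closed)
  define N where "N k = {\<omega> \<in> space \<Omega>. \<forall>i\<in>{..k}. Z i \<omega> \<notin> ?H}" for k
  define S where "S k = space \<Omega> - N k" for k
  have N_hist: "N k \<in> sets (history \<Omega> Z k)" for k
  proof -
    have hit: "{\<omega> \<in> space (history \<Omega> Z k). Z i \<omega> \<notin> ?H} \<in> sets (history \<Omega> Z k)" if "i \<le> k" for i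
      using measurable_sets[OF history_measurable[OF that], of "- ?H"] H
      by (simp add: vimage_def Int_def conj_commute)
    have "{\<omega> \<in> space (history \<Omega> Z k). \<forall>i\<in>{..k}. Z i \<omega> \<notin> ?H} \<in> sets (history \<Omega> Z k)"
    proof (rule sets.sets_Collect_finite_All)
      show "{\<omega> \<in> space (history \<Omega> Z k). Z i \<omega> \<notin> ?H} \<in> sets (history \<Omega> Z k)" if "i \<in> {..k}" for i
        by (rule hit) (use that in simp)
    qed simp
    then show ?thesis unfolding N_def space_history .
  qed
  have S_hist: "S k \<in> sets (history \<Omega> Z k)" for k
    using sets.compl_sets[OF N_hist[of k]] by (simp add: S_def)
  have S_meas[measurable]: "S k \<in> sets \<Omega>" and N_meas[measurable]: "N k \<in> sets \<Omega>" for k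
    using S_hist N_hist history_subalgebra[of Z, OF Z] by (auto simp: subalgebra_def)
  let ?f = "\<lambda>m. (transition ^^ m) g"
  have f: "?f m \<in> increasing_functions le" for m by (rule iterate_increasing[OF g])
  have fm[measurable]: "?f m \<in> borel_measurable borel" for m by (rule increasing_functionsD(1)[OF f])
  note X[measurable] Y[measurable]
  have int: "integrable \<Omega> (\<lambda>\<omega>. indicator A \<omega> * h (V \<omega>))"
    if A: "A \<in> sets \<Omega>" and h: "h \<in> unit_functions" and V: "V \<in> borel_measurable \<Omega>" for A h and V :: "_ \<Rightarrow> 'a"
    using A unit_functionsD[OF h] measurable_compose[OF V unit_functionsD(1)[OF h]]
    by (intro integrable_const_bound[where B=1]) (auto simp: indicator_def)
  have iX: "integrable \<Omega> (\<lambda>\<omega>. indicator (S j) \<omega> * ?f m (fst (Z i \<omega>)))"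
    and iY: "integrable \<Omega> (\<lambda>\<omega>. indicator (S j) \<omega> * ?f m (snd (Z i \<omega>)))" for i j m
    by (intro int increasing_unit[OF f] X Y S_meas)+
  define D where "D k m = (\<integral>\<omega>. indicator (S k) \<omega> * ?f m (fst (Z k \<omega>)) \<partial>\<Omega>) - (\<integral>\<omega>. indicator (S k) \<omega> * ?f m (snd (Z k \<omega>)) \<partial>\<Omega>)" for k m
  have ordered: "?f m (fst (Z k \<omega>)) \<le> ?f m (snd (Z k \<omega>))" if "Z k \<omega> \<in> ?H" for m k \<omega>
    using that by (intro increasing_functionsD(5)[OF f]) (auto simp: order_graph_def)
  have D: "D k m \<le> 0" for k m
  proof (induction k arbitrary: m)
    case 0
    have "(\<integral>\<omega>. indicator (S 0) \<omega> * ?f m (fst (Z 0 \<omega>)) \<partial>\<Omega>) \<le> (\<integral>\<omega>. indicator (S 0) \<omega> * ?f m (snd (Z 0 \<omega>)) \<partial>\<Omega>)"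
      using ordered by (intro integral_mono int increasing_unit[OF f] X Y S_meas)
        (auto simp: indicator_def S_def N_def)
    then show ?case by (simp add: D_def)
  next
    case (Suc k)
    have "(\<integral>\<omega>. indicator (S (Suc k)) \<omega> * ?f m (fst (Z (Suc k) \<omega>)) + indicator (S k) \<omega> * ?f m (snd (Z (Suc k) \<omega>)) \<partial>\<Omega>)
       \<le> (\<integral>\<omega>. indicator (S k) \<omega> * ?f m (fst (Z (Suc k) \<omega>)) + indicator (S (Suc k)) \<omega> * ?f m (snd (Z (Suc k) \<omega>)) \<partial>\<Omega>)"
      using ordered by (intro integral_mono Bochner_Integration.integrable_add int increasing_unit[OF f] X Y S_meas)
        (auto simp: indicator_def S_def N_def le_Suc_eq)
    then have "D (Suc k) m \<le> (\<integral>\<omega>. indicator (S k) \<omega> * ?f m (fst (Z (Suc k) \<omega>)) \<partial>\<Omega>) - (\<integral>\<omega>. indicator (S k) \<omega> * ?f m (snd (Z (Suc k) \<omega>)) \<partial>\<Omega>)"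
      by (simp add: D_def iX iY)
    also have "\<dots> = D k (Suc m)"
      unfolding D_def using evolve_integral[OF prob_space_axioms Z X evX S_hist increasing_unit[OF f]]
        evolve_integral[OF prob_space_axioms Z Y evY S_hist increasing_unit[OF f]] by simp
    also have "\<dots> \<le> 0" by (rule Suc)
    finally show ?case .
  qed
  have laws: "(transition ^^ n) g x = (\<integral>\<omega>. g (fst (Z n \<omega>)) \<partial>\<Omega>)" "(transition ^^ n) g y = (\<integral>\<omega>. g (snd (Z n \<omega>)) \<partial>\<Omega>)"
  proof -
    have "AE \<omega> in \<Omega>. fst (Z 0 \<omega>) = x" "AE \<omega> in \<Omega>. snd (Z 0 \<omega>) = y"
      using start by auto
    then show "(transition ^^ n) g x = (\<integral>\<omega>. g (fst (Z n \<omega>)) \<partial>\<Omega>)" "(transition ^^ n) g y = (\<integral>\<omega>. g (snd (Z n \<omega>)) \<partial>\<Omega>)"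
      using evolve_law[OF prob_space_axioms Z X evX _ increasing_unit[OF g], of x n]
        evolve_law[OF prob_space_axioms Z Y evY _ increasing_unit[OF g], of y n] by simp_all
  qed
  have "(\<integral>\<omega>. g (fst (Z n \<omega>)) \<partial>\<Omega>) = (\<integral>\<omega>. indicator (space \<Omega>) \<omega> * g (fst (Z n \<omega>)) \<partial>\<Omega>)"
    "(\<integral>\<omega>. g (snd (Z n \<omega>)) \<partial>\<Omega>) = (\<integral>\<omega>. indicator (space \<Omega>) \<omega> * g (snd (Z n \<omega>)) \<partial>\<Omega>)"
    by (auto intro!: Bochner_Integration.integral_cong)
  moreover have "(\<integral>\<omega>. indicator (space \<Omega>) \<omega> * g (fst (Z n \<omega>)) + indicator (S n) \<omega> * g (snd (Z n \<omega>)) \<partial>\<Omega>)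
     \<le> (\<integral>\<omega>. (indicator (S n) \<omega> * g (fst (Z n \<omega>)) + indicator (space \<Omega>) \<omega> * g (snd (Z n \<omega>))) + indicator (N n) \<omega> \<partial>\<Omega>)"
    using increasing_functionsD(2,3)[OF g]
    by (intro integral_mono Bochner_Integration.integrable_add int increasing_unit[OF g] X Y S_meas sets.top
         integrable_real_indicator N_meas)
      (auto simp: indicator_def S_def add_increasing less_top[symmetric])
  moreover have "integrable \<Omega> (\<lambda>\<omega>. indicator (space \<Omega>) \<omega> * g (fst (Z n \<omega>)))"
    "integrable \<Omega> (\<lambda>\<omega>. indicator (space \<Omega>) \<omega> * g (snd (Z n \<omega>)))"
    by (intro int increasing_unit[OF g] X Y sets.top)+
  ultimately have "(\<integral>\<omega>. g (fst (Z n \<omega>)) \<partial>\<Omega>) - (\<integral>\<omega>. g (snd (Z n \<omega>)) \<partial>\<Omega>) \<le> D n 0 + measure \<Omega> (N n)"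
    using iX[of n 0 n] iY[of n 0 n] N_meas[of n] by (simp add: D_def less_top[symmetric])
  also have "measure \<Omega> (N n) = tail_prob \<Omega> Z ?H n"
    unfolding tail_prob_def N_def first_hit_gt_iff by (simp add: Ball_def)
  finally show ?thesis using D[of n 0] laws by simp
qed

end

lemma tail_prob_le_1: "prob_space \<Omega> \<Longrightarrow> tail_prob \<Omega> Z H n \<le> 1"
  unfolding tail_prob_def by (rule prob_space.prob_le_1)

lemma tail_prob_tendsto_0:
  assumes \<Omega>: "prob_space \<Omega>" and Z: "\<And>k. Z k \<in> borel_measurable \<Omega>" and H: "H \<in> sets borel"
    and fin: "AE \<omega> in \<Omega>. first_hit 0 Z H \<omega> < \<infinity>"
  shows "(\<lambda>n. tail_prob \<Omega> Z H n) \<longlonglongrightarrow> 0"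
proof -
  interpret prob_space \<Omega> by fact
  note Z[measurable] H[measurable]
  let ?N = "\<lambda>n. {\<omega> \<in> space \<Omega>. \<forall>i\<le>n. Z i \<omega> \<notin> H}"
  have "(\<lambda>n. measure \<Omega> (?N n)) \<longlonglongrightarrow> measure \<Omega> (\<Inter>n. ?N n)"
  proof (rule finite_Lim_measure_decseq)
    show "range ?N \<subseteq> sets \<Omega>" by (auto intro!: sets.sets_Collect)
    show "decseq ?N" by (auto simp: decseq_def)
  qed
  moreover have "AE \<omega> in \<Omega>. \<omega> \<notin> (\<Inter>n. ?N n)"
    using fin
  proof eventually_elim
    case (elim \<omega>)
    then obtain n where "first_hit 0 Z H \<omega> = enat n" by (cases "first_hit 0 Z H \<omega>") auto
    then have "\<not> enat n < first_hit 0 Z H \<omega>" by simp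
    then show ?case by (auto simp: first_hit_gt_iff)
  qed
  then have "measure \<Omega> (\<Inter>n. ?N n) = 0"
    by (subst prob_eq_0) auto
  ultimately show ?thesis by (simp add: tail_prob_def first_hit_gt_iff)
qed

context monotone_kernel begin

lemma dual_monotone: "monotone_kernel (\<lambda>x y. y \<preceq> x) P"
proof -
  interpret d: ordered_space "\<lambda>x y. y \<preceq> x" by (rule dual)
  have "stoch_monotone (\<lambda>x y. y \<preceq> x) P"
    unfolding stoch_monotone_def
  proof
    fix g assume g: "g \<in> increasing_functions (\<lambda>x y. y \<preceq> x)"
    have "transition (\<lambda>x. 1 - g x) \<in> increasing_functions le"
      by (rule transition_increasing[OF reverse_increasing[OF g]])
    moreover have "transition (\<lambda>x. 1 - g x) = (\<lambda>x. 1 - transition g x)"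
      by (rule transition_complement[OF increasing_unit[OF g]])
    ultimately have "(\<lambda>x. 1 - (1 - transition g x)) \<in> increasing_functions (\<lambda>x y. y \<preceq> x)"
      by (intro reverse_increasing') simp
    then show "(\<lambda>x. \<integral>y. g y \<partial>P x) \<in> increasing_functions (\<lambda>x y. y \<preceq> x)" by (simp add: transition_def)
  qed
  then show ?thesis by unfold_locales
qed

text \<open>Let \<open>\<nu>\<close> be the return time and \<open>B k\<close> the event \<open>\<nu> > k\<close>. The measure \<open>\<mu>\<close> is the expected
occupation measure of \<open>X 0, \<dots>, X (\<nu> - 1)\<close> divided by \<open>C = E \<nu>\<close>. Its image under \<open>P\<close> is that of
\<open>X 1, \<dots>, X \<nu>\<close>: the state \<open>X 0 = x\<close> has been exchanged for \<open>X \<nu>\<close>, which lies above \<open>x\<close>.\<close>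

lemma cycle_measure:
  assumes ch: "markov_chain P x \<Omega> X"
    and fin: "(\<integral>\<^sup>+\<omega>. ennreal_of_enat (first_hit 1 X {z. x \<preceq> z} \<omega>) \<partial>\<Omega>) < \<infinity>"
  shows "\<exists>\<mu>\<in>space (prob_algebra borel). \<forall>g\<in>increasing_functions le. (\<integral>x. g x \<partial>\<mu>) \<le> (\<integral>x. transition g x \<partial>\<mu>)"
proof -
  interpret prob_space \<Omega> using ch by (simp add: markov_chain_def)
  have X[measurable]: "\<And>k. X k \<in> borel_measurable \<Omega>" and start: "AE \<omega> in \<Omega>. X 0 \<omega> = x"
    and ev: "evolves_by P \<Omega> X X" using ch by (auto simp: markov_chain_def)
  define R where "R = {z. x \<preceq> z}"
  have R[measurable]: "R \<in> sets borel" unfolding R_def by (rule borel_closed[OF closed_up_set])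
  define B where "B k = {\<omega> \<in> space \<Omega>. \<forall>i\<in>{1..k}. X i \<omega> \<notin> R}" for k
  have B_hist: "B k \<in> sets (history \<Omega> X k)" for k
  proof -
    have "{\<omega> \<in> space (history \<Omega> X k). \<forall>i\<in>{1..k}. X i \<omega> \<notin> R} \<in> sets (history \<Omega> X k)"
    proof (rule sets.sets_Collect_finite_All)
      fix i assume "i \<in> {1..k}"
      then show "{\<omega> \<in> space (history \<Omega> X k). X i \<omega> \<notin> R} \<in> sets (history \<Omega> X k)"
        using measurable_sets[OF history_measurable[of i k X \<Omega>], of "- R"] R
        by (simp add: vimage_def Int_def conj_commute)
    qed simp
    then show ?thesis unfolding B_def space_history .
  qed
  have B[measurable]: "B k \<in> sets \<Omega>" for k
    using B_hist history_subalgebra[of X, OF X] by (auto simp: subalgebra_def)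
  have B_hit: "B k = {\<omega> \<in> space \<Omega>. enat k < first_hit 1 X R \<omega>}" for k
    unfolding B_def first_hit_gt_iff by auto
  define C where "C = (\<Sum>k. emeasure \<Omega> (B k))"
  have C_eq: "C = (\<integral>\<^sup>+\<omega>. ennreal_of_enat (first_hit 1 X R \<omega>) \<partial>\<Omega>)"
    unfolding C_def B_hit by (rule nn_integral_enat_function[symmetric, OF first_hit_measurable[OF X R]])
  have C_fin: "C \<noteq> \<top>" using fin unfolding C_eq R_def by (simp add: less_top)
  have B0: "emeasure \<Omega> (B 0) = 1" using emeasure_space_1 by (simp add: B_def)
  have "emeasure \<Omega> (B 0) \<le> C"
    unfolding C_def using sum_le_suminf[of "\<lambda>k. emeasure \<Omega> (B k)" "{0}"] by simp
  then have C_pos: "C \<noteq> 0" using B0 by auto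

  \<comment> \<open>Time and path chosen jointly, with density \<open>1 / C\<close> on the pairs for which the cycle is not complete.\<close>
  define M where "M = density (count_space UNIV \<Otimes>\<^sub>M \<Omega>) (\<lambda>(k, \<omega>). indicator (B k) \<omega> * inverse C)"
  define \<mu> where "\<mu> = distr M borel (\<lambda>(k, \<omega>). X k \<omega>)"
  have Xpair[measurable]: "(\<lambda>(k, \<omega>). X k \<omega>) \<in> measurable (count_space UNIV \<Otimes>\<^sub>M \<Omega>) borel"
    by (rule measurable_pair_measure_countable1) auto
  have wpair[measurable]: "(\<lambda>(k, \<omega>). indicator (B k) \<omega> * inverse C) \<in> borel_measurable (count_space UNIV \<Otimes>\<^sub>M \<Omega>)"
    by (rule measurable_pair_measure_countable1) auto
  have \<mu>_int: "(\<integral>\<^sup>+z. h z \<partial>\<mu>) = (\<Sum>k. \<integral>\<^sup>+\<omega>. indicator (B k) \<omega> * h (X k \<omega>) \<partial>\<Omega>) * inverse C"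
    if h[measurable]: "h \<in> borel_measurable borel" for h
  proof -
    have m: "(\<lambda>(k, \<omega>). (indicator (B k) \<omega> * inverse C) * h (X k \<omega>)) \<in> borel_measurable (count_space UNIV \<Otimes>\<^sub>M \<Omega>)"
      by (rule measurable_pair_measure_countable1) auto
    have Xpair': "(\<lambda>(k, \<omega>). X k \<omega>) \<in> measurable M borel"
      using Xpair by (simp add: M_def)
    have hX: "(\<lambda>p. h (case p of (k, \<omega>) \<Rightarrow> X k \<omega>)) \<in> borel_measurable (count_space UNIV \<Otimes>\<^sub>M \<Omega>)"
      by measurable
    have "(\<integral>\<^sup>+z. h z \<partial>\<mu>) = (\<integral>\<^sup>+p. h (case p of (k, \<omega>) \<Rightarrow> X k \<omega>) \<partial>M)"
      unfolding \<mu>_def by (rule nn_integral_distr[OF Xpair']) simp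
    also have "\<dots> = (\<integral>\<^sup>+p. (case p of (k, \<omega>) \<Rightarrow> (indicator (B k) \<omega> * inverse C) * h (X k \<omega>)) \<partial>(count_space UNIV \<Otimes>\<^sub>M \<Omega>))"
      unfolding M_def by (subst nn_integral_density[OF wpair hX], rule nn_integral_cong) (simp add: split_beta)
    also have "\<dots> = (\<integral>\<^sup>+k. \<integral>\<^sup>+\<omega>. (indicator (B k) \<omega> * inverse C) * h (X k \<omega>) \<partial>\<Omega> \<partial>count_space UNIV)"
      using nn_integral_fst[OF m] by simp
    also have "\<dots> = (\<integral>\<^sup>+k. (\<integral>\<^sup>+\<omega>. indicator (B k) \<omega> * h (X k \<omega>) \<partial>\<Omega>) * inverse C \<partial>count_space UNIV)"
      by (intro nn_integral_cong, subst nn_integral_multc[symmetric]) (auto simp: mult_ac)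
    also have "\<dots> = (\<Sum>k. \<integral>\<^sup>+\<omega>. indicator (B k) \<omega> * h (X k \<omega>) \<partial>\<Omega>) * inverse C"
      by (simp add: nn_integral_count_space_nat)
    finally show ?thesis .
  qed
  have "emeasure \<mu> (space \<mu>) = (\<integral>\<^sup>+z. 1 \<partial>\<mu>)" by simp
  also have "\<dots> = C * inverse C"
    by (subst \<mu>_int) (simp_all add: C_def)
  also have "\<dots> = 1" using C_pos C_fin ennreal_divide_self[of C] by (simp add: divide_ennreal_def less_top)
  finally have \<mu>: "borel_prob \<mu>"
    by (intro borel_probI prob_spaceI) (simp_all add: \<mu>_def)

  have "(\<integral>z. g z \<partial>\<mu>) \<le> (\<integral>z. transition g z \<partial>\<mu>)" if g: "g \<in> increasing_functions le" for g
  proof -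
    have gu: "g \<in> unit_functions" by (rule increasing_unit[OF g])
    note gm[measurable] = unit_functionsD(1)[OF gu]
    let ?g = "\<lambda>z. ennreal (g z)"
    let ?a = "\<lambda>k. \<integral>\<^sup>+\<omega>. indicator (B k) \<omega> * ?g (X k \<omega>) \<partial>\<Omega>"
    let ?b = "\<lambda>k. \<integral>\<^sup>+\<omega>. indicator (B k) \<omega> * ?g (X (Suc k) \<omega>) \<partial>\<Omega>"
    have dec: "B (Suc k) \<subseteq> B k" for k by (auto simp: B_def)
    have step: "?a (Suc k) + ?g x * emeasure \<Omega> (B k - B (Suc k)) \<le> ?b k" for k
    proof -
      have "?a (Suc k) + ?g x * emeasure \<Omega> (B k - B (Suc k))
          = (\<integral>\<^sup>+\<omega>. indicator (B (Suc k)) \<omega> * ?g (X (Suc k) \<omega>) + ?g x * indicator (B k - B (Suc k)) \<omega> \<partial>\<Omega>)"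
        by (simp add: nn_integral_add nn_integral_cmult_indicator)
      also have "\<dots> \<le> ?b k"
      proof (rule nn_integral_mono)
        fix \<omega> assume "\<omega> \<in> space \<Omega>"
        show "indicator (B (Suc k)) \<omega> * ?g (X (Suc k) \<omega>) + ?g x * indicator (B k - B (Suc k)) \<omega>
            \<le> indicator (B k) \<omega> * ?g (X (Suc k) \<omega>)"
        proof (cases "\<omega> \<in> B k - B (Suc k)")
          case True
          then have "x \<preceq> X (Suc k) \<omega>" by (auto simp: B_def R_def le_Suc_eq)
          then have "g x \<le> g (X (Suc k) \<omega>)" by (rule increasing_functionsD(5)[OF g])
          then show ?thesis using True by (simp add: ennreal_leI)
        next
          case False
          then show ?thesis using dec[of k] by (auto simp: indicator_def)
        qed
      qed
      finally show ?thesis .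
    qed
    \<comment> \<open>The events \<open>B k - B (Suc k)\<close>, that the return occurs at time \<open>k + 1\<close>, almost surely exhaust the space.\<close>
    have "(\<Sum>k. emeasure \<Omega> (B k - B (Suc k))) = emeasure \<Omega> (\<Union>k. B k - B (Suc k))"
    proof (rule suminf_emeasure)
      show "disjoint_family (\<lambda>k. B k - B (Suc k))"
        unfolding disjoint_family_on_def
      proof (intro ballI impI)
        fix i j :: nat assume "i \<noteq> j"
        have "(B i - B (Suc i)) \<inter> (B j - B (Suc j)) = {}" if "i < j" for i j
          using lift_Suc_antimono_le[of B "Suc i" j, OF dec] that by auto
        with \<open>i \<noteq> j\<close> show "(B i - B (Suc i)) \<inter> (B j - B (Suc j)) = {}"
          by (cases "i < j") (auto simp: not_less Int_commute dest!: le_neq_implies_less)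
      qed
    qed auto
    moreover have "emeasure \<Omega> (\<Union>k. B k - B (Suc k)) = 1"
    proof -
      have "emeasure \<Omega> (\<Inter>k. B k) = 0"
      proof (rule ccontr)
        assume nz: "emeasure \<Omega> (\<Inter>k. B k) \<noteq> 0"
        have "(\<Sum>k::nat. emeasure \<Omega> (\<Inter>k. B k)) \<le> C"
          unfolding C_def by (intro suminf_le emeasure_mono) auto
        moreover have "(\<Sum>k::nat. emeasure \<Omega> (\<Inter>k. B k)) = \<top>"
          using nz by (simp add: nn_integral_count_space_nat[symmetric] ennreal_mult_top)
        ultimately show False using C_fin by (simp add: top_unique)
      qed
      moreover have "(\<Union>k. B k - B (Suc k)) = space \<Omega> - (\<Inter>k. B k)"
      proof (intro equalityI subsetI)
        fix \<omega> assume \<omega>: "\<omega> \<in> space \<Omega> - (\<Inter>k. B k)"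
        then obtain k where "\<omega> \<notin> B k" by auto
        moreover have "\<omega> \<in> B 0" using \<omega> by (simp add: B_def)
        ultimately have "\<exists>j<k. \<omega> \<in> B j \<and> \<omega> \<notin> B (Suc j)" by (induction k) (auto simp: less_Suc_eq)
        then show "\<omega> \<in> (\<Union>k. B k - B (Suc k))" by auto
      qed (auto simp: B_def)
      moreover have "(\<Inter>k. B k) \<in> sets \<Omega>" by (rule sets.countable_INT) auto
      ultimately show ?thesis
        using emeasure_space_1 emeasure_Diff_null_set[of "\<Inter>k. B k" \<Omega> "space \<Omega>"] by (simp add: null_setsI)
    qed
    ultimately have tele: "(\<Sum>k. emeasure \<Omega> (B k - B (Suc k))) = 1" by simp
    have "?a 0 = (\<integral>\<^sup>+\<omega>. ?g x \<partial>\<Omega>)"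
      using start by (intro nn_integral_cong_AE) (auto simp: B_def)
    then have a0: "?a 0 = ?g x" by (simp add: emeasure_space_1)
    have "(\<Sum>k. ?a k) = (\<Sum>k. ?a (Suc k)) + ?a 0"
      by (subst suminf_offset[of ?a 1]) auto
    also have "\<dots> = (\<Sum>k. ?a (Suc k)) + ?g x * (\<Sum>k. emeasure \<Omega> (B k - B (Suc k)))"
      by (simp add: a0 tele)
    also have "\<dots> = (\<Sum>k. ?a (Suc k) + ?g x * emeasure \<Omega> (B k - B (Suc k)))"
      by (subst suminf_add[symmetric]) auto
    also have "\<dots> \<le> (\<Sum>k. ?b k)" by (intro suminf_le step) auto
    also have "\<dots> = (\<Sum>k. \<integral>\<^sup>+\<omega>. indicator (B k) \<omega> * ennreal (transition g (X k \<omega>)) \<partial>\<Omega>)"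
      using evolve_nn_integral[OF prob_space_axioms X X ev B_hist, of ?g]
      by (simp add: unit_nn_integral[OF kernel_prob gu] transition_def)
    finally have "(\<integral>\<^sup>+z. ?g z \<partial>\<mu>) \<le> (\<integral>\<^sup>+z. ennreal (transition g z) \<partial>\<mu>)"
      using unit_functionsD(1)[OF transition_unit[OF gu]] by (simp add: \<mu>_int mult_right_mono)
    then show ?thesis
      using unit_integral_bounds(1)[OF \<mu> transition_unit[OF gu]]
      by (simp add: unit_nn_integral[OF \<mu> gu] unit_nn_integral[OF \<mu> transition_unit[OF gu]])
  qed
  with \<mu> show ?thesis by blast
qed

end

section \<open>The stochastic order under weak limits\<close>

text \<open>Lipschitz functions which, for nonempty \<open>C\<close>, decrease to the indicator of its closure as \<open>j\<close> grows.\<close>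

definition bump :: "'a::metric_space set \<Rightarrow> nat \<Rightarrow> 'a \<Rightarrow> real" where
  "bump C j x = max 0 (1 - real (Suc j) * infdist x C)"

lemma bump_bounds: "0 \<le> bump C j x" "bump C j x \<le> 1"
  using infdist_nonneg[of x C] by (auto simp: bump_def)

lemma bump_Lipschitz: "\<bar>bump C j x - bump C j y\<bar> \<le> real (Suc j) * dist x y"
proof -
  have "\<bar>bump C j x - bump C j y\<bar> \<le> \<bar>real (Suc j) * infdist x C - real (Suc j) * infdist y C\<bar>"
    unfolding bump_def by linarith
  also have "\<dots> = real (Suc j) * \<bar>infdist x C - infdist y C\<bar>"
    by (simp only: right_diff_distrib[symmetric] abs_mult abs_of_nat)
  also have "\<dots> \<le> real (Suc j) * dist x y"
    by (intro mult_left_mono infdist_triangle_abs) simp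
  finally show ?thesis .
qed

lemma bump_measurable: "bump C j \<in> borel_measurable (borel :: 'a::metric_space measure)"
  unfolding bump_def by (intro borel_measurable_continuous_onI continuous_intros)

lemma bump_eq_1: "x \<in> C \<Longrightarrow> bump C j x = 1"
  by (simp add: bump_def)

lemma bump_le_indicator: "bump C j x \<le> indicator {x. infdist x C \<le> 1 / real (Suc j)} x"
  using bump_bounds[of C j x] by (auto simp: bump_def indicator_def field_simps)

lemma measure_le_bump:
  fixes C :: "'a::polish_space set"
  assumes mu: "borel_prob \<mu>" and C: "closed C"
  shows "measure \<mu> C \<le> (\<integral>x. bump C j x \<partial>\<mu>)"
    and "(\<integral>x. bump C j x \<partial>\<mu>) \<le> measure \<mu> {x. infdist x C \<le> 1 / real (Suc j)}"
proof -
  let ?N = "{x. infdist x C \<le> 1 / real (Suc j)}"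
  have N: "closed ?N" by (intro closed_Collect_le continuous_intros)
  have int: "integrable \<mu> (bump C j)"
    using bump_bounds[of C j] by (intro borel_prob_integrable[OF mu bump_measurable, of _ _ 1]) auto
  have ind: "integrable \<mu> (indicator A :: 'a \<Rightarrow> real)" "measure \<mu> A = (\<integral>x. indicator A x \<partial>\<mu>)" if "closed A" for A
  proof -
    have "A \<in> sets borel" using that by (rule borel_closed)
    then show "integrable \<mu> (indicator A :: 'a \<Rightarrow> real)"
      by (intro borel_prob_integrable[OF mu, of _ 1] borel_measurable_indicator) (auto simp: indicator_def)
    show "measure \<mu> A = (\<integral>x. indicator A x \<partial>\<mu>)"
      by (subst Bochner_Integration.integral_indicator) (simp add: borel_probD[OF mu])
  qed
  show "measure \<mu> C \<le> (\<integral>x. bump C j x \<partial>\<mu>)"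
    unfolding ind(2)[OF C]
    by (intro integral_mono ind(1)[OF C] int) (auto simp: indicator_def bump_eq_1 bump_bounds)
  show "(\<integral>x. bump C j x \<partial>\<mu>) \<le> measure \<mu> ?N"
    unfolding ind(2)[OF N] by (intro integral_mono ind(1)[OF N] int bump_le_indicator)
qed

context ordered_space begin

text \<open>For compact \<open>K\<close> let \<open>C j\<close> be its closed \<open>1 / (j + 1)\<close>-neighbourhood within a compact set \<open>L\<close> that
carries almost all mass of every \<open>\<mu> n\<close>. Then \<open>\<pi> K\<close> is at most \<open>\<nu>\<close> of the up-hull of \<open>C j\<close>, up to the
error. These hulls decrease to a subset of the up-hull of \<open>K\<close>, because points of \<open>C j\<close> below a fixed
\<open>x\<close> have a cluster point in \<open>K\<close>. Tightness supplies the compactness used here.\<close>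

lemma stoch_le_weak_limit:
  assumes mu: "\<And>n. borel_prob (\<mu> n)" and pi: "borel_prob \<pi>"
    and nu: "borel_prob \<nu>" and tight: "tight_laws \<mu>"
    and conv: "\<And>C j. (\<lambda>n. \<integral>x. bump C j x \<partial>\<mu> (r n)) \<longlonglongrightarrow> (\<integral>x. bump C j x \<partial>\<pi>)"
    and le: "\<And>n. stoch_le (\<mu> n) \<nu>"
  shows "stoch_le \<pi> \<nu>"
proof (rule stoch_leI_compact[OF pi nu])
  fix K :: "'a set" assume K: "compact K"
  interpret nu: prob_space \<nu> using borel_probD[OF nu] by simp
  have closed_K: "closed K" using K by (rule compact_imp_closed)
  show "measure \<pi> K \<le> measure \<nu> (up_hull le K)"
  proof (cases "K = {}")
    case True
    then show ?thesis by simp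
  next
    case False
    show ?thesis
    proof (rule field_le_epsilon)
      fix e :: real assume "0 < e"
      then obtain L where L: "compact L" "\<And>n. 1 - e \<le> measure (\<mu> n) L"
        using tight unfolding tight_laws_def by blast
      have closed_L: "closed L" using L(1) by (rule compact_imp_closed)
      define N where "N j = {x. infdist x K \<le> 1 / real (Suc j)}" for j
      have N: "closed (N j)" for j unfolding N_def by (intro closed_Collect_le continuous_intros)
      define C where "C j = N j \<inter> L" for j
      have C: "compact (C j)" for j unfolding C_def using N L(1) by (rule closed_Int_compact)
      have "measure \<pi> K \<le> measure \<nu> (up_hull le (C j)) + e" for j
      proof -
        have "(\<integral>x. bump K j x \<partial>\<mu> n) \<le> measure \<nu> (up_hull le (C j)) + e" for n
        proof -
          interpret prob_space "\<mu> n" using borel_probD[OF mu] by simp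
          have "(\<integral>x. bump K j x \<partial>\<mu> n) \<le> measure (\<mu> n) (N j)"
            unfolding N_def by (rule measure_le_bump(2)[OF mu closed_K])
          also have "\<dots> \<le> measure (\<mu> n) (C j \<union> - L)"
            using compact_imp_closed[OF C] closed_L borel_probD[OF mu]
            by (intro finite_measure_mono) (auto simp: C_def)
          also have "\<dots> \<le> measure (\<mu> n) (C j) + measure (\<mu> n) (- L)"
            using compact_imp_closed[OF C] closed_L borel_probD[OF mu] by (intro measure_Un_le) auto
          also have "measure (\<mu> n) (- L) = 1 - measure (\<mu> n) L"
            by (rule borel_prob_compl[OF mu borel_closed[OF closed_L]])
          finally have 1: "(\<integral>x. bump K j x \<partial>\<mu> n) \<le> measure (\<mu> n) (C j) + e" using L(2)[of n] by linarith
          have "measure (\<mu> n) (C j) \<le> measure (\<mu> n) (up_hull le (C j))"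
            using closed_up_hull[OF C] mu by (intro finite_measure_mono up_hull_superset) auto
          also have "\<dots> \<le> measure \<nu> (up_hull le (C j))"
            by (rule stoch_le_increasing_set[OF le mu nu up_hull_increasing[OF C]])
          finally show ?thesis using 1 by linarith
        qed
        then have "(\<integral>x. bump K j x \<partial>\<pi>) \<le> measure \<nu> (up_hull le (C j)) + e"
          by (intro LIMSEQ_le_const2[OF conv]) blast
        with measure_le_bump(1)[OF pi closed_K, of j] show ?thesis by linarith
      qed
      moreover have "(\<lambda>j. measure \<nu> (up_hull le (C j))) \<longlonglongrightarrow> measure \<nu> (\<Inter>j. up_hull le (C j))"
      proof (rule nu.finite_Lim_measure_decseq)
        show "range (\<lambda>j. up_hull le (C j)) \<subseteq> sets \<nu>" using closed_up_hull[OF C] nu by auto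
        have "1 / real (Suc n) \<le> 1 / real (Suc m)" if "m \<le> n" for m n
          using that by (intro divide_left_mono) auto
        then have "C n \<subseteq> C m" if "m \<le> n" for m n
          using that unfolding C_def N_def by (blast intro: order_trans)
        then show "decseq (\<lambda>j. up_hull le (C j))"
          unfolding decseq_def using up_hull_mono by blast
      qed
      ultimately have "measure \<pi> K - e \<le> measure \<nu> (\<Inter>j. up_hull le (C j))"
        by (intro LIMSEQ_le_const[where x="measure \<nu> (\<Inter>j. up_hull le (C j))"]) (auto simp: algebra_simps)
      also have "\<dots> \<le> measure \<nu> (up_hull le K)"
      proof (rule nu.finite_measure_mono)
        show "up_hull le K \<in> sets \<nu>" using closed_up_hull[OF K] nu by simp
        show "(\<Inter>j. up_hull le (C j)) \<subseteq> up_hull le K"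
        proof
          fix x assume "x \<in> (\<Inter>j. up_hull le (C j))"
          then have "\<forall>j. \<exists>z. z \<in> C j \<and> z \<preceq> x" by (auto simp: up_hull_def)
          then obtain z where z: "\<And>j. z j \<in> C j" "\<And>j. z j \<preceq> x" by metis
          have "\<forall>j. z j \<in> L" using z(1) by (auto simp: C_def)
          then obtain u s where u: "strict_mono (s :: nat \<Rightarrow> nat)" "(z \<circ> s) \<longlonglongrightarrow> u"
            using L(1) unfolding compact_def by blast
          have "u \<preceq> x" by (rule le_limit[OF u(2), of "\<lambda>_. x"]) (use z in auto)
          moreover have "infdist u K \<le> 0"
          proof (rule LIMSEQ_le)
            show "(\<lambda>j. infdist ((z \<circ> s) j) K) \<longlonglongrightarrow> infdist u K" by (intro tendsto_intros u(2))
            show "(\<lambda>j. inverse (real (Suc (s j)))) \<longlonglongrightarrow> 0"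
              using LIMSEQ_subseq_LIMSEQ[OF LIMSEQ_inverse_real_of_nat u(1)] by (simp add: o_def)
            show "\<exists>N. \<forall>n\<ge>N. infdist ((z \<circ> s) n) K \<le> inverse (real (Suc (s n)))"
              using z(1) unfolding C_def N_def by (simp add: inverse_eq_divide)
          qed
          then have "u \<in> K"
            using in_closed_iff_infdist_zero[OF closed_K False] infdist_nonneg[of u K] by simp
          ultimately show "x \<in> up_hull le K" by (auto simp: up_hull_def)
        qed
      qed
      finally show "measure \<pi> K \<le> measure \<nu> (up_hull le K) + e" by simp
    qed
  qed
qed

text \<open>Along the sequence the measure of a closed increasing set increases, and the limit law of a closed
set is at least the limit of its measures.\<close>

lemma increasing_le_weak_limit:
  assumes mu: "\<And>n. borel_prob (\<mu> n)" and pi: "borel_prob \<pi>"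
    and conv: "\<And>C j. (\<lambda>n. \<integral>x. bump C j x \<partial>\<mu> (r n)) \<longlonglongrightarrow> (\<integral>x. bump C j x \<partial>\<pi>)"
    and r: "strict_mono (r :: nat \<Rightarrow> nat)" and mono: "\<And>m n. m \<le> n \<Longrightarrow> stoch_le (\<mu> m) (\<mu> n)"
  shows "stoch_le (\<mu> n) \<pi>"
proof (rule stoch_leI_compact[OF mu pi])
  fix K :: "'a set" assume K: "compact K"
  interpret prob_space "\<mu> n" using borel_probD[OF mu] by simp
  let ?U = "up_hull le K"
  have U: "closed ?U" by (rule closed_up_hull[OF K])
  show "measure (\<mu> n) K \<le> measure \<pi> ?U"
  proof (cases "K = {}")
    case True
    then show ?thesis by simp
  next
    case False
    then have ne: "?U \<noteq> {}" using up_hull_superset by blast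
    have "measure (\<mu> n) K \<le> measure \<pi> {x. infdist x ?U \<le> 1 / real (Suc j)}" for j
    proof -
      have "measure (\<mu> n) K \<le> measure (\<mu> n) ?U"
        using U mu by (intro finite_measure_mono up_hull_superset) auto
      also have "\<dots> \<le> (\<integral>x. bump ?U j x \<partial>\<pi>)"
      proof (rule LIMSEQ_le_const[OF conv], intro exI allI impI)
        fix m assume "n \<le> m"
        then have "n \<le> r m" using seq_suble[OF r, of m] by simp
        then have "measure (\<mu> n) ?U \<le> measure (\<mu> (r m)) ?U"
          by (intro stoch_le_increasing_set[OF mono mu mu up_hull_increasing[OF K]])
        also have "\<dots> \<le> (\<integral>x. bump ?U j x \<partial>\<mu> (r m))" by (rule measure_le_bump(1)[OF mu U])
        finally show "measure (\<mu> n) ?U \<le> (\<integral>x. bump ?U j x \<partial>\<mu> (r m))" .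
      qed
      also have "\<dots> \<le> measure \<pi> {x. infdist x ?U \<le> 1 / real (Suc j)}" by (rule measure_le_bump(2)[OF pi U])
      finally show ?thesis .
    qed
    then show ?thesis
      by (intro LIMSEQ_le_const[OF closed_neighborhood_measure_tendsto[OF pi U ne]]) blast
  qed
qed

end

context monotone_kernel begin

section \<open>Stationary laws\<close>

definition asymptotically_equal :: bool where
  "asymptotically_equal \<longleftrightarrow> (\<forall>g\<in>increasing_functions le. \<forall>x y.
     (\<lambda>n. (transition ^^ n) g x - (transition ^^ n) g y) \<longlonglongrightarrow> 0)"

text \<open>Both integrals are asymptotic to the value at one fixed point \<open>z\<close>, by dominated convergence.\<close>

lemma iterate_integral_difference:
  assumes ae: asymptotically_equal and mu: "borel_prob \<mu>" and nu: "borel_prob \<nu>"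
    and g: "g \<in> increasing_functions le"
  shows "(\<lambda>n. (\<integral>x. (transition ^^ n) g x \<partial>\<mu>) - (\<integral>x. (transition ^^ n) g x \<partial>\<nu>)) \<longlonglongrightarrow> 0"
proof -
  fix z :: 'a
  have f: "(transition ^^ n) g \<in> unit_functions" for n by (rule iterate_unit[OF increasing_unit[OF g]])
  have "(\<lambda>n. (\<integral>x. (transition ^^ n) g x \<partial>\<mu>) - (transition ^^ n) g z) \<longlonglongrightarrow> 0"
    if mu: "borel_prob \<mu>" for \<mu>
  proof -
    interpret prob_space \<mu> using borel_probD[OF mu] by simp
    have "(\<lambda>n. \<integral>x. (transition ^^ n) g x - (transition ^^ n) g z \<partial>\<mu>) \<longlonglongrightarrow> (\<integral>x. 0 \<partial>\<mu>)"
    proof (rule integral_dominated_convergence[where w="\<lambda>_. 1"])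
      show "(\<lambda>x. (transition ^^ n) g x - (transition ^^ n) g z) \<in> borel_measurable \<mu>" for n
        using unit_functionsD(1)[OF f[of n]] by (simp add: borel_prob_measurable[OF mu])
      show "AE x in \<mu>. (\<lambda>n. (transition ^^ n) g x - (transition ^^ n) g z) \<longlonglongrightarrow> 0"
        using ae g unfolding asymptotically_equal_def by blast
      have "\<bar>(transition ^^ n) g x - (transition ^^ n) g z\<bar> \<le> 1" for n x
        using unit_functionsD(2,3)[OF f[of n], of x] unit_functionsD(2,3)[OF f[of n], of z] by linarith
      then show "AE x in \<mu>. norm ((transition ^^ n) g x - (transition ^^ n) g z) \<le> 1" for n by simp
    qed auto
    moreover have "(\<integral>x. (transition ^^ n) g x - (transition ^^ n) g z \<partial>\<mu>) = (\<integral>x. (transition ^^ n) g x \<partial>\<mu>) - (transition ^^ n) g z" for n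
      using unit_integrable[OF mu f[of n]] prob_space by simp
    ultimately show ?thesis by simp
  qed
  from tendsto_diff[OF this[OF mu] this[OF nu]] show ?thesis by simp
qed

lemma stationary_unique:
  assumes ae: asymptotically_equal and "stationary_dist P \<pi>" "stationary_dist P \<pi>'"
  shows "\<pi>' = \<pi>"
proof (rule increasing_functions_determine)
  show pi: "borel_prob \<pi>'" "borel_prob \<pi>"
    using assms by (simp_all add: stationary_dist_iff)
  fix g assume g: "g \<in> increasing_functions le"
  have "(\<lambda>n::nat. (\<integral>x. g x \<partial>\<pi>') - (\<integral>x. g x \<partial>\<pi>)) \<longlonglongrightarrow> 0"
    using iterate_integral_difference[OF ae pi g] assms(2,3)
    by (simp add: stationary_iterate increasing_unit[OF g])
  then show "(\<integral>x. g x \<partial>\<pi>') = (\<integral>x. g x \<partial>\<pi>)" by (simp add: LIMSEQ_const_iff)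
qed

text \<open>The laws \<open>\<mu> n = \<mu>0 P^n\<close> increase and stay below \<open>\<nu>0\<close>, hence are tight. A weak limit \<open>\<pi>\<close> dominates
them and satisfies \<open>\<pi> \<le> \<pi>P\<close>, while asymptotic equality forbids that the integrals of iterates of a
test function grow beyond its integral under \<open>\<pi>\<close>.\<close>

lemma stationary_exists:
  assumes ae: asymptotically_equal and bmc: "bmc le"
    and \<mu>0: "borel_prob \<mu>0" "\<And>g. g \<in> increasing_functions le \<Longrightarrow> (\<integral>x. g x \<partial>\<mu>0) \<le> (\<integral>x. transition g x \<partial>\<mu>0)"
    and \<nu>0: "borel_prob \<nu>0" "\<And>g. g \<in> increasing_functions le \<Longrightarrow> (\<integral>x. transition g x \<partial>\<nu>0) \<le> (\<integral>x. g x \<partial>\<nu>0)"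
  shows "\<exists>\<pi>. stationary_dist P \<pi>"
proof -
  let ?T = "\<lambda>n. transition ^^ n"
  define \<mu> where "\<mu> n = ((\<lambda>\<rho>. \<rho> \<bind> P) ^^ n) \<mu>0" for n
  have mu: "borel_prob (\<mu> n)" for n
    by (induction n) (auto simp: \<mu>_def \<mu>0(1) intro: bind_kernel(1))
  have \<mu>_Suc: "\<mu> (Suc n) = \<mu> n \<bind> P" for n by (simp add: \<mu>_def)
  have mu_int: "(\<integral>x. g x \<partial>\<mu> n) = (\<integral>x. ?T n g x \<partial>\<mu>0)" if "g \<in> unit_functions" for g n
    using that
  proof (induction n arbitrary: g)
    case 0
    then show ?case by (simp add: \<mu>_def)
  next
    case (Suc n)
    then show ?case
      by (simp add: \<mu>_Suc bind_kernel(2)[OF mu] transition_unit funpow_swap1)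
  qed
  have T: "?T n g \<in> increasing_functions le" if "g \<in> increasing_functions le" for n g
    by (rule iterate_increasing[OF that])
  have mu_step: "stoch_le (\<mu> n) (\<mu> (Suc n))" for n
    unfolding stoch_le_def using \<mu>0(2)[OF T] by (simp add: mu_int increasing_unit)
  have mono: "stoch_le (\<mu> m) (\<mu> n)" if "m \<le> n" for m n
    using that by (induction n rule: dec_induct) (auto intro: stoch_le_refl stoch_le_trans mu_step)
  have bdd: "stoch_le (\<mu> n) \<nu>0" for n
    unfolding stoch_le_def
  proof
    fix g assume g: "g \<in> increasing_functions le"
    have nu_le: "(\<integral>x. ?T k g x \<partial>\<nu>0) \<le> (\<integral>x. g x \<partial>\<nu>0)" for k
      by (induction k) (use \<nu>0(2)[OF T[OF g]] in \<open>auto intro: order_trans\<close>)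
    have "(\<integral>x. g x \<partial>\<mu> n) - (\<integral>x. g x \<partial>\<nu>0) \<le> (\<integral>x. ?T k g x \<partial>\<mu>0) - (\<integral>x. ?T k g x \<partial>\<nu>0)" if "n \<le> k" for k
      using mono[OF that] g nu_le[of k] unfolding stoch_le_def
      by (simp add: mu_int[OF increasing_unit[OF g], symmetric] diff_mono)
    then have "(\<integral>x. g x \<partial>\<mu> n) - (\<integral>x. g x \<partial>\<nu>0) \<le> 0"
      by (intro LIMSEQ_le_const[OF iterate_integral_difference[OF ae \<mu>0(1) \<nu>0(1) g]]) blast
    then show "(\<integral>x. g x \<partial>\<mu> n) \<le> (\<integral>x. g x \<partial>\<nu>0)" by simp
  qed
  have tight: "tight_laws \<mu>"
    by (rule bounded_increasing_tight[where \<mu>=\<mu>, OF bmc mu \<nu>0(1) mu_step bdd])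
  obtain r \<pi> where r: "strict_mono (r :: nat \<Rightarrow> nat)" and pi: "borel_prob \<pi>"
    and conv: "\<And>(f :: 'a \<Rightarrow> real) L. (\<And>x. 0 \<le> f x) \<Longrightarrow> (\<And>x. f x \<le> 1) \<Longrightarrow>
       (\<And>x y. \<bar>f x - f y\<bar> \<le> L * dist x y) \<Longrightarrow>
       (\<lambda>n. \<integral>x. f x \<partial>\<mu> (r n)) \<longlonglongrightarrow> (\<integral>x. f x \<partial>\<pi>)"
    using tight_subsequence_converges[OF mu tight] by blast
  have conv: "(\<lambda>n. \<integral>x. bump C j x \<partial>\<mu> (r n)) \<longlonglongrightarrow> (\<integral>x. bump C j x \<partial>\<pi>)" for C j
    by (rule conv[OF bump_bounds bump_Lipschitz])
  have below: "stoch_le (\<mu> n) \<pi>" for n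
    by (rule increasing_le_weak_limit[OF mu pi conv r mono])
  have "stoch_le (\<mu> n) (\<pi> \<bind> P)" for n
    using mu_step[of n] bind_stoch_le[OF below[of n] mu pi] unfolding \<mu>_Suc by (rule stoch_le_trans)
  then have up: "stoch_le \<pi> (\<pi> \<bind> P)"
    by (rule stoch_le_weak_limit[OF mu pi bind_kernel(1)[OF pi] tight conv])
  have up': "(\<integral>x. g x \<partial>\<pi>) \<le> (\<integral>x. transition g x \<partial>\<pi>)" if "g \<in> increasing_functions le" for g
    using up that bind_kernel(2)[OF pi increasing_unit[OF that]] unfolding stoch_le_def by fastforce
  have "\<pi> \<bind> P = \<pi>"
  proof (rule increasing_functions_determine[OF bind_kernel(1)[OF pi] pi])
    fix g assume g: "g \<in> increasing_functions le"
    have iter: "(\<integral>x. transition g x \<partial>\<pi>) \<le> (\<integral>x. ?T (Suc n) g x \<partial>\<pi>)" for n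
    proof (induction n)
      case (Suc n)
      have "(\<integral>x. ?T (Suc n) g x \<partial>\<pi>) \<le> (\<integral>x. ?T (Suc (Suc n)) g x \<partial>\<pi>)"
        using up'[OF T[OF g, of "Suc n"]] by simp
      with Suc show ?case by (rule order_trans)
    qed simp
    have "(\<integral>x. ?T n g x \<partial>\<mu>0) \<le> (\<integral>x. g x \<partial>\<pi>)" for n
      using below[of n] g unfolding stoch_le_def by (simp add: mu_int[OF increasing_unit[OF g], symmetric])
    then have "(\<integral>x. transition g x \<partial>\<pi>) - (\<integral>x. g x \<partial>\<pi>) \<le> (\<integral>x. ?T (Suc n) g x \<partial>\<pi>) - (\<integral>x. ?T (Suc n) g x \<partial>\<mu>0)" for n
      by (intro diff_mono iter)
    then have "(\<integral>x. transition g x \<partial>\<pi>) - (\<integral>x. g x \<partial>\<pi>) \<le> 0"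
      by (intro LIMSEQ_le_const[OF LIMSEQ_Suc[OF iterate_integral_difference[OF ae pi \<mu>0(1) g]]]) blast
    with up'[OF g] show "(\<integral>x. g x \<partial>(\<pi> \<bind> P)) = (\<integral>x. g x \<partial>\<pi>)"
      using bind_kernel(2)[OF pi increasing_unit[OF g]] by simp
  qed
  with pi show ?thesis by (auto simp: stationary_dist_iff)
qed

text \<open>The supremum over all test functions of the differences at \<open>y\<close> need not be a measurable function of
\<open>y\<close>. The sets \<open>A n\<close> where all differences are at most \<open>e / 2\<close> increase to the whole space, and the
outer measure is continuous along increasing sequences of arbitrary sets. For a single test function
the set where the difference is large is measurable and disjoint from \<open>A n\<close>, so its measure is small,
uniformly in the test function.\<close>

lemma integral_difference_uniform:
  assumes pi: "borel_prob \<pi>"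
    and unif: "\<And>y. (\<lambda>n. b y n) \<longlonglongrightarrow> 0"
    and b: "\<And>g y n. g \<in> increasing_functions le \<Longrightarrow> \<bar>(transition ^^ n) g x - (transition ^^ n) g y\<bar> \<le> b y n"
    and e: "0 < e"
  shows "eventually (\<lambda>n. \<forall>g\<in>increasing_functions le.
     (\<integral>y. \<bar>(transition ^^ n) g x - (transition ^^ n) g y\<bar> \<partial>\<pi>) \<le> e) sequentially"
proof -
  interpret prob_space \<pi> using borel_probD[OF pi] by simp
  let ?d = "\<lambda>n g y. \<bar>(transition ^^ n) g x - (transition ^^ n) g y\<bar>"
  define A where "A n = {y. \<forall>g\<in>increasing_functions le. ?d n g y \<le> e/2}" for n
  have "A n \<subseteq> A (Suc n)" for n
    unfolding A_def using transition_increasing by (auto simp: funpow_swap1)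
  then have "incseq A" by (rule incseq_SucI)
  have "\<exists>n. y \<in> A n" for y
  proof -
    have "eventually (\<lambda>n. b y n < e/2) sequentially" using e by (intro order_tendstoD(2)[OF unif]) auto
    then obtain n where "b y n < e/2" by (auto dest: eventually_happens)
    then show ?thesis unfolding A_def by (intro exI[of _ n] CollectI ballI order_trans[OF b]) auto
  qed
  then have "(\<Union>n. A n) = UNIV" by auto
  then have "(SUP n. outer_measure_of \<pi> (A n)) = 1"
    using SUP_outer_measure_of_incseq[of A \<pi>] \<open>incseq A\<close> borel_probD[OF pi] emeasure_space_1
    by (simp flip: sets.top)
  moreover have "ennreal (1 - e/2) < 1" using e by (simp add: ennreal_less_one_iff)
  ultimately obtain k where k: "ennreal (1 - e/2) < outer_measure_of \<pi> (A k)"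
    by (metis less_SUP_iff)
  have "(\<integral>y. ?d n g y \<partial>\<pi>) \<le> e" if n: "k \<le> n" and g: "g \<in> increasing_functions le" for n g
  proof -
    have f: "(transition ^^ n) g \<in> unit_functions" by (rule iterate_unit[OF increasing_unit[OF g]])
    note unit_functionsD(1)[OF f, measurable]
    define B where "B = {y. ?d n g y \<le> e/2}"
    have B: "B \<in> sets borel" unfolding B_def by measurable
    have "A k \<subseteq> A n" using \<open>incseq A\<close> n by (rule incseqD)
    also have "A n \<subseteq> B" using g by (auto simp: A_def B_def)
    finally have "outer_measure_of \<pi> (A k) \<le> outer_measure_of \<pi> B" by (rule outer_measure_of_mono)
    also have "\<dots> = ennreal (measure \<pi> B)"
      using B borel_probD[OF pi] by (simp add: emeasure_eq_measure)
    finally have "ennreal (1 - e/2) < ennreal (measure \<pi> B)" using k by simp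
    then have mB: "1 - e/2 < measure \<pi> B" by (meson ennreal_leI not_le)
    have d1: "?d n g y \<le> 1" for y
      using unit_functionsD(2,3)[OF f, of x] unit_functionsD(2,3)[OF f, of y] by linarith
    have "(\<integral>y. ?d n g y \<partial>\<pi>) \<le> (\<integral>y. e/2 + indicator (- B) y \<partial>\<pi>)"
    proof (rule integral_mono)
      show "integrable \<pi> (?d n g)" by (rule borel_prob_integrable[OF pi, of _ 1]) (use d1 in auto)
      show "integrable \<pi> (\<lambda>y. e/2 + indicator (- B) y)"
        using B by (intro Bochner_Integration.integrable_add integrable_const borel_prob_integrable[OF pi, of "indicator _" 1]) auto
      show "?d n g y \<le> e/2 + indicator (- B) y" for y
        using d1[of y] e by (cases "y \<in> B") (auto simp: B_def)
    qed
    also have "\<dots> = e/2 + measure \<pi> (- B)"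
      using B borel_probD[OF pi] prob_space
      by (subst Bochner_Integration.integral_add) (auto intro!: borel_prob_integrable[OF pi, of "indicator _" 1])
    also have "\<dots> = e/2 + (1 - measure \<pi> B)" by (simp add: borel_prob_compl[OF pi B])
    finally show ?thesis using mB by linarith
  qed
  then show ?thesis unfolding eventually_sequentially by blast
qed

text \<open>Up-hulls and complements of down-hulls of a compact set are increasing sets, whose measures
converge. So the intersection of the two hulls, compact by KS-normality, carries almost all mass from
some time on, and the finitely many earlier laws are tight one by one.\<close>

lemma ks_normal_tight:
  assumes ks: "ks_normal le" and pi: "borel_prob \<pi>" and mu: "\<And>n. borel_prob (\<mu> n)"
    and conv: "\<And>g. g \<in> increasing_functions le \<Longrightarrow> (\<lambda>n. \<integral>x. g x \<partial>\<mu> n) \<longlonglongrightarrow> (\<integral>x. g x \<partial>\<pi>)"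
  shows "tight_laws \<mu>"
  unfolding tight_laws_def
proof (intro allI impI)
  fix e :: real assume e: "0 < e"
  interpret d: ordered_space "\<lambda>x y. y \<preceq> x" by (rule dual)
  interpret pi: prob_space \<pi> using borel_probD[OF pi] by simp
  obtain K where K: "compact K" "1 - e/4 < measure \<pi> K"
    using borel_prob_compact_exhaust[OF pi, of "e/4"] e by auto
  define U where "U = up_hull le K"
  define D where "D = down_hull le K"
  have D_eq: "D = up_hull (\<lambda>x y. y \<preceq> x) K" by (auto simp: D_def down_hull_def up_hull_def)
  have U: "closed U" "U \<in> increasing_sets le" unfolding U_def
    using closed_up_hull[OF K(1)] up_hull_increasing[OF K(1)] by auto
  have D: "closed D" unfolding D_eq by (rule d.closed_up_hull[OF K(1)])
  have D': "- D \<in> increasing_sets le"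
    using D by (auto simp: increasing_sets_def D_def down_hull_def intro: le_trans)
  have set_conv: "(\<lambda>n. measure (\<mu> n) I) \<longlonglongrightarrow> measure \<pi> I" if I: "I \<in> increasing_sets le" for I
    using conv[OF indicator_increasing[OF I]] borel_probD[OF mu] borel_probD[OF pi] by simp
  have "measure \<pi> K \<le> measure \<pi> U" "measure \<pi> K \<le> measure \<pi> D"
    using U D pi up_hull_superset[of K] by (auto intro!: pi.finite_measure_mono simp: U_def D_def down_hull_def)
  then have "1 - e/4 < measure \<pi> U" "measure \<pi> (- D) < e/4"
    using K(2) borel_prob_compl[OF pi borel_closed[OF D]] by auto
  then have "eventually (\<lambda>n. 1 - e/4 < measure (\<mu> n) U \<and> measure (\<mu> n) (- D) < e/4) sequentially"
    by (intro eventually_conj order_tendstoD(1)[OF set_conv[OF U(2)]] order_tendstoD(2)[OF set_conv[OF D']])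
  then obtain N where N: "\<And>n. N \<le> n \<Longrightarrow> 1 - e/4 < measure (\<mu> n) U" "\<And>n. N \<le> n \<Longrightarrow> measure (\<mu> n) (- D) < e/4"
    unfolding eventually_sequentially by blast
  have "\<exists>L. compact L \<and> 1 - e < measure (\<mu> n) L" for n by (rule borel_prob_compact_exhaust[OF mu e])
  then obtain L where L: "\<And>n. compact (L n)" "\<And>n. 1 - e < measure (\<mu> n) (L n)" by metis
  let ?C = "(U \<inter> D) \<union> (\<Union>n<N. L n)"
  have C: "compact ?C"
    using ks K(1) L(1) unfolding ks_normal_def U_def D_def by (intro compact_Un compact_UN) auto
  have "1 - e \<le> measure (\<mu> n) ?C" for n
  proof -
    interpret prob_space "\<mu> n" using borel_probD[OF mu] by simp
    have sub: "measure (\<mu> n) S \<le> measure (\<mu> n) ?C" if "S \<subseteq> ?C" for S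
      using that compact_imp_closed[OF C] mu by (intro finite_measure_mono) auto
    show ?thesis
    proof (cases "n < N")
      case True
      then have "L n \<subseteq> ?C" by blast
      from sub[OF this] L(2)[of n] show ?thesis by linarith
    next
      case False
      have "measure (\<mu> n) U \<le> measure (\<mu> n) ((U \<inter> D) \<union> - D)"
        using U D borel_probD[OF mu] by (intro finite_measure_mono) auto
      also have "\<dots> \<le> measure (\<mu> n) (U \<inter> D) + measure (\<mu> n) (- D)"
        using U D borel_probD[OF mu] by (intro measure_Un_le) auto
      finally show ?thesis using N[of n] False sub[of "U \<inter> D"] e by auto
    qed
  qed
  with C show "\<exists>K. compact K \<and> (\<forall>n. 1 - e \<le> measure (\<mu> n) K)" by blast
qed

end

section \<open>Convergence to the stationary law\<close>

context monotone_kernel begin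

lemma chain_expectation:
  assumes "markov_chain P x \<Omega> X" "g \<in> unit_functions"
  shows "(\<integral>\<omega>. g (X n \<omega>) \<partial>\<Omega>) = (transition ^^ n) g x"
  using assms by (intro evolve_law[where Z=X]) (auto simp: markov_chain_def)

lemma achieves_bound:
  assumes ach: "achieves P (order_graph le) \<Omega> Z" and g: "g \<in> increasing_functions le"
  shows "\<bar>(transition ^^ n) g x - (transition ^^ n) g y\<bar>
    \<le> max (tail_prob (\<Omega> x y) (Z x y) (order_graph le) n) (tail_prob (\<Omega> y x) (Z y x) (order_graph le) n)"
proof -
  have "mm_coupling P x y (\<Omega> x y) (Z x y)" for x y using ach by (simp add: achieves_def)
  from coupling_bound[OF this g, of n x y] coupling_bound[OF this g, of n y x]
  show ?thesis by linarith
qed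

lemma achieves_tail_tendsto_0:
  assumes "achieves P (order_graph le) \<Omega> Z"
  shows "(\<lambda>n. max (tail_prob (\<Omega> x y) (Z x y) (order_graph le) n) (tail_prob (\<Omega> y x) (Z y x) (order_graph le) n)) \<longlonglongrightarrow> 0"
proof -
  have "(\<lambda>n. tail_prob (\<Omega> x y) (Z x y) (order_graph le) n) \<longlonglongrightarrow> 0" for x y
    using assms by (intro tail_prob_tendsto_0) (auto simp: achieves_def mm_coupling_def)
  from tendsto_max[OF this[of x y] this[of y x]] show ?thesis by simp
qed

lemma achieves_asymptotically_equal:
  assumes "achieves P (order_graph le) \<Omega> Z" shows asymptotically_equal
  unfolding asymptotically_equal_def
proof (intro ballI allI)
  fix g x y assume "g \<in> increasing_functions le"
  then show "(\<lambda>n. (transition ^^ n) g x - (transition ^^ n) g y) \<longlonglongrightarrow> 0"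
    by (intro Lim_null_comparison[OF _ achieves_tail_tendsto_0[OF assms, of x y]] always_eventually allI)
      (simp add: achieves_bound[OF assms])
qed

text \<open>The second measure is the cycle measure of the chain started at \<open>y0\<close> for the reversed order, whose
test functions are the functions \<open>1 - g\<close>.\<close>

lemma pr_cond_measures:
  assumes ch: "\<And>x. markov_chain P x (\<Omega> x) (X x)" and pr: "pr_cond le \<Omega> X"
  shows "\<exists>\<mu>\<in>space (prob_algebra borel). \<forall>g\<in>increasing_functions le. (\<integral>x. g x \<partial>\<mu>) \<le> (\<integral>x. transition g x \<partial>\<mu>)"
    and "\<exists>\<nu>\<in>space (prob_algebra borel). \<forall>g\<in>increasing_functions le. (\<integral>x. transition g x \<partial>\<nu>) \<le> (\<integral>x. g x \<partial>\<nu>)"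
proof -
  obtain x0 y0 where
    x0: "(\<integral>\<^sup>+\<omega>. ennreal_of_enat (first_hit 1 (X x0) {z. x0 \<preceq> z} \<omega>) \<partial>\<Omega> x0) < \<infinity>" and
    y0: "(\<integral>\<^sup>+\<omega>. ennreal_of_enat (first_hit 1 (X y0) {z. z \<preceq> y0} \<omega>) \<partial>\<Omega> y0) < \<infinity>"
    using pr unfolding pr_cond_def by blast
  show "\<exists>\<mu>\<in>space (prob_algebra borel). \<forall>g\<in>increasing_functions le. (\<integral>x. g x \<partial>\<mu>) \<le> (\<integral>x. transition g x \<partial>\<mu>)"
    by (rule cycle_measure[OF ch x0])
  interpret d: monotone_kernel "\<lambda>x y. y \<preceq> x" P by (rule dual_monotone)
  obtain \<nu> where nu: "borel_prob \<nu>"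
    and le: "\<And>g. g \<in> increasing_functions (\<lambda>x y. y \<preceq> x) \<Longrightarrow> (\<integral>x. g x \<partial>\<nu>) \<le> (\<integral>x. transition g x \<partial>\<nu>)"
    using d.cycle_measure[OF ch y0] by blast
  interpret prob_space \<nu> using borel_probD[OF nu] by simp
  have "(\<integral>x. transition g x \<partial>\<nu>) \<le> (\<integral>x. g x \<partial>\<nu>)" if g: "g \<in> increasing_functions le" for g
  proof -
    have gu: "g \<in> unit_functions" by (rule increasing_unit[OF g])
    have "transition (\<lambda>x. 1 - g x) = (\<lambda>x. 1 - transition g x)"
      by (rule transition_complement[OF gu])
    with le[OF reverse_increasing'[OF g]] show ?thesis
      using unit_integrable[OF nu gu] unit_integrable[OF nu transition_unit[OF gu]] prob_space by simp
  qed
  with nu show "\<exists>\<nu>\<in>space (prob_algebra borel). \<forall>g\<in>increasing_functions le. (\<integral>x. transition g x \<partial>\<nu>) \<le> (\<integral>x. g x \<partial>\<nu>)"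
    by blast
qed

text \<open>A stationary law satisfies \<open>\<integral> g d\<pi> = \<integral> T^n g d\<pi>\<close>, so the deviation at \<open>x\<close> is an average of
differences between two starting points.\<close>

lemma stationary_deviation:
  assumes st: "stationary_dist P \<pi>" and g: "g \<in> unit_functions"
  shows "integrable \<pi> (\<lambda>y. \<bar>(transition ^^ n) g x - (transition ^^ n) g y\<bar>)"
    and "\<bar>(transition ^^ n) g x - (\<integral>y. g y \<partial>\<pi>)\<bar> \<le> (\<integral>y. \<bar>(transition ^^ n) g x - (transition ^^ n) g y\<bar> \<partial>\<pi>)"
    and "(\<integral>y. \<bar>(transition ^^ n) g x - (transition ^^ n) g y\<bar> \<partial>\<pi>) \<le> 1"
proof -
  have pi: "borel_prob \<pi>" using st by (simp add: stationary_dist_iff)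
  interpret prob_space \<pi> using borel_probD[OF pi] by simp
  have f: "(transition ^^ n) g \<in> unit_functions" by (rule iterate_unit[OF g])
  have int: "integrable \<pi> ((transition ^^ n) g)" by (rule unit_integrable[OF pi f])
  then show i: "integrable \<pi> (\<lambda>y. \<bar>(transition ^^ n) g x - (transition ^^ n) g y\<bar>)" by simp
  have "(transition ^^ n) g x - (\<integral>y. g y \<partial>\<pi>) = (\<integral>y. (transition ^^ n) g x - (transition ^^ n) g y \<partial>\<pi>)"
    using int prob_space by (simp add: stationary_iterate[OF st g])
  then show "\<bar>(transition ^^ n) g x - (\<integral>y. g y \<partial>\<pi>)\<bar> \<le> (\<integral>y. \<bar>(transition ^^ n) g x - (transition ^^ n) g y\<bar> \<partial>\<pi>)"
    by (simp add: integral_abs_bound)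
  have "\<bar>(transition ^^ n) g x - (transition ^^ n) g y\<bar> \<le> 1" for y
    using unit_functionsD(2,3)[OF f, of x] unit_functionsD(2,3)[OF f, of y] by linarith
  then show "(\<integral>y. \<bar>(transition ^^ n) g x - (transition ^^ n) g y\<bar> \<partial>\<pi>) \<le> 1"
    by (intro integral_le_const i) auto
qed

end

text \<open>The deviation from \<open>\<pi>\<close> at a starting point is at most the average of the differences to a second,
\<open>\<pi>\<close>-distributed starting point. These averages tend to zero uniformly over the test functions, and
the tail probabilities bound them, hence so does \<open>\<beta>\<close>.\<close>

theorem theorem6p1:
  fixes le :: "'a::polish_space \<Rightarrow> 'a \<Rightarrow> bool"
    and P :: "'a \<Rightarrow> 'a measure"
    and \<Omega> :: "'a \<Rightarrow> 'w measure" and X :: "'a \<Rightarrow> nat \<Rightarrow> 'w \<Rightarrow> 'a"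
    and \<Omega>c :: "'a \<Rightarrow> 'a \<Rightarrow> 'c measure" and Z :: "'a \<Rightarrow> 'a \<Rightarrow> nat \<Rightarrow> 'c \<Rightarrow> 'a \<times> 'a"
  defines "\<G> \<equiv> increasing_functions le"
    and "Eg \<equiv> \<lambda>(g :: 'a \<Rightarrow> real) x n. \<integral>\<omega>. g (X x n \<omega>) \<partial>\<Omega> x"
    and "law \<equiv> \<lambda>x n. distr (\<Omega> x) borel (X x n)"
    and "tail \<equiv> \<lambda>x y n. tail_prob (\<Omega>c x y) (Z x y) (order_graph le) n"
  assumes "ordered_polish le"
    and "markov_kernel P"
    and "stoch_monotone le P"
    and "\<And>x. markov_chain P x (\<Omega> x) (X x)"
    and "bmc le"
    and "pr_cond le \<Omega> X"
    and "achieves P (order_graph le) \<Omega>c Z"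
  shows "\<exists>\<pi>. stationary_dist P \<pi> \<and> (\<forall>\<pi>'. stationary_dist P \<pi>' \<longrightarrow> \<pi>' = \<pi>) \<and>
    (\<forall>x y. (\<forall>n. (SUP g\<in>\<G>. \<bar>Eg g x n - Eg g y n\<bar>) \<le> max (tail x y n) (tail y x n)) \<and>
           (\<lambda>n. max (tail x y n) (tail y x n)) \<longlonglongrightarrow> 0) \<and>
    (\<forall>x. convergent (\<lambda>n. SUP g\<in>\<G>. \<bar>Eg g x n - (\<integral>y. g y \<partial>\<pi>)\<bar>) \<and>
         lim (\<lambda>n. SUP g\<in>\<G>. \<bar>Eg g x n - (\<integral>y. g y \<partial>\<pi>)\<bar>)
           \<le> lim (\<lambda>n. SUP g\<in>\<G>. \<integral>y. \<bar>Eg g x n - Eg g y n\<bar> \<partial>\<pi>) \<and>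
         (\<lambda>n. SUP g\<in>\<G>. \<integral>y. \<bar>Eg g x n - Eg g y n\<bar> \<partial>\<pi>) \<longlonglongrightarrow> 0) \<and>
    (ks_normal le \<longrightarrow> (\<forall>y. weakly_converges (law y) \<pi>)) \<and>
    (\<forall>x. tight_laws (law x) \<longrightarrow> weakly_converges (law x) \<pi>) \<and>
    (\<forall>\<beta> :: nat \<Rightarrow> real. (\<forall>n. (SUP (x, y)\<in>UNIV. tail x y n) \<le> \<beta> n) \<longrightarrow>
       (\<forall>x n. (SUP g\<in>\<G>. \<bar>Eg g x n - (\<integral>y. g y \<partial>\<pi>)\<bar>) \<le> \<beta> n \<and>
              (SUP I\<in>increasing_sets le.
                 \<bar>measure (\<Omega> x) {\<omega> \<in> space (\<Omega> x). X x n \<omega> \<in> I} - measure \<pi> I\<bar>) \<le> \<beta> n))"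
proof -
  have "monotone_kernel le P"
    using assms by (simp add: monotone_kernel_def ordered_space_def borel_kernel_def monotone_kernel_axioms_def)
  then interpret monotone_kernel le P .
  let ?T = "\<lambda>n. transition ^^ n"
  note ch = \<open>\<And>x. markov_chain P x (\<Omega> x) (X x)\<close> and ach = \<open>achieves P (order_graph le) \<Omega>c Z\<close>
  have X: "X x n \<in> borel_measurable (\<Omega> x)" "prob_space (\<Omega> x)" for x n
    using ch by (simp_all add: markov_chain_def)
  have Eg: "Eg g x n = ?T n g x" if "g \<in> unit_functions" for g x n
    unfolding Eg_def by (rule chain_expectation[OF ch that])
  have Eg_inc: "Eg g x n = ?T n g x" if "g \<in> \<G>" for g x n
    using that by (intro Eg increasing_unit) (simp add: \<G>_def)
  have zero: "(\<lambda>_. 0) \<in> \<G>" unfolding \<G>_def by (rule increasing_functions_const) auto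
  then have ne: "\<G> \<noteq> {}" by blast
  let ?b = "\<lambda>x y n. max (tail x y n) (tail y x n)"
  have bound: "\<bar>Eg g x n - Eg g y n\<bar> \<le> ?b x y n" if "g \<in> \<G>" for g x y n
    using achieves_bound[OF ach, of g n x y] that Eg_inc[OF that] by (simp add: tail_def \<G>_def)
  have b_lim: "?b x y \<longlonglongrightarrow> 0" for x y
    using achieves_tail_tendsto_0[OF ach, of x y] by (simp add: tail_def)
  have ae: asymptotically_equal by (rule achieves_asymptotically_equal[OF ach])
  obtain \<mu>0 where \<mu>0: "borel_prob \<mu>0"
    "\<And>g. g \<in> increasing_functions le \<Longrightarrow> (\<integral>x. g x \<partial>\<mu>0) \<le> (\<integral>x. transition g x \<partial>\<mu>0)"
    using pr_cond_measures(1)[OF ch \<open>pr_cond le \<Omega> X\<close>] by blast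
  obtain \<nu>0 where \<nu>0: "borel_prob \<nu>0"
    "\<And>g. g \<in> increasing_functions le \<Longrightarrow> (\<integral>x. transition g x \<partial>\<nu>0) \<le> (\<integral>x. g x \<partial>\<nu>0)"
    using pr_cond_measures(2)[OF ch \<open>pr_cond le \<Omega> X\<close>] by blast
  obtain \<pi> where st: "stationary_dist P \<pi>"
    using stationary_exists[OF ae \<open>bmc le\<close> \<mu>0 \<nu>0] by blast
  have pi: "borel_prob \<pi>" using st by (simp add: stationary_dist_iff)
  interpret pi: prob_space \<pi> using borel_probD[OF pi] by simp

  define S where "S x n = (SUP g\<in>\<G>. \<integral>y. \<bar>Eg g x n - Eg g y n\<bar> \<partial>\<pi>)" for x n
  define D where "D x n = (SUP g\<in>\<G>. \<bar>Eg g x n - (\<integral>y. g y \<partial>\<pi>)\<bar>)" for x n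
  have Eg_int: "(\<integral>y. \<bar>Eg g x n - Eg g y n\<bar> \<partial>\<pi>) = (\<integral>y. \<bar>?T n g x - ?T n g y\<bar> \<partial>\<pi>)" if "g \<in> \<G>" for g x n
    by (simp only: Eg_inc[OF that])
  have unit: "g \<in> unit_functions" if "g \<in> \<G>" for g
    using that by (intro increasing_unit) (simp add: \<G>_def)
  have dev: "\<bar>Eg g x n - (\<integral>y. g y \<partial>\<pi>)\<bar> \<le> (\<integral>y. \<bar>Eg g x n - Eg g y n\<bar> \<partial>\<pi>)"
    and int_le_1: "(\<integral>y. \<bar>Eg g x n - Eg g y n\<bar> \<partial>\<pi>) \<le> 1"
    and int: "integrable \<pi> (\<lambda>y. \<bar>Eg g x n - Eg g y n\<bar>)" if "g \<in> \<G>" for g x n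
    using stationary_deviation[OF st unit[OF that], of n x] by (simp_all only: Eg_inc[OF that])
  have bdd_S: "bdd_above ((\<lambda>g. \<integral>y. \<bar>Eg g x n - Eg g y n\<bar> \<partial>\<pi>) ` \<G>)" for x n
    using int_le_1 by (intro bdd_aboveI2[where M=1]) auto
  have bdd_D: "bdd_above ((\<lambda>g. \<bar>Eg g x n - (\<integral>y. g y \<partial>\<pi>)\<bar>) ` \<G>)" for x n
    using order_trans[OF dev int_le_1] by (intro bdd_aboveI2[where M=1]) auto
  have S_nonneg: "0 \<le> S x n" for x n
    unfolding S_def by (rule cSUP_upper2[OF bdd_S zero]) simp
  have D_nonneg: "0 \<le> D x n" for x n
    unfolding D_def by (rule cSUP_upper2[OF bdd_D zero]) simp
  have D_le_S: "D x n \<le> S x n" for x n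
    unfolding D_def S_def by (rule cSUP_mono[OF ne bdd_S]) (use dev in blast)
  have S_lim: "S x \<longlonglongrightarrow> 0" for x
  proof (rule tendstoI)
    fix e :: real assume e: "0 < e"
    have "eventually (\<lambda>n. \<forall>g\<in>increasing_functions le. (\<integral>y. \<bar>?T n g x - ?T n g y\<bar> \<partial>\<pi>) \<le> e/2) sequentially"
    proof (rule integral_difference_uniform[OF pi b_lim[of x] _ half_gt_zero[OF e]])
      show "\<bar>?T n g x - ?T n g y\<bar> \<le> ?b x y n" if "g \<in> increasing_functions le" for g y n
        using bound[of g x n y] Eg_inc[of g] that by (simp add: \<G>_def)
    qed
    then show "eventually (\<lambda>n. dist (S x n) 0 < e) sequentially"
    proof eventually_elim
      case (elim n)
      have "S x n \<le> e/2"
        unfolding S_def by (rule cSUP_least[OF ne]) (use elim Eg_int in \<open>auto simp: \<G>_def\<close>)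
      then show ?case using S_nonneg[of x n] e by simp
    qed
  qed
  have D_lim: "D x \<longlonglongrightarrow> 0" for x
    by (rule tendsto_sandwich[OF _ _ tendsto_const S_lim[of x]]) (auto simp: D_nonneg D_le_S)
  have law: "borel_prob (law x n)" for x n
    unfolding law_def using X by (intro borel_probI prob_space.prob_space_distr) auto
  have law_lim: "(\<lambda>n. \<integral>z. g z \<partial>law x n) \<longlonglongrightarrow> (\<integral>z. g z \<partial>\<pi>)" if g: "g \<in> increasing_functions le" for g x
  proof -
    have gG: "g \<in> \<G>" using g by (simp add: \<G>_def)
    have "(\<integral>z. g z \<partial>law x n) = Eg g x n" for n
      unfolding law_def Eg_def by (rule integral_distr[OF X(1) increasing_functionsD(1)[OF g]])
    moreover have "(\<lambda>n. Eg g x n - (\<integral>z. g z \<partial>\<pi>)) \<longlonglongrightarrow> 0"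
      by (rule Lim_null_comparison[OF _ D_lim[of x]])
        (use cSUP_upper[OF gG bdd_D, of x] in \<open>auto simp: D_def\<close>)
    ultimately show ?thesis by (simp add: LIM_zero_iff)
  qed
  have weak: "weakly_converges (law x) \<pi>" if "tight_laws (law x)" for x
    by (rule tight_converges_weakly[OF law pi law_lim that])
  have rate: "D x n \<le> \<beta> n \<and> (SUP I\<in>increasing_sets le.
      \<bar>measure (\<Omega> x) {\<omega> \<in> space (\<Omega> x). X x n \<omega> \<in> I} - measure \<pi> I\<bar>) \<le> \<beta> n"
    if \<beta>: "\<And>n. (SUP (x, y)\<in>UNIV. tail x y n) \<le> \<beta> n" for \<beta> x n
  proof -
    have "prob_space (\<Omega>c u v)" for u v using ach by (simp add: achieves_def mm_coupling_def)
    then have "bdd_above ((\<lambda>(u, v). tail u v n) ` UNIV)"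
      unfolding tail_def by (intro bdd_aboveI2[where M=1]) (auto intro: tail_prob_le_1)
    then have "tail u v n \<le> \<beta> n" for u v
      using cSUP_upper[of "(u, v)" UNIV "\<lambda>(u, v). tail u v n"] \<beta>[of n] by simp
    then have b\<beta>: "?b u v n \<le> \<beta> n" for u v by simp
    have g_le: "\<bar>Eg g x n - (\<integral>y. g y \<partial>\<pi>)\<bar> \<le> \<beta> n" if g: "g \<in> \<G>" for g
    proof -
      have "(\<integral>y. \<bar>Eg g x n - Eg g y n\<bar> \<partial>\<pi>) \<le> \<beta> n"
        using order_trans[OF bound[OF g] b\<beta>] by (intro pi.integral_le_const int[OF g]) auto
      with dev[OF g, of x n] show ?thesis by linarith
    qed
    have "\<bar>measure (\<Omega> x) {\<omega> \<in> space (\<Omega> x). X x n \<omega> \<in> I} - measure \<pi> I\<bar> \<le> \<beta> n"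
      if I: "I \<in> increasing_sets le" for I
    proof -
      have Ib: "I \<in> sets borel" using I by (simp add: increasing_sets_def)
      have "{\<omega> \<in> space (\<Omega> x). X x n \<omega> \<in> I} \<in> sets (\<Omega> x)"
        using measurable_sets[OF X(1) Ib] by (simp add: vimage_def Int_def conj_commute)
      then have "measure (\<Omega> x) {\<omega> \<in> space (\<Omega> x). X x n \<omega> \<in> I}
          = (\<integral>\<omega>. indicator {\<omega> \<in> space (\<Omega> x). X x n \<omega> \<in> I} \<omega> \<partial>\<Omega> x)"
        by (subst Bochner_Integration.integral_indicator) (auto intro!: arg_cong[where f="measure _"])
      also have "\<dots> = Eg (indicator I) x n"
        unfolding Eg_def by (intro Bochner_Integration.integral_cong) (auto simp: indicator_def)
      finally have "measure (\<Omega> x) {\<omega> \<in> space (\<Omega> x). X x n \<omega> \<in> I} = Eg (indicator I) x n" .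
      moreover have "measure \<pi> I = (\<integral>y. indicator I y \<partial>\<pi>)"
        using Ib borel_probD[OF pi] by simp
      moreover have "indicator I \<in> \<G>" unfolding \<G>_def by (rule indicator_increasing[OF I])
      ultimately show ?thesis using g_le[of "indicator I"] by simp
    qed
    moreover have "increasing_sets le \<noteq> {}" unfolding increasing_sets_def by blast
    ultimately show ?thesis
      unfolding D_def using g_le ne by (auto intro!: cSUP_least)
  qed
  show ?thesis
  proof (intro exI[of _ \<pi>] conjI allI impI)
    show "stationary_dist P \<pi>" by (rule st)
    show "\<pi>' = \<pi>" if "stationary_dist P \<pi>'" for \<pi>' by (rule stationary_unique[OF ae st that])
    show "(SUP g\<in>\<G>. \<bar>Eg g x n - Eg g y n\<bar>) \<le> ?b x y n" for x y n
      by (rule cSUP_least[OF ne bound])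
    show "?b x y \<longlonglongrightarrow> 0" for x y by (rule b_lim)
    show "convergent (\<lambda>n. SUP g\<in>\<G>. \<bar>Eg g x n - (\<integral>y. g y \<partial>\<pi>)\<bar>)" for x
      using convergentI[OF D_lim[of x]] by (simp add: D_def[abs_def])
    show "lim (\<lambda>n. SUP g\<in>\<G>. \<bar>Eg g x n - (\<integral>y. g y \<partial>\<pi>)\<bar>)
        \<le> lim (\<lambda>n. SUP g\<in>\<G>. \<integral>y. \<bar>Eg g x n - Eg g y n\<bar> \<partial>\<pi>)" for x
      using limI[OF D_lim[of x]] limI[OF S_lim[of x]] by (simp add: D_def[abs_def] S_def[abs_def])
    show "(\<lambda>n. SUP g\<in>\<G>. \<integral>y. \<bar>Eg g x n - Eg g y n\<bar> \<partial>\<pi>) \<longlonglongrightarrow> 0" for x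
      using S_lim[of x] by (simp add: S_def[abs_def])
    show "weakly_converges (law y) \<pi>" if "ks_normal le" for y
      by (rule weak[OF ks_normal_tight[OF that pi law law_lim]])
    show "weakly_converges (law x) \<pi>" if "tight_laws (law x)" for x by (rule weak[OF that])
    show "(SUP g\<in>\<G>. \<bar>Eg g x n - (\<integral>y. g y \<partial>\<pi>)\<bar>) \<le> \<beta> n"
      if "\<forall>n. (SUP (x, y)\<in>UNIV. tail x y n) \<le> \<beta> n" for \<beta> x n
      using rate[of \<beta> x n] that by (simp add: D_def)
    show "(SUP I\<in>increasing_sets le. \<bar>measure (\<Omega> x) {\<omega> \<in> space (\<Omega> x). X x n \<omega> \<in> I} - measure \<pi> I\<bar>) \<le> \<beta> n"
      if "\<forall>n. (SUP (x, y)\<in>UNIV. tail x y n) \<le> \<beta> n" for \<beta> x n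
      using rate[of \<beta> x n] that by simp
  qed
qed

end
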